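(* Suppose the assumptions on $f$ stated in the context hold. Fix $x_0,y_{-1}$. There exist positive constants $\xi,\theta$ independent of $\epsilon$ such that, for any target accuracy $\epsilon>0$, if $\{x_t\}$ is a sequence generated by the LMNegCur algorithm (see context) with $$\epsilon_1=\min\Big\{\frac1{36},\frac{\sqrt{L_2}}{12L_1}\Big\}\epsilon^{3/2},\qquad\epsilon_2=\frac{\sqrt{L_2}}{18}\epsilon^{1/2},$$ $\eta_y=1/\ell$, momentum parameter $\frac{\sqrt\kappa-1}{\sqrt\kappa+1}$, and $$N_0\ge 2\sqrt\kappa\ln\frac{\sqrt{\kappa+1}\,\|y_{-1}-y^*(x_0)\|}{A},\qquad N_t\ge 2\sqrt\kappa\ln\frac{\sqrt{\kappa+1}\,(A+\kappa\|s_{t-1}\|)}{A}\ (t\ge1),\qquad A=\min\{\epsilon_1/\ell,\ \epsilon_2/(2L_H)\},$$ then $T(\epsilon):=\min\{t:\ \|\nabla P(x_t)\|\le\xi\epsilon\ \text{and}\ \nabla^2P(x_t)\succeq-\theta\sqrt\epsilon I\}$ satisfies $$T(\epsilon)\le\bar C_1\epsilon^{-3/2}\ln\epsilon^{-1}+\bar C_2\epsilon^{-3/2}+1=\tilde{\mathcal O}(\ell^{1.5}\rho^{0.5}\mu^{-1.5}\epsilon^{-1.5}),$$ and, when the lower bounds on the $N_t$ are taken with equality (integer rounding of $N_t$ disregarded), $$\sum_{t=0}^{T(\epsilon)}N_t\le2\sqrt\kappa\ln\frac{\sqrt{\kappa+1}\,\|y_{-1}-y^*(x_0)\|}{A}+2\sqrt\kappa\,T(\epsilon)\ln\frac{\sqrt{\kappa+1}\,(A+2\kappa\sqrt{\bar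 G}/\sqrt{L_2})}{A},$$ where $\bar C_1=36\sqrt{L_2}(P(x_0)-P^* )/\ln2$, $\bar C_2=(\ln\bar G+\ln2)\bar C_1$, $\bar G=\max\big\{\frac{41}{9}\bar C,\ 1+\frac{L_1}{\sqrt{L_2}}\bar C^{1/2}+\bar C,\ 2+\frac{L_1}{\sqrt{L_2}}\big\}$ and $\bar C=\big(36\sqrt{L_2}(P(x_0)-P^* )\big)^{2/3}$.
   Context: Setting. $f:\mathbb{R}^n\times\mathbb{R}^m\to\mathbb{R}$ is continuously differentiable and, for every $x$, $f(x,\cdot)$ is $\mu$-strongly concave ($\mu>0$). Assumptions: (i) $\|\nabla f(x,y)-\nabla f(x',y')\|\le\ell\|(x,y)-(x',y')\|$ for all $(x,y),(x',y')$; (ii) the second-order partial derivative matrices $\nabla^2_{xx}f,\nabla^2_{xy}f,\nabla^2_{yx}f,\nabla^2_{yy}f$ are $\rho$-Lipschitz continuous in $(x,y)$; (iii) $P(x)=\max_{y\in\mathbb{R}^m}f(x,y)$ is bounded below by a constant $P^*$. $\|\cdot\|$ is the Euclidean norm of vectors and the spectral norm of matrices. Notation. $y^*(x)=\arg\max_{y}f(x,y)$; $\kappa=\ell/\mu$; $L_1=(\kappa+1)\ell$; $L_2=\rho(1+\kappa)^3$; $L_H=\rho(1+\kappa)^2$; $H(x,y)=[\nabla^2_{xx}f-\nabla^2_{xy}f(\nabla^2_{yy}f)^{-1}\nabla^2_{yx}f](x,y)$. $\tilde{\mathcal O}(\cdot)$ hides absolute constants and logarithmic factors; here $P(x_0)-P^*$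 is also treated as a constant. LMNegCur algorithm. Input $x_0,y_{-1}$ and parameters $\eta_y,\theta_y$ (momentum), $N_t,\epsilon$. For $t=0,1,2,\dots$: (1) set $y^t_0=\tilde y^t_0=y_{t-1}$; for $k=0,\dots,N_t-1$ set $y^t_{k+1}=\tilde y^t_k+\eta_y\nabla_yf(x_t,\tilde y^t_k)$ and $\tilde y^t_{k+1}=y^t_{k+1}+\theta_y(y^t_{k+1}-y^t_k)$; set $y_t=y^t_{N_t}$. (2) Set $g_t=\nabla_xf(x_t,y_t)$, $H_t=H(x_t,y_t)$. (3) Compute $u_t$ with $\lambda_{\min}(H_t)=u_t^\top H_tu_t$, $\|u_t\|=1$, $g_t^\top u_t\le0$. If $\lambda_{\min}(H_t)\le-\frac12\sqrt{L_2\max\{\|g_t\|,\epsilon\}}$, set $s_t=\sqrt{\max\{\|g_t\|,\epsilon\}/L_2}\,u_t$. Otherwise, if $\|g_t\|\ge\epsilon$, let $s_t$ solve $(H_t+\sqrt{L_2\|g_t\|}I)s_t=-g_t$; otherwise stop and output $(x_t,y_t)$. (4) Set $x_{t+1}=x_t+s_t$. *)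

theory Defs
  imports "HOL-Analysis.Analysis"
begin

definition grad :: "('a::real_inner \<Rightarrow> real) \<Rightarrow> 'a \<Rightarrow> 'a" where
  "grad f x = (THE D. GDERIV f x :> D)"

definition hess :: "(real^'n \<Rightarrow> real) \<Rightarrow> real^'n \<Rightarrow> real^'n^'n" where
  "hess f x = jacobian (grad f) (at x)"

definition grad_x :: "((real^'n) \<times> (real^'m) \<Rightarrow> real) \<Rightarrow> real^'n \<Rightarrow> real^'m \<Rightarrow> real^'n" where
  "grad_x f x y = grad (\<lambda>x'. f (x', y)) x"

definition grad_y :: "((real^'n) \<times> (real^'m) \<Rightarrow> real) \<Rightarrow> real^'n \<Rightarrow> real^'m \<Rightarrow> real^'m" where
  "grad_y f x y = grad (\<lambda>y'. f (x, y')) y"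

definition hess_xx :: "((real^'n) \<times> (real^'m) \<Rightarrow> real) \<Rightarrow> (real^'n) \<times> (real^'m) \<Rightarrow> real^'n^'n" where
  "hess_xx f z = jacobian (\<lambda>x'. grad_x f x' (snd z)) (at (fst z))"

text \<open>Mixed blocks: the first subscript is the variable of the inner gradient, so the
  \<open>xy\<close>-block has one row per coordinate of \<open>x\<close>, and the \<open>yx\<close>-block one row per
  coordinate of \<open>y\<close>.\<close>

definition hess_xy :: "((real^'n) \<times> (real^'m) \<Rightarrow> real) \<Rightarrow> (real^'n) \<times> (real^'m) \<Rightarrow> real^'m^'n" where
  "hess_xy f z = jacobian (\<lambda>y'. grad_x f (fst z) y') (at (snd z))"

definition hess_yx :: "((real^'n) \<times> (real^'m) \<Rightarrow> real) \<Rightarrow> (real^'n) \<times> (real^'m) \<Rightarrow> real^'n^'m" where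
  "hess_yx f z = jacobian (\<lambda>x'. grad_y f x' (snd z)) (at (fst z))"

definition hess_yy :: "((real^'n) \<times> (real^'m) \<Rightarrow> real) \<Rightarrow> (real^'n) \<times> (real^'m) \<Rightarrow> real^'m^'m" where
  "hess_yy f z = jacobian (\<lambda>y'. grad_y f (fst z) y') (at (snd z))"

text \<open>The four second-order partial derivative matrices exist everywhere. (\<open>jacobian\<close> is a
  total function, so this has to be stated separately.)\<close>

definition second_partials_exist :: "((real^'n) \<times> (real^'m) \<Rightarrow> real) \<Rightarrow> bool" where
  "second_partials_exist f \<longleftrightarrow> (\<forall>x y.
      (\<lambda>x'. grad_x f x' y) differentiable (at x) \<and>
      (\<lambda>y'. grad_x f x y') differentiable (at y) \<and>
      (\<lambda>x'. grad_y f x' y) differentiable (at x) \<and>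
      (\<lambda>y'. grad_y f x y') differentiable (at y))"

text \<open>Lipschitz continuity in the spectral norm. The norm of the type \<open>real^'k^'l\<close> is the
  Frobenius norm, which is why \<open>lipschitz_on\<close> is not used for matrix-valued maps.\<close>

definition spectral_lipschitz :: "real \<Rightarrow> ('a::metric_space \<Rightarrow> real^'k^'l) \<Rightarrow> bool" where
  "spectral_lipschitz \<rho> M \<longleftrightarrow> (\<forall>z z'. onorm ((*v) (M z - M z')) \<le> \<rho> * dist z z')"

definition lambda_min :: "real^'n^'n \<Rightarrow> real" where
  "lambda_min M = (LEAST a. \<exists>v. v \<noteq> 0 \<and> M *v v = a *\<^sub>R v)"

definition loewner_le :: "real^'n^'n \<Rightarrow> real^'n^'n \<Rightarrow> bool" where
  "loewner_le M M' \<longleftrightarrow>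
     transpose (M' - M) = M' - M \<and> (\<forall>v. 0 \<le> v \<bullet> ((M' - M) *v v))"

definition strongly_concave :: "real \<Rightarrow> ('a::real_normed_vector \<Rightarrow> real) \<Rightarrow> bool" where
  "strongly_concave \<mu> h \<longleftrightarrow> (\<forall>y y'. \<forall>t\<in>{0..1}.
     h (t *\<^sub>R y + (1 - t) *\<^sub>R y')
       \<ge> t * h y + (1 - t) * h y' + \<mu> / 2 * t * (1 - t) * (norm (y - y'))\<^sup>2)"

definition primal :: "((real^'n) \<times> (real^'m) \<Rightarrow> real) \<Rightarrow> real^'n \<Rightarrow> real" where
  "primal f x = (SUP y. f (x, y))"

definition ystar :: "((real^'n) \<times> (real^'m) \<Rightarrow> real) \<Rightarrow> real^'n \<Rightarrow> real^'m" where
  "ystar f x = arg_max (\<lambda>y. f (x, y)) (\<lambda>_. True)"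

definition schur_hess :: "((real^'n) \<times> (real^'m) \<Rightarrow> real) \<Rightarrow> real^'n \<Rightarrow> real^'m \<Rightarrow> real^'n^'n" where
  "schur_hess f x y = hess_xx f (x, y)
     - hess_xy f (x, y) ** matrix_inv (hess_yy f (x, y)) ** hess_yx f (x, y)"

definition approx_second_order_point ::
  "((real^'n) \<times> (real^'m) \<Rightarrow> real) \<Rightarrow> real \<Rightarrow> real \<Rightarrow> real^'n \<Rightarrow> bool" where
  "approx_second_order_point f a b x \<longleftrightarrow>
     norm (grad (primal f) x) \<le> a \<and> loewner_le (mat (- b)) (hess (primal f) x)"

definition kappa :: "real \<Rightarrow> real \<Rightarrow> real" where
  "kappa l \<mu> = l / \<mu>"

definition L1 :: "real \<Rightarrow> real \<Rightarrow> real" where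
  "L1 l \<mu> = (kappa l \<mu> + 1) * l"

definition L2 :: "real \<Rightarrow> real \<Rightarrow> real \<Rightarrow> real" where
  "L2 l \<mu> \<rho> = \<rho> * (1 + kappa l \<mu>) ^ 3"

definition LH :: "real \<Rightarrow> real \<Rightarrow> real \<Rightarrow> real" where
  "LH l \<mu> \<rho> = \<rho> * (1 + kappa l \<mu>)\<^sup>2"

definition eps1 :: "real \<Rightarrow> real \<Rightarrow> real \<Rightarrow> real \<Rightarrow> real" where
  "eps1 l \<mu> \<rho> \<epsilon> = min (1 / 36) (sqrt (L2 l \<mu> \<rho>) / (12 * L1 l \<mu>)) * \<epsilon> powr (3/2)"

definition eps2 :: "real \<Rightarrow> real \<Rightarrow> real \<Rightarrow> real \<Rightarrow> real" where
  "eps2 l \<mu> \<rho> \<epsilon> = sqrt (L2 l \<mu> \<rho>) / 18 * \<epsilon> powr (1/2)"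

definition Acc :: "real \<Rightarrow> real \<Rightarrow> real \<Rightarrow> real \<Rightarrow> real" where
  "Acc l \<mu> \<rho> \<epsilon> = min (eps1 l \<mu> \<rho> \<epsilon> / l) (eps2 l \<mu> \<rho> \<epsilon> / (2 * LH l \<mu> \<rho>))"

text \<open>In the following, \<open>D\<close> stands for the initial gap, the primal value at the starting
  point minus its lower bound.\<close>

definition Cbar :: "real \<Rightarrow> real \<Rightarrow> real \<Rightarrow> real \<Rightarrow> real" where
  "Cbar l \<mu> \<rho> D = (36 * sqrt (L2 l \<mu> \<rho>) * D) powr (2/3)"

definition Gbar :: "real \<Rightarrow> real \<Rightarrow> real \<Rightarrow> real \<Rightarrow> real" where
  "Gbar l \<mu> \<rho> D = Max {41 / 9 * Cbar l \<mu> \<rho> D,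
     1 + L1 l \<mu> / sqrt (L2 l \<mu> \<rho>) * Cbar l \<mu> \<rho> D powr (1/2) + Cbar l \<mu> \<rho> D,
     2 + L1 l \<mu> / sqrt (L2 l \<mu> \<rho>)}"

definition Cbar1 :: "real \<Rightarrow> real \<Rightarrow> real \<Rightarrow> real \<Rightarrow> real" where
  "Cbar1 l \<mu> \<rho> D = 36 * sqrt (L2 l \<mu> \<rho>) * D / ln 2"

definition Cbar2 :: "real \<Rightarrow> real \<Rightarrow> real \<Rightarrow> real \<Rightarrow> real" where
  "Cbar2 l \<mu> \<rho> D = (ln (Gbar l \<mu> \<rho> D) + ln 2) * Cbar1 l \<mu> \<rho> D"

definition outer_bound :: "real \<Rightarrow> real \<Rightarrow> real \<Rightarrow> real \<Rightarrow> real \<Rightarrow> real" where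
  "outer_bound D l \<mu> \<rho> \<epsilon> =
     Cbar1 l \<mu> \<rho> D * \<epsilon> powr (-3/2) * ln (inverse \<epsilon>) + Cbar2 l \<mu> \<rho> D * \<epsilon> powr (-3/2) + 1"

text \<open>Lower bound on the number of inner iterations in outer iteration \<open>t\<close>, as a real number;
  \<open>d\<close> is the initial distance of the inner iterate from the inner maximizer.\<close>

definition inner_lower :: "real \<Rightarrow> real \<Rightarrow> real \<Rightarrow> real \<Rightarrow> real \<Rightarrow> (nat \<Rightarrow> real^'n) \<Rightarrow> nat \<Rightarrow> real" where
  "inner_lower l \<mu> \<rho> \<epsilon> d s t = (let \<kappa> = kappa l \<mu>; A = Acc l \<mu> \<rho> \<epsilon> in
     if t = 0 then 2 * sqrt \<kappa> * ln (sqrt (\<kappa> + 1) * d / A)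
     else 2 * sqrt \<kappa> * ln (sqrt (\<kappa> + 1) * (A + \<kappa> * norm (s (t - 1))) / A))"

text \<open>Soft-O in the parameters \<open>l\<close>, \<open>\<mu>\<close>, \<open>\<rho>\<close>, \<open>\<epsilon>\<close>: one constant \<open>C\<close> and one exponent \<open>k\<close>
  serve all admissible parameter values, and the hidden factor is a power of a sum of
  logarithms of the parameters. As the functions compared bound iteration
  counts, \<open>X\<close> is read as \<open>max 1 X\<close>; in the relevant regime \<open>X \<ge> 1\<close> (in particular as
  \<open>\<epsilon> \<rightarrow> 0\<close>) this is just \<open>X\<close>.\<close>

definition soft_O ::
  "(real \<Rightarrow> real \<Rightarrow> real \<Rightarrow> real \<Rightarrow> real) \<Rightarrow> (real \<Rightarrow> real \<Rightarrow> real \<Rightarrow> real \<Rightarrow> real) \<Rightarrow> bool" where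
  "soft_O F X \<longleftrightarrow> (\<exists>C. \<exists>k::nat. \<forall>l \<mu> \<rho> \<epsilon>. 0 < \<mu> \<and> \<mu> \<le> l \<and> 0 < \<rho> \<and> 0 < \<epsilon> \<longrightarrow>
     \<bar>F l \<mu> \<rho> \<epsilon>\<bar> \<le> C * max 1 (X l \<mu> \<rho> \<epsilon>) *
        (1 + \<bar>ln l\<bar> + \<bar>ln \<mu>\<bar> + \<bar>ln \<rho>\<bar> + \<bar>ln \<epsilon>\<bar>) ^ k)"

text \<open>Inner loop: the pair of the iterate and the extrapolated iterate after \<open>k\<close> steps of
  accelerated gradient ascent with gradient oracle \<open>G\<close>.\<close>

primrec nag :: "('b::real_vector \<Rightarrow> 'b) \<Rightarrow> real \<Rightarrow> real \<Rightarrow> 'b \<Rightarrow> nat \<Rightarrow> 'b \<times> 'b" where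
  "nag G \<eta> \<theta> y0 0 = (y0, y0)"
| "nag G \<eta> \<theta> y0 (Suc k) =
     (let (y, yt) = nag G \<eta> \<theta> y0 k; y' = yt + \<eta> *\<^sub>R G yt in (y', y' + \<theta> *\<^sub>R (y' - y)))"

definition neg_curvature :: "real \<Rightarrow> real \<Rightarrow> real^'n \<Rightarrow> real^'n^'n \<Rightarrow> bool" where
  "neg_curvature M \<epsilon> g H \<longleftrightarrow> lambda_min H \<le> - (1/2) * sqrt (M * max (norm g) \<epsilon>)"

text \<open>\<open>LMNegCur f M \<eta> \<theta> N \<epsilon> x0 ym1 \<tau> x y u s\<close>: the sequences \<open>x\<close>, \<open>y\<close>, \<open>u\<close>, \<open>s\<close> form a run of
  the algorithm that stops in outer iteration \<open>\<tau>\<close> (never, if \<open>\<tau> = \<infinity>\<close>). The iterates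
  generated are \<open>x t\<close> and \<open>y t\<close> with \<open>t \<le> \<tau>\<close>; entries of the sequences beyond that are
  irrelevant. \<open>M\<close> is the Hessian-Lipschitz parameter used by the algorithm.\<close>

definition LMNegCur ::
  "((real^'n) \<times> (real^'m) \<Rightarrow> real) \<Rightarrow> real \<Rightarrow> real \<Rightarrow> real \<Rightarrow> (nat \<Rightarrow> nat) \<Rightarrow> real \<Rightarrow>
   real^'n \<Rightarrow> real^'m \<Rightarrow> enat \<Rightarrow>
   (nat \<Rightarrow> real^'n) \<Rightarrow> (nat \<Rightarrow> real^'m) \<Rightarrow> (nat \<Rightarrow> real^'n) \<Rightarrow> (nat \<Rightarrow> real^'n) \<Rightarrow> bool" where
  "LMNegCur f M \<eta> \<theta> N \<epsilon> x0 ym1 \<tau> x y u s \<longleftrightarrow>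
     x 0 = x0 \<and>
     (\<forall>t. enat t \<le> \<tau> \<longrightarrow>
       (let g = grad_x f (x t) (y t); H = schur_hess f (x t) (y t) in
          y t = fst (nag (grad_y f (x t)) \<eta> \<theta> (if t = 0 then ym1 else y (t - 1)) (N t)) \<and>
          lambda_min H = u t \<bullet> (H *v u t) \<and> norm (u t) = 1 \<and> g \<bullet> u t \<le> 0 \<and>
          (enat t = \<tau> \<longleftrightarrow> \<not> neg_curvature M \<epsilon> g H \<and> norm g < \<epsilon>) \<and>
          (enat t < \<tau> \<longrightarrow>
             (if neg_curvature M \<epsilon> g H
              then s t = sqrt (max (norm g) \<epsilon> / M) *\<^sub>R u t
              else (H + mat (sqrt (M * norm g))) *v s t = - g) \<and>
             x (Suc t) = x t + s t)))"

end

theory Submission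
  imports Defs
begin

text \<open>
  The implicit function theorem, in the Lipschitz setting, gives
  \<open>\<nabla>P(x) = \<nabla>\<^sub>x f(x, y*(x))\<close> and \<open>\<nabla>\<^sup>2 P(x) = H(x, y*(x))\<close>, and the latter is \<open>L\<^sub>2\<close>-Lipschitz. Linear
  convergence of the accelerated inner loop keeps \<open>y\<^sub>t\<close> within \<open>A\<close> of \<open>y*(x\<^sub>t)\<close>, so \<open>g\<^sub>t\<close> and \<open>H\<^sub>t\<close>
  are accurate enough for every iteration to decrease \<open>P\<close>. As long as \<open>x\<^sub>t\<close> is not an approximate
  second-order point, an iteration either decreases \<open>P\<close> by \<open>\<epsilon>\<^bsup>3/2\<^esup> / (24 \<surd>L\<^sub>2)\<close> or is a Newton step that
  halves \<open>\<parallel>g\<^sub>t\<parallel>\<close>. Between two iterations of the first kind at most \<open>log\<^sub>2 (2G/\<epsilon>)\<close> halvings fit, where \<open>G\<close>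
  bounds all \<open>\<parallel>g\<^sub>t\<parallel>\<close> because \<open>\<parallel>\<nabla>P\<parallel>\<^sup>2 \<le> 2 L\<^sub>1 (P - P*)\<close>.

  The constants \<open>\<xi>\<close> and \<open>\<theta>\<close> may depend on everything except \<open>\<epsilon>\<close>. They are taken so large that \<open>x\<^sub>0\<close>
  itself qualifies unless \<open>\<epsilon>\<close> is below a threshold \<open>\<epsilon>\<^sub>0\<close>. Below it the stated constant 36 leaves room
  over the 24 above, which absorbs the halvings before the first large decrease.
\<close>

section \<open>Gradients and Taylor remainders\<close>

text \<open>The dichotomy between a large decrease and a halving comes from the step length. A
  Newton step with shift \<open>\<sigma> = sqrt (M * norm g)\<close> and length \<open>r\<close>
  lowers \<open>P\<close> by order \<open>\<sigma> * r\<^sup>2\<close>, and the gradient after it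
  has order at most \<open>\<sigma> * r\<close>. If that gradient is not halved,
  \<open>\<sigma> * r\<close> is comparable to \<open>norm g\<close>, and the decrease has order
  \<open>norm g powr (3/2) / sqrt M\<close>. The errors of the inexact gradient must be small
  against \<open>\<sigma> * r\<close>, although \<open>r\<close> is not bounded below in advance.
  The Newton equation forces \<open>r\<close> to be at least
  \<open>norm g / (L1 + \<sigma>)\<close>; which of \<open>L1\<close> and \<open>\<sigma>\<close>
  dominates explains the two terms of the minimum in \<open>eps1\<close>. Regularity of the
  maximizer rests on one estimate: \<open>grad_y\<close> expands distances in \<open>y\<close> by at
  least \<open>\<mu>\<close>, and so does its derivative \<open>hess_yy\<close>. This inverts
  \<open>hess_yy\<close> and differentiates \<open>ystar\<close> without any spectral theory for
  \<open>hess_yy\<close>.\<close>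

lemma norm_matrix_vector_mult_le: "norm (M *v v) \<le> onorm ((*v) M) * norm (v :: real^'n)"
  for M :: "real^'n^'m"
  by (rule onorm) simp

text \<open>\<open>grad\<close> is a definite description: the Riesz vector
  \<open>adjoint f' 1\<close> of the derivative supplies existence, and uniqueness of derivatives
  supplies the rest.\<close>

lemma has_derivative_grad:
  fixes f :: "'a::euclidean_space \<Rightarrow> real"
  assumes "f differentiable (at x)"
  shows "(f has_derivative (\<lambda>h. h \<bullet> grad f x)) (at x)"
proof -
  obtain f' where f': "(f has_derivative f') (at x)"
    using assms unfolding differentiable_def by blast
  then have "linear f'" by (rule has_derivative_linear)
  then have "f' = (\<lambda>h. h \<bullet> adjoint f' 1)" by (simp add: adjoint_works fun_eq_iff)
  with f' have ex: "GDERIV f x :> adjoint f' 1" by (simp add: gderiv_def)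
  have "D = adjoint f' 1" if "GDERIV f x :> D" for D
  proof -
    have "(\<lambda>h. h \<bullet> D) = (\<lambda>h. h \<bullet> adjoint f' 1)"
      using that ex unfolding gderiv_def by (rule has_derivative_unique)
    then show ?thesis by (simp add: fun_eq_iff vector_eq_ldot)
  qed
  with ex have "GDERIV f x :> grad f x" unfolding grad_def by (rule theI)
  then show ?thesis by (simp add: gderiv_def)
qed

lemma grad_unique:
  fixes f :: "'a::euclidean_space \<Rightarrow> real"
  assumes "(f has_derivative (\<lambda>h. h \<bullet> D)) (at x)"
  shows "grad f x = D"
proof -
  have "(\<lambda>h. h \<bullet> grad f x) = (\<lambda>h. h \<bullet> D)"
    using assms has_derivative_grad has_derivative_unique differentiable_def by blast
  then show ?thesis by (simp add: fun_eq_iff vector_eq_ldot)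
qed

lemma has_vector_derivative_along_line:
  fixes f :: "'a::real_normed_vector \<Rightarrow> 'b::real_normed_vector"
  assumes "(f has_derivative f') (at (x + t *\<^sub>R d))"
  shows "((\<lambda>t. f (x + t *\<^sub>R d)) has_vector_derivative f' d) (at t)"
proof -
  have "((\<lambda>t. f (x + t *\<^sub>R d)) has_derivative (\<lambda>r. f' (r *\<^sub>R d))) (at t)"
    by (rule has_derivative_compose[where g = f and f = "\<lambda>t. x + t *\<^sub>R d"])
      (auto intro!: derivative_eq_intros assms)
  then show ?thesis
    unfolding has_vector_derivative_def
    using linear_scale[OF has_derivative_linear[OF assms]] by simp
qed

text \<open>The definition of strong concavity mentions no derivative. Its inequality on the segment
  from \<open>y\<close> to \<open>y'\<close>, divided by the weight \<open>t\<close> of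
  \<open>y'\<close>, becomes this tangent bound as \<open>t\<close> decreases to 0.\<close>

lemma strongly_concave_le_quadratic:
  fixes h :: "'a::real_inner \<Rightarrow> real"
  assumes sc: "strongly_concave \<mu> h" and der: "(h has_derivative (\<lambda>k. k \<bullet> g)) (at y)"
  shows "h y' \<le> h y + (y' - y) \<bullet> g - \<mu> / 2 * (norm (y' - y))\<^sup>2"
proof -
  let ?d = "y' - y"
  let ?n = "(norm ?d)\<^sup>2"
  have "((\<lambda>t. h (y + t *\<^sub>R ?d)) has_vector_derivative ?d \<bullet> g) (at 0)"
    by (rule has_vector_derivative_along_line) (simp add: der)
  then have "((\<lambda>t. h (y + t *\<^sub>R ?d)) has_field_derivative ?d \<bullet> g) (at 0)"
    by (simp add: has_real_derivative_iff_has_vector_derivative)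
  then have "((\<lambda>t. (h (y + t *\<^sub>R ?d) - h y) / t) \<longlongrightarrow> ?d \<bullet> g) (at 0)"
    by (simp add: DERIV_def)
  then have lim: "((\<lambda>t. (h (y + t *\<^sub>R ?d) - h y) / t) \<longlongrightarrow> ?d \<bullet> g) (at_right 0)"
    by (rule tendsto_mono[rotated]) (simp add: at_le)
  have "((\<lambda>t. h y' - h y + \<mu> / 2 * (1 - t) * ?n) \<longlongrightarrow> h y' - h y + \<mu> / 2 * (1 - 0) * ?n) (at_right 0)"
    by (intro tendsto_intros)
  then have lim2: "((\<lambda>t. h y' - h y + \<mu> / 2 * (1 - t) * ?n) \<longlongrightarrow> h y' - h y + \<mu> / 2 * ?n) (at_right 0)"
    by simp
  have "\<forall>\<^sub>F t in at_right 0. h y' - h y + \<mu> / 2 * (1 - t) * ?n \<le> (h (y + t *\<^sub>R ?d) - h y) / t"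
    unfolding eventually_at_right_field
  proof (intro exI[of _ 1] conjI allI impI)
    fix t :: real assume t: "0 < t" "t < 1"
    have "h (t *\<^sub>R y' + (1 - t) *\<^sub>R y) \<ge> t * h y' + (1 - t) * h y + \<mu> / 2 * t * (1 - t) * ?n"
      using sc t unfolding strongly_concave_def by (metis atLeastAtMost_iff less_imp_le)
    moreover have "t *\<^sub>R y' + (1 - t) *\<^sub>R y = y + t *\<^sub>R ?d" by (simp add: algebra_simps)
    ultimately have "t * (h y' - h y + \<mu> / 2 * (1 - t) * ?n) \<le> h (y + t *\<^sub>R ?d) - h y"
      by (simp add: algebra_simps)
    then show "h y' - h y + \<mu> / 2 * (1 - t) * ?n \<le> (h (y + t *\<^sub>R ?d) - h y) / t"
      using t by (simp add: pos_le_divide_eq mult.commute)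
  qed simp
  then have "h y' - h y + \<mu> / 2 * ?n \<le> ?d \<bullet> g"
    by (rule tendsto_le[OF _ lim lim2, rotated]) simp
  then show ?thesis by simp
qed

text \<open>Vector-valued maps have no mean value equation. Pairing with the remainder
  \<open>w\<close> itself reduces the claim to the decrease of a real function, with
  \<open>norm w * norm w\<close> on the left.\<close>

lemma lipschitz_derivative_remainder:
  fixes g :: "'a::real_normed_vector \<Rightarrow> 'b::real_inner"
  assumes der: "\<And>z. (g has_derivative G z) (at z)"
    and lip: "\<And>z z' v. norm (G z v - G z' v) \<le> L * norm (z - z') * norm v"
  shows "norm (g (x + s) - g x - G x s) \<le> L / 2 * (norm s)\<^sup>2"
proof -
  define w where "w = g (x + s) - g x - G x s"
  define \<psi> where "\<psi> t = (g (x + t *\<^sub>R s) - g x - t *\<^sub>R G x s) \<bullet> w - L * t\<^sup>2 / 2 * (norm s)\<^sup>2 * norm w" for t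
  have "\<psi> 1 \<le> \<psi> 0"
  proof (rule DERIV_nonpos_imp_nonincreasing[of 0 1 \<psi>], simp, intro exI conjI)
    fix t :: real assume t: "0 \<le> t" "t \<le> 1"
    have d1: "((\<lambda>t. g (x + t *\<^sub>R s)) has_vector_derivative G (x + t *\<^sub>R s) s) (at t)"
      by (rule has_vector_derivative_along_line[OF der])
    have d2: "((\<lambda>t. (g (x + t *\<^sub>R s) - g x - t *\<^sub>R G x s)) has_vector_derivative G (x + t *\<^sub>R s) s - G x s) (at t)"
      by (auto intro!: derivative_eq_intros d1)
    have d3: "((\<lambda>t. (g (x + t *\<^sub>R s) - g x - t *\<^sub>R G x s) \<bullet> w) has_vector_derivative (G (x + t *\<^sub>R s) s - G x s) \<bullet> w) (at t)"
      by (rule bounded_linear.has_vector_derivative[OF bounded_linear_inner_left d2])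
    show "(\<psi> has_real_derivative (G (x + t *\<^sub>R s) s - G x s) \<bullet> w - L * t * (norm s)\<^sup>2 * norm w) (at t)"
      unfolding \<psi>_def
      by (auto intro!: derivative_eq_intros d3[unfolded has_real_derivative_iff_has_vector_derivative[symmetric]])
    have "(G (x + t *\<^sub>R s) s - G x s) \<bullet> w \<le> norm (G (x + t *\<^sub>R s) s - G x s) * norm w"
      by (rule norm_cauchy_schwarz)
    also have "\<dots> \<le> (L * norm (t *\<^sub>R s) * norm s) * norm w"
      using lip[of "x + t *\<^sub>R s" s x] by (intro mult_right_mono) auto
    also have "\<dots> = L * t * (norm s)\<^sup>2 * norm w" using t by (simp add: power2_eq_square)
    finally show "(G (x + t *\<^sub>R s) s - G x s) \<bullet> w - L * t * (norm s)\<^sup>2 * norm w \<le> 0" by simp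
  qed
  then have "norm w * norm w \<le> (L / 2 * (norm s)\<^sup>2) * norm w"
    by (simp add: \<psi>_def w_def[symmetric] dot_square_norm power2_eq_square)
  then show ?thesis
  proof (cases "norm w = 0")
    \<comment> \<open>The sign of \<open>L\<close> is not given, so for vanishing \<open>w\<close>
      the right-hand side is seen to be nonnegative from the Lipschitz hypothesis.\<close>
    case True
    have "norm (G (x+s) s - G x s) \<le> L * norm s * norm s" using lip[of "x + s" s x] by simp
    then have "0 \<le> L * norm s * norm s" by (meson norm_ge_zero order_trans)
    with True show ?thesis by (simp add: w_def power2_eq_square mult.assoc)
  next
    case False
    then have "0 < norm w" by simp
    with \<open>norm w * norm w \<le> _\<close> have "norm w \<le> L / 2 * (norm s)\<^sup>2"
      by (rule mult_right_le_imp_le)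
    then show ?thesis by (simp add: w_def)
  qed
qed

text \<open>The quadratic remainder bound for the gradient is integrated along the segment; 1/6 is
  the integral of \<open>t\<^sup>2 / 2\<close>.\<close>

lemma lipschitz_hessian_upper:
  fixes \<phi> :: "'a::real_inner \<Rightarrow> real"
  assumes der: "\<And>z. (\<phi> has_derivative (\<lambda>h. h \<bullet> g z)) (at z)"
    and rem: "\<And>x s. norm (g (x + s) - g x - G x s) \<le> L / 2 * (norm s)\<^sup>2"
    and lin: "\<And>x. linear (G x)"
  shows "\<phi> (x + s) \<le> \<phi> x + s \<bullet> g x + 1 / 2 * (s \<bullet> G x s) + L / 6 * norm s ^ 3"
proof -
  define \<psi> where "\<psi> t = \<phi> (x + t *\<^sub>R s) - t * (s \<bullet> g x) - t\<^sup>2 / 2 * (s \<bullet> G x s) - L * t ^ 3 / 6 * norm s ^ 3" for t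
  have "\<psi> 1 \<le> \<psi> 0"
  proof (rule DERIV_nonpos_imp_nonincreasing[of 0 1 \<psi>], simp, intro exI conjI)
    fix t :: real assume t: "0 \<le> t" "t \<le> 1"
    have d1: "((\<lambda>t. \<phi> (x + t *\<^sub>R s)) has_real_derivative s \<bullet> g (x + t *\<^sub>R s)) (at t)"
      unfolding has_real_derivative_iff_has_vector_derivative
      by (rule has_vector_derivative_along_line[OF der])
    show "(\<psi> has_real_derivative s \<bullet> g (x + t *\<^sub>R s) - s \<bullet> g x - t * (s \<bullet> G x s) - L * t\<^sup>2 / 2 * norm s ^ 3) (at t)"
      unfolding \<psi>_def by (auto intro!: derivative_eq_intros d1)
    have "s \<bullet> g (x + t *\<^sub>R s) - s \<bullet> g x - t * (s \<bullet> G x s) = s \<bullet> (g (x + t *\<^sub>R s) - g x - G x (t *\<^sub>R s))"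
      by (simp add: linear_scale[OF lin] inner_diff_right)
    also have "\<dots> \<le> norm s * norm (g (x + t *\<^sub>R s) - g x - G x (t *\<^sub>R s))"
      by (rule norm_cauchy_schwarz)
    also have "\<dots> \<le> norm s * (L / 2 * (norm (t *\<^sub>R s))\<^sup>2)"
      by (intro mult_left_mono rem) simp
    also have "\<dots> = L * t\<^sup>2 / 2 * norm s ^ 3"
      by (simp add: power_mult_distrib power2_eq_square power3_eq_cube)
    finally show "s \<bullet> g (x + t *\<^sub>R s) - s \<bullet> g x - t * (s \<bullet> G x s) - L * t\<^sup>2 / 2 * norm s ^ 3 \<le> 0" by simp
  qed
  then show ?thesis by (simp add: \<psi>_def)
qed

text \<open>Serves twice: for \<open>f\<close> in \<open>y\<close>, as the progress guarantee of an
  ascent step, and for the negated primal function, to bound its gradient by its gap.\<close>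

lemma lipschitz_grad_lower:
  fixes h :: "'a::real_inner \<Rightarrow> real"
  assumes der: "\<And>z. (h has_derivative (\<lambda>k. k \<bullet> g z)) (at z)"
    and lip: "\<And>z z'. norm (g z - g z') \<le> L * norm (z - z')"
  shows "h (x + s) \<ge> h x + s \<bullet> g x - L / 2 * (norm s)\<^sup>2"
proof -
  define \<psi> where "\<psi> t = h (x + t *\<^sub>R s) - t * (s \<bullet> g x) + t\<^sup>2 * L / 2 * (norm s)\<^sup>2" for t
  have "\<psi> 0 \<le> \<psi> 1"
  proof (rule DERIV_nonneg_imp_nondecreasing[of 0 1 \<psi>], simp, intro exI conjI)
    fix t :: real assume t: "0 \<le> t" "t \<le> 1"
    have d1: "((\<lambda>t. h (x + t *\<^sub>R s)) has_real_derivative s \<bullet> g (x + t *\<^sub>R s)) (at t)"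
      unfolding has_real_derivative_iff_has_vector_derivative
      by (rule has_vector_derivative_along_line[OF der])
    show "(\<psi> has_real_derivative s \<bullet> g (x + t *\<^sub>R s) - s \<bullet> g x + t * L * (norm s)\<^sup>2) (at t)"
      unfolding \<psi>_def by (auto intro!: derivative_eq_intros d1)
    have "\<bar>s \<bullet> (g (x + t *\<^sub>R s) - g x)\<bar> \<le> norm s * norm (g (x + t *\<^sub>R s) - g x)"
      by (rule Cauchy_Schwarz_ineq2)
    also have "\<dots> \<le> norm s * (L * norm (t *\<^sub>R s))"
      using lip[of "x + t *\<^sub>R s" x] by (intro mult_left_mono) auto
    also have "\<dots> = t * L * (norm s)\<^sup>2" using t by (simp add: power2_eq_square)
    finally show "0 \<le> s \<bullet> g (x + t *\<^sub>R s) - s \<bullet> g x + t * L * (norm s)\<^sup>2"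
      by (simp add: inner_diff_right)
  qed
  then show ?thesis by (simp add: \<psi>_def)
qed

lemma norm_derivative_le_lipschitz:
  fixes g :: "'a::real_normed_vector \<Rightarrow> 'b::real_normed_vector"
  assumes der: "(g has_derivative G) (at z)"
    and lip: "\<And>z z'. norm (g z - g z') \<le> L * norm (z - z')"
  shows "norm (G v) \<le> L * norm v"
proof -
  have lin: "linear G" using der by (rule has_derivative_linear)
  show ?thesis
  proof (rule field_le_epsilon)
    fix e :: real assume "e > 0"
    define e' where "e' = e / (norm v + 1)"
    have e': "e' > 0" using \<open>e > 0\<close> by (simp add: e'_def add_nonneg_pos)
    obtain d where d0: "d > 0" and
      d: "\<And>y. norm (y - z) < d \<Longrightarrow> norm (g y - g z - G (y - z)) \<le> e' * norm (y - z)"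
      using der e' unfolding has_derivative_at_alt by blast
    define t where "t = d / (2 * (norm v + 1))"
    have t: "t > 0" using d0 by (simp add: t_def add_nonneg_pos)
    have "t * norm v < d" using d0 by (simp add: t_def divide_simps) (smt (verit) mult_nonneg_nonneg norm_ge_zero mult.commute)
    then have "norm (g (z + t *\<^sub>R v) - g z - t *\<^sub>R G v) \<le> e' * (t * norm v)"
      using d[of "z + t *\<^sub>R v"] t by (simp add: linear_scale[OF lin])
    moreover have "norm (g (z + t *\<^sub>R v) - g z) \<le> L * (t * norm v)"
      using lip[of "z + t *\<^sub>R v" z] t by simp
    ultimately have "norm (t *\<^sub>R G v) \<le> L * (t * norm v) + e' * (t * norm v)"
      using norm_triangle_ineq4[of "g (z + t *\<^sub>R v) - g z" "g (z + t *\<^sub>R v) - g z - t *\<^sub>R G v"] by simp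
    then have "t * norm (G v) \<le> t * (L * norm v + e' * norm v)" using t by (simp add: algebra_simps)
    then have "norm (G v) \<le> L * norm v + e' * norm v" using t by simp
    also have "e' * norm v \<le> e' * (norm v + 1)" using e' by simp
    also have "\<dots> = e" using add_nonneg_pos[of "norm v" 1] by (simp add: e'_def)
    finally show "norm (G v) \<le> L * norm v + e" by simp
  qed
qed

lemma second_derivative_symmetric:
  fixes \<phi> :: "'a::real_inner \<Rightarrow> real"
  assumes der: "\<And>z. (\<phi> has_derivative (\<lambda>h. h \<bullet> g z)) (at z)"
    and der2: "(g has_derivative A) (at z)"
  shows "v \<bullet> A w = w \<bullet> A v"
proof -
  have lin: "linear A" using der2 by (rule has_derivative_linear)
  \<comment> \<open>The second difference is symmetric in \<open>v\<close> and \<open>w\<close>, and the mean value theorem in direction \<open>v\<close>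
    gives \<open>\<Delta> t v w = t\<^sup>2 * (v \<bullet> A w) + o(t\<^sup>2)\<close>.\<close>
  define \<Delta> where "\<Delta> t v w = \<phi> (z + t *\<^sub>R v + t *\<^sub>R w) - \<phi> (z + t *\<^sub>R v) - \<phi> (z + t *\<^sub>R w) + \<phi> z" for t v w
  define c where "c = 2 * norm v + 2 * norm w"
  have key: "\<bar>\<Delta> t v w - t\<^sup>2 * (v \<bullet> A w)\<bar> \<le> t\<^sup>2 * (e * c\<^sup>2)"
    if t: "0 < t" and e: "0 < e" and c: "c = 2 * norm v + 2 * norm w" and tc: "t * c < d"
      and d: "\<And>y. norm (y - z) < d \<Longrightarrow> norm (g y - g z - A (y - z)) \<le> e * norm (y - z)" for t e d v w
  proof -
    have dq: "((\<lambda>r. \<phi> (z + r *\<^sub>R v + t *\<^sub>R w) - \<phi> (z + r *\<^sub>R v)) has_real_derivative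
        v \<bullet> g (z + r *\<^sub>R v + t *\<^sub>R w) - v \<bullet> g (z + r *\<^sub>R v)) (at r)" for r
    proof -
      have 1: "((\<lambda>r. \<phi> (z + r *\<^sub>R v)) has_real_derivative v \<bullet> g (z + r *\<^sub>R v)) (at r)"
        unfolding has_real_derivative_iff_has_vector_derivative
        by (rule has_vector_derivative_along_line[OF der])
      have "((\<lambda>r. \<phi> ((z + t *\<^sub>R w) + r *\<^sub>R v)) has_real_derivative v \<bullet> g ((z + t *\<^sub>R w) + r *\<^sub>R v)) (at r)"
        unfolding has_real_derivative_iff_has_vector_derivative
        by (rule has_vector_derivative_along_line[OF der])
      then have 2: "((\<lambda>r. \<phi> (z + r *\<^sub>R v + t *\<^sub>R w)) has_real_derivative v \<bullet> g (z + r *\<^sub>R v + t *\<^sub>R w)) (at r)"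
        by (simp add: ac_simps)
      show ?thesis by (rule DERIV_diff[OF 2 1])
    qed
    obtain r where r: "0 < r" "r < t"
      and mv: "(\<phi> (z + t *\<^sub>R v + t *\<^sub>R w) - \<phi> (z + t *\<^sub>R v)) - (\<phi> (z + 0 *\<^sub>R v + t *\<^sub>R w) - \<phi> (z + 0 *\<^sub>R v))
        = (t - 0) * (v \<bullet> g (z + r *\<^sub>R v + t *\<^sub>R w) - v \<bullet> g (z + r *\<^sub>R v))"
      using MVT2[OF t, of "\<lambda>r. \<phi> (z + r *\<^sub>R v + t *\<^sub>R w) - \<phi> (z + r *\<^sub>R v)"
          "\<lambda>r. v \<bullet> g (z + r *\<^sub>R v + t *\<^sub>R w) - v \<bullet> g (z + r *\<^sub>R v)"] dq by blast
    define p where "p = g (z + r *\<^sub>R v + t *\<^sub>R w) - g z - A (r *\<^sub>R v + t *\<^sub>R w)"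
    define q where "q = g (z + r *\<^sub>R v) - g z - A (r *\<^sub>R v)"
    have nv: "norm (r *\<^sub>R v) \<le> t * norm v" using r t by (simp add: mult_right_mono)
    have nvw: "norm (r *\<^sub>R v + t *\<^sub>R w) \<le> t * norm v + t * norm w"
      using norm_triangle_ineq[of "r *\<^sub>R v" "t *\<^sub>R w"] nv t by simp
    have c0: "norm v \<le> c" "0 \<le> c" using c by auto
    have lt: "t * norm v + t * norm w < d"
    proof -
      have "t * norm v + t * norm w \<le> t * c" using t c by (simp add: algebra_simps)
      then show ?thesis using tc by simp
    qed
    have "t * norm v < d" using lt t by (smt (verit) mult_nonneg_nonneg norm_ge_zero)
    then have "norm q \<le> e * norm (r *\<^sub>R v)"
      using d[of "z + r *\<^sub>R v"] nv unfolding q_def by simp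
    also have "\<dots> \<le> e * (t * norm v)" using nv e by (intro mult_left_mono) auto
    finally have q: "norm q \<le> e * (t * norm v)" .
    have "norm p \<le> e * norm (r *\<^sub>R v + t *\<^sub>R w)"
      using d[of "z + r *\<^sub>R v + t *\<^sub>R w"] nvw lt unfolding p_def by (simp add: add.assoc)
    also have "\<dots> \<le> e * (t * norm v + t * norm w)" using nvw e by (intro mult_left_mono) auto
    finally have p: "norm p \<le> e * (t * norm v + t * norm w)" .
    have "norm (p - q) \<le> e * (t * norm v + t * norm w) + e * (t * norm v)"
      using norm_triangle_ineq4[of p q] p q by linarith
    also have "\<dots> \<le> e * t * c" using e t by (simp add: c algebra_simps)
    finally have pq: "norm (p - q) \<le> e * t * c" .
    have "A (r *\<^sub>R v + t *\<^sub>R w) - A (r *\<^sub>R v) = t *\<^sub>R A w"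
      by (simp add: linear_add[OF lin] linear_scale[OF lin])
    then have "g (z + r *\<^sub>R v + t *\<^sub>R w) - g (z + r *\<^sub>R v) = t *\<^sub>R A w + (p - q)"
      unfolding p_def q_def by (simp add: algebra_simps)
    then have "\<Delta> t v w = t * (v \<bullet> (t *\<^sub>R A w + (p - q)))"
      using mv unfolding \<Delta>_def by (simp flip: inner_diff_right)
    then have "\<Delta> t v w - t\<^sup>2 * (v \<bullet> A w) = t * (v \<bullet> (p - q))"
      by (simp add: inner_add_right algebra_simps power2_eq_square)
    then have "\<bar>\<Delta> t v w - t\<^sup>2 * (v \<bullet> A w)\<bar> = t * \<bar>v \<bullet> (p - q)\<bar>" using t by (simp add: abs_mult)
    also have "\<dots> \<le> t * (c * (e * t * c))"
      using Cauchy_Schwarz_ineq2[of v "p - q"] mult_mono[OF c0(1) pq c0(2) norm_ge_zero] t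
      by (intro mult_left_mono) auto
    finally show ?thesis by (simp add: power2_eq_square ac_simps)
  qed
  have "\<bar>v \<bullet> A w - w \<bullet> A v\<bar> \<le> e" if "e > 0" for e
  proof -
    \<comment> \<open>The errors of the two second differences add up to
      \<open>2 * e' * c\<^sup>2\<close>, which must not exceed \<open>e\<close>; the added 1 covers
      \<open>c = 0\<close>.\<close>
    define e' where "e' = e / (2 * (c\<^sup>2 + 1))"
    have c0: "c \<ge> 0" by (simp add: c_def)
    have e': "e' > 0" using that by (simp add: e'_def add_nonneg_pos)
    obtain d where d0: "d > 0" and
      d: "\<And>y. norm (y - z) < d \<Longrightarrow> norm (g y - g z - A (y - z)) \<le> e' * norm (y - z)"
      using der2 e' unfolding has_derivative_at_alt by blast
    define t where "t = d / (2 * (c + 1))"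
    have t: "t > 0" using d0 c0 by (simp add: t_def)
    have "t * c < d" using d0 c0 by (simp add: t_def field_simps add_nonneg_pos)
    then have 1: "\<bar>\<Delta> t v w - t\<^sup>2 * (v \<bullet> A w)\<bar> \<le> t\<^sup>2 * (e' * c\<^sup>2)" and
      2: "\<bar>\<Delta> t w v - t\<^sup>2 * (w \<bullet> A v)\<bar> \<le> t\<^sup>2 * (e' * c\<^sup>2)"
      using key[OF t e' _ _ d, of v w] key[OF t e' _ _ d, of w v] by (auto simp: c_def ac_simps)
    have "\<Delta> t w v = \<Delta> t v w" by (simp add: \<Delta>_def ac_simps)
    with 1 2 have "\<bar>t\<^sup>2 * (v \<bullet> A w) - t\<^sup>2 * (w \<bullet> A v)\<bar> \<le> t\<^sup>2 * (2 * e' * c\<^sup>2)"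
      by (simp add: algebra_simps)
    then have "t\<^sup>2 * \<bar>v \<bullet> A w - w \<bullet> A v\<bar> \<le> t\<^sup>2 * (2 * e' * c\<^sup>2)"
      by (metis abs_mult abs_power2 right_diff_distrib)
    then have "\<bar>v \<bullet> A w - w \<bullet> A v\<bar> \<le> 2 * e' * c\<^sup>2" using t by simp
    also have "\<dots> \<le> 2 * e' * (c\<^sup>2 + 1)" using e' by simp
    also have "\<dots> = e"
    proof -
      have "(e / (2 * K)) * 2 * K = e" if "K > 0" for K :: real using that by simp
      from this[of "c\<^sup>2 + 1"] show ?thesis by (metis add_nonneg_pos e'_def mult.commute zero_le_power2 zero_less_one)
    qed
    finally show ?thesis .
  qed
  then have "\<bar>v \<bullet> A w - w \<bullet> A v\<bar> \<le> 0" by (meson dense_ge)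
  then show ?thesis by simp
qed

text \<open>Partial derivatives alone do not combine into a joint one; continuity of the
  \<open>Y\<close> block achieves it. The spectral Lipschitz bound becomes continuity in
  \<open>blinfun\<close>, whose norm is the operator norm.\<close>

lemma has_derivative_joint:
  fixes g :: "real^'n \<Rightarrow> real^'m \<Rightarrow> real^'k"
  assumes \<rho>: "0 \<le> \<rho>"
    and X: "\<And>x y. ((\<lambda>x. g x y) has_derivative (*v) (X (x, y))) (at x)"
    and Y: "\<And>x y. ((\<lambda>y. g x y) has_derivative (*v) (Y (x, y))) (at y)"
    and lip: "spectral_lipschitz \<rho> Y"
  shows "((\<lambda>z. g (fst z) (snd z)) has_derivative (\<lambda>h. X z *v fst h + Y z *v snd h)) (at z)"
proof -
  let ?B = "\<lambda>z. Blinfun ((*v) (Y z))"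
  have app: "blinfun_apply (?B z) = (*v) (Y z)" for z
    by (simp add: bounded_linear_Blinfun_apply)
  have "\<rho>-lipschitz_on UNIV ?B"
  proof (rule lipschitz_onI)
    fix z z' :: "(real^'n) \<times> (real^'m)"
    have "blinfun_apply (?B z - ?B z') = (*v) (Y z - Y z')"
      by (simp add: fun_eq_iff blinfun.diff_left app matrix_vector_mult_diff_rdistrib)
    then show "dist (?B z) (?B z') \<le> \<rho> * dist z z'"
      using lip[unfolded spectral_lipschitz_def, rule_format, of z z']
      by (simp only: dist_norm norm_blinfun.rep_eq)
  qed (rule \<rho>)
  then have cont: "continuous (at z within UNIV) ?B" for z
    by (meson UNIV_I continuous_on_eq_continuous_within lipschitz_on_continuous_on)
  have "((\<lambda>(x, y). g x y) has_derivative (\<lambda>(h, k). X (fst z, snd z) *v h + ?B (fst z, snd z) k))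
      (at (fst z, snd z) within UNIV \<times> UNIV)"
    by (rule has_derivative_partialsI) (use X[of "snd z" "fst z"] cont[of z] in \<open>auto simp: app Y case_prod_unfold\<close>)
  then show ?thesis by (simp add: app case_prod_unfold)
qed

section \<open>Symmetric and invertible matrices\<close>

lemma inner_matrix_symmetric:
  fixes M :: "real^'n^'n"
  assumes "transpose M = M"
  shows "v \<bullet> (M *v w) = w \<bullet> (M *v v)"
  by (metis assms dot_lmul_matrix inner_commute transpose_matrix_vector)

lemma transpose_eqI:
  fixes M :: "real^'n^'m"
  assumes "\<And>v w. v \<bullet> (M *v w) = w \<bullet> (M' *v v)"
  shows "transpose M = M'"
proof -
  have "transpose M *v v = M' *v v" for v
  proof -
    have "w \<bullet> (transpose M *v v) = w \<bullet> (M' *v v)" for w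
      using assms[of v w] by (metis dot_lmul_matrix inner_commute transpose_matrix_vector)
    then show ?thesis by (metis vector_eq_ldot)
  qed
  then show ?thesis by (simp add: matrix_eq)
qed

lemma mat_vector_mult: "mat c *v v = c *\<^sub>R (v :: real^'n)"
  by (simp add: matrix_vector_mult_def mat_def vec_eq_iff if_distrib[where f="\<lambda>c. c * _"] sum.delta cong: if_cong)

text \<open>If \<open>w = M *v v\<close> were nonzero, the form at \<open>v + t *\<^sub>R w\<close>
  would be \<open>2 * t * b + t\<^sup>2 * a\<close> with \<open>b > 0\<close>, which is negative for
  small negative \<open>t\<close>; \<open>t = - b / (a + 1)\<close> is small enough.\<close>

lemma psd_inner_eq_0_imp_kernel:
  fixes M :: "real^'n^'n"
  assumes sym: "transpose M = M" and psd: "\<And>v. 0 \<le> v \<bullet> (M *v v)" and z: "v \<bullet> (M *v v) = 0"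
  shows "M *v v = 0"
proof (rule ccontr)
  assume nz: "M *v v \<noteq> 0"
  define w where "w = M *v v"
  define a where "a = w \<bullet> (M *v w)"
  define b where "b = w \<bullet> w"
  have b: "b > 0" using nz by (simp add: b_def w_def)
  have a: "a \<ge> 0" using psd by (simp add: a_def)
  define c where "c = 1 / (a + 1)"
  have c: "c > 0" using a by (simp add: c_def)
  define t where "t = - (b * c)"
  have "0 \<le> (v + t *\<^sub>R w) \<bullet> (M *v (v + t *\<^sub>R w))" by (rule psd)
  also have "\<dots> = 2 * t * b + t\<^sup>2 * a"
    using z inner_matrix_symmetric[OF sym, of v w]
    by (simp add: matrix_vector_right_distrib matrix_vector_mult_scaleR inner_add_left inner_add_right
        a_def b_def w_def power2_eq_square algebra_simps)
  also have "\<dots> = b\<^sup>2 * c * (a * c - 2)"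
    by (simp add: t_def power2_eq_square algebra_simps)
  also have "\<dots> < 0"
  proof (rule mult_pos_neg)
    show "0 < b\<^sup>2 * c" using c b by simp
    have "a * c \<le> 1" using a by (simp add: c_def)
    then show "a * c - 2 < 0" by simp
  qed
  finally show False by simp
qed

text \<open>\<open>lambda_min\<close> is a \<open>LEAST\<close> over eigenvalues, so a least one has
  to be exhibited. It is the minimum \<open>m\<close> of the quadratic form on the unit sphere:
  \<open>M - mat m\<close> is positive semidefinite with vanishing form at the minimizer
  \<open>v0\<close>, so \<open>v0\<close> lies in its kernel.\<close>

lemma lambda_min_le_Rayleigh:
  fixes M :: "real^'n^'n"
  assumes sym: "transpose M = M"
  shows "lambda_min M * (norm v)\<^sup>2 \<le> v \<bullet> (M *v v)"
proof -
  have "compact (sphere (0::real^'n) 1)" by simp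
  moreover have "sphere (0::real^'n) 1 \<noteq> {}" by simp
  moreover have "continuous_on (sphere 0 1) (\<lambda>v. v \<bullet> (M *v v))"
    by (intro continuous_intros linear_continuous_on matrix_vector_mul_bounded_linear)
  ultimately obtain v0 where v0: "v0 \<in> sphere 0 1"
    and min: "\<And>v. v \<in> sphere 0 1 \<Longrightarrow> v0 \<bullet> (M *v v0) \<le> v \<bullet> (M *v v)"
    using continuous_attains_inf[of "sphere 0 1" "\<lambda>v. v \<bullet> (M *v v)"] by blast
  define m where "m = v0 \<bullet> (M *v v0)"
  have n0: "norm v0 = 1" using v0 by simp
  have ray: "m * (norm v)\<^sup>2 \<le> v \<bullet> (M *v v)" for v
  proof (cases "v = 0")
    case False
    then have "sgn v \<in> sphere 0 1" by (simp add: norm_sgn)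
    then have "m \<le> sgn v \<bullet> (M *v sgn v)" unfolding m_def by (rule min)
    also have "\<dots> = (v \<bullet> (M *v v)) / (norm v)\<^sup>2"
      by (simp add: sgn_div_norm matrix_vector_mult_scaleR power2_eq_square divide_inverse)
    finally show ?thesis using False by (simp add: pos_le_divide_eq)
  qed simp
  define N where "N = M - mat m"
  have Nv: "N *v v = M *v v - m *\<^sub>R v" for v
    by (simp add: N_def matrix_vector_mult_diff_rdistrib mat_vector_mult)
  have "transpose N = N"
    by (rule transpose_eqI)
      (simp add: Nv inner_diff_right inner_matrix_symmetric[OF sym] inner_commute)
  moreover have "0 \<le> v \<bullet> (N *v v)" for v
    using ray[of v] by (simp add: Nv inner_diff_right dot_square_norm)
  moreover have "v0 \<bullet> (N *v v0) = 0"
    by (simp add: Nv inner_diff_right m_def dot_square_norm n0)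
  ultimately have "N *v v0 = 0" by (rule psd_inner_eq_0_imp_kernel)
  then have eig: "M *v v0 = m *\<^sub>R v0" by (simp add: Nv)
  have "lambda_min M = m"
    unfolding lambda_min_def
  proof (rule Least_equality)
    show "\<exists>v. v \<noteq> 0 \<and> M *v v = m *\<^sub>R v" using eig n0 by (intro exI[of _ v0]) auto
    fix a assume "\<exists>v. v \<noteq> 0 \<and> M *v v = a *\<^sub>R v"
    then obtain v where v: "v \<noteq> 0" "M *v v = a *\<^sub>R v" by blast
    then have "m * (norm v)\<^sup>2 \<le> a * (norm v)\<^sup>2" using ray[of v] by (simp add: dot_square_norm)
    then show "m \<le> a" using v by simp
  qed
  with ray show ?thesis by simp
qed

lemma matrix_inv_vector_mult:
  fixes M :: "real^'m^'m"
  assumes inj: "\<And>v. M *v v = 0 \<Longrightarrow> v = 0"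
  shows "matrix_inv M *v (M *v v) = v" and "M *v (matrix_inv M *v v) = v"
proof -
  obtain B where B: "B ** M = mat 1" using inj matrix_left_invertible_ker by blast
  then have "M ** B = mat 1" by (simp add: matrix_left_right_inverse)
  with B have ex: "M ** B = mat 1 \<and> B ** M = mat 1" by simp
  then have "M ** matrix_inv M = mat 1 \<and> matrix_inv M ** M = mat 1"
    unfolding matrix_inv_def by (rule someI[where P="\<lambda>A'. M ** A' = mat 1 \<and> A' ** M = mat 1"])
  then show "matrix_inv M *v (M *v v) = v" "M *v (matrix_inv M *v v) = v"
    by (simp_all add: matrix_vector_mul_assoc)
qed

section \<open>Accelerated gradient ascent\<close>

text \<open>With \<open>q = \<surd>(\<mu>/l)\<close>, the auxiliary point \<open>v\<close> is the one for which \<open>yt = (y + q v) / (1 + q)\<close>; it makes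
  the gap plus \<open>\<mu>/2\<close> times the squared distance of \<open>v\<close> from the maximizer a Lyapunov function.\<close>

lemma nag_step_contraction:
  fixes h :: "'b::real_inner \<Rightarrow> real"
  assumes upper: "\<And>y y'. h y' \<le> h y + (y' - y) \<bullet> G y - \<mu> / 2 * (norm (y' - y))\<^sup>2"
    and lower: "\<And>y s. h (y + s) \<ge> h y + s \<bullet> G y - l / 2 * (norm s)\<^sup>2"
    and q: "0 < q" "q \<le> 1" "q\<^sup>2 = \<mu> / l" and pos: "0 < \<mu>" "0 < l"
    and v: "v = (1 / q) *\<^sub>R ((1 + q) *\<^sub>R yt - y)"
    and y': "y' = yt + (1 / l) *\<^sub>R G yt"
    and yt': "yt' = y' + ((1 - q) / (1 + q)) *\<^sub>R (y' - y)"
    and v': "v' = (1 / q) *\<^sub>R ((1 + q) *\<^sub>R yt' - y')"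
  shows "h ys - h y' + \<mu> / 2 * (norm (v' - ys))\<^sup>2 \<le> (1 - q) * (h ys - h y + \<mu> / 2 * (norm (v - ys))\<^sup>2)"
proof -
  define a b g w where "a = v - ys" and "b = yt - ys" and "g = G yt" and "w = (1 - q) *\<^sub>R a + q *\<^sub>R b"
  have lq: "l * q\<^sup>2 = \<mu>" using q pos by simp
  have yy: "y = (1 + q) *\<^sub>R yt - q *\<^sub>R v" using q by (simp add: v)
  have "(1 + q) *\<^sub>R yt' = (1 + q) *\<^sub>R y' + (1 - q) *\<^sub>R (y' - y)"
    using q by (simp add: yt' scaleR_add_right)
  then have "v' = (1 / q) *\<^sub>R ((1 + q) *\<^sub>R y' + (1 - q) *\<^sub>R (y' - y) - y')" by (simp add: v')
  also have "(1 + q) *\<^sub>R y' + (1 - q) *\<^sub>R (y' - y) - y' = y' - (1 - q) *\<^sub>R y"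
    by (simp add: algebra_simps)
  also have "\<dots> = q *\<^sub>R (w + ys) + (1 / l) *\<^sub>R g"
    by (simp add: y' yy w_def a_def b_def g_def algebra_simps power2_eq_square)
  finally have "v' = (1 / q) *\<^sub>R (q *\<^sub>R (w + ys) + (1 / l) *\<^sub>R g)" .
  have v'eq: "v' - ys = w + (q / \<mu>) *\<^sub>R g"
  proof -
    have "1 / q * (1 / l) = q / \<mu>"
      using q pos by (simp add: lq[symmetric] power2_eq_square)
    then show ?thesis using q \<open>v' = (1 / q) *\<^sub>R (q *\<^sub>R (w + ys) + (1 / l) *\<^sub>R g)\<close> by (simp add: scaleR_add_right)
  qed
  have n1: "(norm (v' - ys))\<^sup>2 = (norm w)\<^sup>2 + 2 * (q / \<mu>) * (w \<bullet> g) + (q / \<mu>)\<^sup>2 * (norm g)\<^sup>2"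
    unfolding v'eq power2_norm_eq_inner
    by (simp add: inner_add_left inner_add_right inner_commute power2_eq_square algebra_simps)
  have "\<mu> / 2 * (norm (v' - ys))\<^sup>2 = \<mu> / 2 * (norm w)\<^sup>2 + q * (w \<bullet> g) + (1 / (2 * l)) * (norm g)\<^sup>2"
    unfolding n1 using pos lq[symmetric] q by (simp add: field_simps power2_eq_square)
  \<comment> \<open>The gain of the ascent step cancels the squared gradient in the preceding
    expansion.\<close>
  moreover have "h y' \<ge> h yt + (1 / (2 * l)) * (norm g)\<^sup>2"
  proof -
    have "h yt + (1 / l) * (norm g)\<^sup>2 - l / 2 * ((1 / l) * norm g)\<^sup>2 \<le> h y'"
      using lower[of yt "(1 / l) *\<^sub>R g"] pos by (simp add: y' g_def dot_square_norm)
    moreover have "l / 2 * ((1 / l) * norm g)\<^sup>2 = 1 / (2 * l) * (norm g)\<^sup>2"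
      using pos by (simp add: power2_eq_square)
    moreover have "(1 / l) * (norm g)\<^sup>2 = 2 * (1 / (2 * l) * (norm g)\<^sup>2)" by simp
    ultimately show ?thesis by linarith
  qed
  moreover have "\<mu> / 2 * (norm w)\<^sup>2 \<le> \<mu> / 2 * ((1 - q) * (norm a)\<^sup>2 + q * (norm b)\<^sup>2)"
  proof -
    have "(1 - q) * (norm a)\<^sup>2 + q * (norm b)\<^sup>2 - (norm w)\<^sup>2 = q * (1 - q) * (norm (a - b))\<^sup>2"
      unfolding w_def power2_norm_eq_inner
      by (simp add: inner_add_left inner_add_right inner_diff_left inner_diff_right inner_commute power2_eq_square algebra_simps)
    then have "(norm w)\<^sup>2 \<le> (1 - q) * (norm a)\<^sup>2 + q * (norm b)\<^sup>2"
      using q by (smt (verit) mult_nonneg_nonneg zero_le_power2)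
    then show ?thesis using pos by simp
  qed
  \<comment> \<open>The weights \<open>q\<close> at \<open>ys\<close> and \<open>1 - q\<close> at
    \<open>y\<close> are those of \<open>b\<close> and \<open>a\<close> in \<open>w\<close>; with
    them all inner products with \<open>g\<close> cancel in the final sum.\<close>
  moreover have "q * h ys \<le> q * (h yt - b \<bullet> g - \<mu> / 2 * (norm b)\<^sup>2)"
  proof -
    have "ys - yt = - b" by (simp add: b_def)
    then show ?thesis using upper[of ys yt] q by (simp add: g_def)
  qed
  moreover have "(1 - q) * h y \<le> (1 - q) * (h yt + q * (b \<bullet> g - a \<bullet> g))"
  proof -
    have "y - yt = q *\<^sub>R (b - a)" by (simp add: yy a_def b_def algebra_simps)
    then have "h y \<le> h yt + q * (b \<bullet> g - a \<bullet> g) - \<mu> / 2 * (norm (y - yt))\<^sup>2"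
      using upper[of y yt] by (simp add: g_def inner_diff_left)
    then have "h y \<le> h yt + q * (b \<bullet> g - a \<bullet> g)" using pos by (smt (verit) mult_nonneg_nonneg zero_le_power2 divide_nonneg_pos)
    then show ?thesis using q by (intro mult_left_mono) auto
  qed
  moreover have "q * (w \<bullet> g) = q * ((1 - q) * (a \<bullet> g)) + q * (q * (b \<bullet> g))"
    by (simp add: w_def inner_add_left algebra_simps)
  ultimately show ?thesis
    unfolding a_def[symmetric] by (simp add: algebra_simps add_divide_distrib diff_divide_distrib)
qed

text \<open>The Lyapunov function starts below \<open>(l + \<mu>) / 2\<close> times the squared
  distance, since initially \<open>v = y0\<close>, and it always dominates \<open>\<mu> / 2\<close>
  times that of the iterate. The ratio and a square root give the factor
  \<open>sqrt (l / \<mu> + 1)\<close> and the 2 in the exponent.\<close>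

lemma nag_convergence:
  fixes h :: "'b::real_inner \<Rightarrow> real"
  assumes upper: "\<And>y y'. h y' \<le> h y + (y' - y) \<bullet> G y - \<mu> / 2 * (norm (y' - y))\<^sup>2"
    and lower: "\<And>y s. h (y + s) \<ge> h y + s \<bullet> G y - l / 2 * (norm s)\<^sup>2"
    and max: "\<And>y. h y \<le> h ys" and G0: "G ys = 0" and pos: "0 < \<mu>" "\<mu> \<le> l"
  shows "norm (fst (nag G (1 / l) ((sqrt (l / \<mu>) - 1) / (sqrt (l / \<mu>) + 1)) y0 k) - ys)
     \<le> sqrt (l / \<mu> + 1) * exp (- (k / (2 * sqrt (l / \<mu>)))) * norm (y0 - ys)"
proof -
  define q where "q = 1 / sqrt (l / \<mu>)"
  let ?\<theta> = "(sqrt (l / \<mu>) - 1) / (sqrt (l / \<mu>) + 1)"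
  have sq: "sqrt (l / \<mu>) \<ge> 1" using pos by simp
  have q: "0 < q" "q \<le> 1" "q\<^sup>2 = \<mu> / l"
    using sq pos by (auto simp: q_def power_divide)
  have \<theta>: "?\<theta> = (1 - q) / (1 + q)" 
  proof -
    have "1 - q = (sqrt (l / \<mu>) - 1) / sqrt (l / \<mu>)" "1 + q = (sqrt (l / \<mu>) + 1) / sqrt (l / \<mu>)"
      using sq pos by (simp_all only: q_def diff_divide_distrib add_divide_distrib) auto
    then show ?thesis using sq pos by simp
  qed
  define E where "E y v = h ys - h y + \<mu> / 2 * (norm (v - ys))\<^sup>2" for y v
  define V where "V p = (1 / q) *\<^sub>R ((1 + q) *\<^sub>R snd p - fst p)" for p :: "'b \<times> 'b"
  let ?n = "nag G (1 / l) ?\<theta> y0"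
  have "E (fst (?n k)) (V (?n k)) \<le> (1 - q) ^ k * E y0 y0"
  proof (induction k)
    case 0
    have "V (y0, y0) = y0" using q by (simp add: V_def algebra_simps)
    then show ?case by simp
  next
    case (Suc k)
    obtain y yt where p: "?n k = (y, yt)" by fastforce
    define y' where "y' = yt + (1 / l) *\<^sub>R G yt"
    define yt' where "yt' = y' + ((1 - q) / (1 + q)) *\<^sub>R (y' - y)"
    have s: "?n (Suc k) = (y', yt')" by (simp add: Let_def p[unfolded \<theta>] y'_def yt'_def \<theta>)
    have "E y' (V (y', yt')) \<le> (1 - q) * E y (V (y, yt))"
      unfolding E_def
      by (rule nag_step_contraction[OF upper lower q _ _ _ y'_def yt'_def]) (use pos in \<open>auto simp: V_def\<close>)
    also have "\<dots> \<le> (1 - q) * ((1 - q) ^ k * E y0 y0)"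
      using Suc.IH q by (intro mult_left_mono) (auto simp: p)
    finally show ?case unfolding s by (simp add: mult.assoc)
  qed
  also have "\<dots> \<le> exp (- q) ^ k * ((l + \<mu>) / 2 * (norm (y0 - ys))\<^sup>2)"
  proof (rule mult_mono)
    show "E y0 y0 \<le> (l + \<mu>) / 2 * (norm (y0 - ys))\<^sup>2"
      using lower[of ys "y0 - ys"] by (simp add: E_def G0 field_simps)
    show "(1 - q) ^ k \<le> exp (- q) ^ k"
      using q exp_ge_add_one_self[of "- q"] by (intro power_mono) auto
    show "0 \<le> E y0 y0" using pos max[of y0] by (simp add: E_def)
  qed simp
  finally have "E (fst (?n k)) (V (?n k)) \<le> exp (- q) ^ k * ((l + \<mu>) / 2 * (norm (y0 - ys))\<^sup>2)" .
  moreover have "\<mu> / 2 * (norm (fst (?n k) - ys))\<^sup>2 \<le> E (fst (?n k)) (V (?n k))"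
  proof -
    let ?y = "fst (?n k)"
    have "\<mu> / 2 * (norm (?y - ys))\<^sup>2 \<le> h ys - h ?y"
      using upper[of ?y ys] by (simp add: G0)
    moreover have "0 \<le> \<mu> / 2 * (norm (V (?n k) - ys))\<^sup>2" using pos by simp
    ultimately show ?thesis unfolding E_def by linarith
  qed
  ultimately have "\<mu> / 2 * (norm (fst (?n k) - ys))\<^sup>2 \<le> exp (- q) ^ k * ((l + \<mu>) / 2 * (norm (y0 - ys))\<^sup>2)"
    by linarith
  then have "(norm (fst (?n k) - ys))\<^sup>2 \<le> (l / \<mu> + 1) * exp (- q) ^ k * (norm (y0 - ys))\<^sup>2"
    using pos by (simp add: field_simps)
  also have "\<dots> = (sqrt (l / \<mu> + 1) * exp (- (k / (2 * sqrt (l / \<mu>)))) * norm (y0 - ys))\<^sup>2"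
  proof -
    have "exp (- q) ^ k = exp (- (k * q))" by (simp add: exp_of_nat_mult[symmetric])
    also have "\<dots> = (exp (- (k / (2 * sqrt (l / \<mu>)))))\<^sup>2"
      by (simp add: q_def exp_double[symmetric])
    finally show ?thesis using pos by (simp add: power_mult_distrib)
  qed
  finally show ?thesis
    by (rule power2_le_imp_le) (use pos in simp)
qed

section \<open>The primal function of a nonconvex-strongly-concave problem\<close>

locale nonconvex_strongly_concave =
  fixes f :: "(real^'n) \<times> (real^'m) \<Rightarrow> real" and l \<mu> \<rho> :: real
  assumes mu_pos: "0 < \<mu>" and rho_pos: "0 < \<rho>"
    and f_diff: "\<And>z. f differentiable (at z)"
    and sc: "\<And>x. strongly_concave \<mu> (\<lambda>y. f (x, y))"
    and lip: "l-lipschitz_on UNIV (grad f)"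
    and second: "second_partials_exist f"
    and lip_xx: "spectral_lipschitz \<rho> (hess_xx f)" and lip_xy: "spectral_lipschitz \<rho> (hess_xy f)"
    and lip_yx: "spectral_lipschitz \<rho> (hess_yx f)" and lip_yy: "spectral_lipschitz \<rho> (hess_yy f)"
begin

section \<open>Partial gradients, Hessian blocks and expansiveness in the second variable\<close>

abbreviation "\<kappa> \<equiv> kappa l \<mu>"

lemma der_partial_x: "((\<lambda>x. f (x, y)) has_derivative (\<lambda>h. h \<bullet> fst (grad f (x, y)))) (at x)"
proof -
  have "((\<lambda>x. f (x, y)) has_derivative (\<lambda>h. (h, 0) \<bullet> grad f (x, y))) (at x)"
    by (rule has_derivative_compose[where g = f and f = "\<lambda>x. (x, y)"])
      (auto intro!: derivative_eq_intros has_derivative_grad f_diff)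
  then show ?thesis by (simp add: inner_prod_def)
qed

lemma der_partial_y: "((\<lambda>y. f (x, y)) has_derivative (\<lambda>h. h \<bullet> snd (grad f (x, y)))) (at y)"
proof -
  have "((\<lambda>y. f (x, y)) has_derivative (\<lambda>h. (0, h) \<bullet> grad f (x, y))) (at y)"
    by (rule has_derivative_compose[where g = f and f = "\<lambda>y. (x, y)"])
      (auto intro!: derivative_eq_intros has_derivative_grad f_diff)
  then show ?thesis by (simp add: inner_prod_def)
qed

lemma grad_x_eq: "grad_x f x y = fst (grad f (x, y))"
  unfolding grad_x_def by (rule grad_unique) (rule der_partial_x)

lemma grad_y_eq: "grad_y f x y = snd (grad f (x, y))"
  unfolding grad_y_def by (rule grad_unique) (rule der_partial_y)

lemma grad_eq: "grad f z = (grad_x f (fst z) (snd z), grad_y f (fst z) (snd z))"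
  by (simp add: grad_x_eq grad_y_eq)

lemma der_y: "((\<lambda>y. f (x, y)) has_derivative (\<lambda>h. h \<bullet> grad_y f x y)) (at y)"
  using der_partial_y by (simp add: grad_y_eq)

lemma grad_lipschitz: "norm (grad f z - grad f z') \<le> l * norm (z - z')"
  using lipschitz_onD[OF lip, of z z'] by (simp add: dist_norm)

lemma grad_x_lipschitz: "norm (grad_x f x y - grad_x f x' y') \<le> l * norm ((x, y) - (x', y'))"
  using order_trans[OF norm_fst_le[of "fst (grad f (x, y) - grad f (x', y'))" "snd (grad f (x, y) - grad f (x', y'))", unfolded prod.collapse]
      grad_lipschitz[of "(x, y)" "(x', y')"]]
  by (simp add: grad_x_eq)

lemma grad_y_lipschitz: "norm (grad_y f x y - grad_y f x' y') \<le> l * norm ((x, y) - (x', y'))"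
  using order_trans[OF norm_snd_le[of "snd (grad f (x, y) - grad f (x', y'))" "fst (grad f (x, y) - grad f (x', y'))", unfolded prod.collapse]
      grad_lipschitz[of "(x, y)" "(x', y')"]]
  by (simp add: grad_y_eq)

lemma hess_blocks:
  shows der_xx: "((\<lambda>x. grad_x f x y) has_derivative (*v) (hess_xx f (x, y))) (at x)"
    and der_xy: "((\<lambda>y. grad_x f x y) has_derivative (*v) (hess_xy f (x, y))) (at y)"
    and der_yx: "((\<lambda>x. grad_y f x y) has_derivative (*v) (hess_yx f (x, y))) (at x)"
    and der_yy: "((\<lambda>y. grad_y f x y) has_derivative (*v) (hess_yy f (x, y))) (at y)"
  using second unfolding second_partials_exist_def hess_xx_def hess_xy_def hess_yx_def hess_yy_def
  by (auto simp: jacobian_works)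

lemma spectral_lipschitzD:
  fixes M :: "(real^'n) \<times> (real^'m) \<Rightarrow> real^'p^'q"
  assumes "spectral_lipschitz \<rho> M"
  shows "norm (M z *v v - M z' *v v) \<le> \<rho> * norm (z - z') * norm v"
proof -
  have "norm ((M z - M z') *v v) \<le> onorm ((*v) (M z - M z')) * norm v"
    by (rule norm_matrix_vector_mult_le)
  also have "\<dots> \<le> (\<rho> * norm (z - z')) * norm v"
    using assms[unfolded spectral_lipschitz_def dist_norm, rule_format, of z z'] by (simp add: mult_right_mono)
  finally show ?thesis by (simp add: matrix_vector_mult_diff_rdistrib)
qed

lemma hess_block_bounds:
  shows hess_xx_bound: "norm (hess_xx f z *v v) \<le> l * norm v"
    and hess_xy_bound: "norm (hess_xy f z *v w) \<le> l * norm w"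
    and hess_yx_bound: "norm (hess_yx f z *v v) \<le> l * norm v"
proof -
  obtain x y where z: "z = (x, y)" by fastforce
  show "norm (hess_xx f z *v v) \<le> l * norm v" unfolding z
    by (rule norm_derivative_le_lipschitz[OF der_xx])
      (use grad_x_lipschitz[of _ y _ y] in \<open>simp add: norm_Pair\<close>)
  show "norm (hess_xy f z *v w) \<le> l * norm w" unfolding z
    by (rule norm_derivative_le_lipschitz[OF der_xy])
      (use grad_x_lipschitz[of x _ x _] in \<open>simp add: norm_Pair\<close>)
  show "norm (hess_yx f z *v v) \<le> l * norm v" unfolding z
    by (rule norm_derivative_le_lipschitz[OF der_yx])
      (use grad_y_lipschitz[of _ y _ y] in \<open>simp add: norm_Pair\<close>)
qed

lemma f_y_upper: "f (x, y') \<le> f (x, y) + (y' - y) \<bullet> grad_y f x y - \<mu> / 2 * (norm (y' - y))\<^sup>2"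
  using strongly_concave_le_quadratic[OF sc der_y] by simp

lemma f_y_lower: "f (x, y + s) \<ge> f (x, y) + s \<bullet> grad_y f x y - l / 2 * (norm s)\<^sup>2"
  by (rule lipschitz_grad_lower[where h = "\<lambda>y. f (x, y)", OF der_y])
    (use grad_y_lipschitz[of x _ x _] in \<open>simp add: norm_Pair\<close>)

text \<open>Adding the tangent bounds at the two points gives strong monotonicity of the negated
  gradient; Cauchy-Schwarz does the rest.\<close>

lemma grad_y_expansive: "\<mu> * norm (y - y') \<le> norm (grad_y f x y - grad_y f x y')"
proof (cases "y = y'")
  case False
  have "\<mu> * (norm (y - y'))\<^sup>2 \<le> (y - y') \<bullet> (grad_y f x y' - grad_y f x y)"
    using f_y_upper[of x y' y] f_y_upper[of x y y']
    by (simp add: norm_minus_commute inner_diff_left inner_diff_right)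
  also have "\<dots> \<le> norm (y - y') * norm (grad_y f x y' - grad_y f x y)"
    by (rule norm_cauchy_schwarz)
  finally have "(\<mu> * norm (y - y')) * norm (y - y') \<le> norm (grad_y f x y - grad_y f x y') * norm (y - y')"
    by (simp add: power2_eq_square norm_minus_commute ac_simps)
  then show ?thesis using False by simp
qed simp

text \<open>Expansiveness and Lipschitz continuity are compared on a unit vector, which exists
  because index types are nonempty. Positivity of \<open>l\<close> and
  \<open>\<kappa> \<ge> 1\<close> are drawn from here.\<close>

lemma mu_le_l: "\<mu> \<le> l"
proof -
  define e :: "real^'m" where "e = axis undefined 1"
  have e: "norm e = 1" by (simp add: e_def)
  have "\<mu> * norm (e - 0) \<le> l * norm ((0, e) - (0::real^'n, 0::real^'m))"
    using grad_y_expansive[of e 0 0] grad_y_lipschitz[of 0 e 0 0] by linarith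
  then show ?thesis by (simp add: norm_Pair e)
qed

lemma l_pos: "0 < l" using mu_le_l mu_pos by simp

lemma kappa_ge_1: "1 \<le> \<kappa>" using mu_le_l mu_pos by (simp add: kappa_def)

text \<open>Expansiveness passes from the gradient to its derivative: for the displacement
  \<open>t *\<^sub>R v\<close> the two differ by at most \<open>t * (t * c)\<close>, and
  \<open>t * c \<le> e\<close> remains after division by \<open>t\<close>. Injectivity of
  \<open>hess_yy\<close> follows.\<close>

lemma hess_yy_expansive: "\<mu> * norm v \<le> norm (hess_yy f z *v v)"
proof (rule field_le_epsilon)
  obtain x y where z: "z = (x, y)" by fastforce
  fix e :: real assume e: "0 < e"
  define c where "c = \<rho> / 2 * (norm v)\<^sup>2"
  have c: "c \<ge> 0" using rho_pos by (simp add: c_def)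
  define t where "t = e / (c + 1)"
  have t: "t > 0" using e c by (simp add: t_def)
  have "norm (grad_y f x (y + t *\<^sub>R v) - grad_y f x y - hess_yy f (x, y) *v (t *\<^sub>R v)) \<le> \<rho> / 2 * (norm (t *\<^sub>R v))\<^sup>2"
    by (rule lipschitz_derivative_remainder[where G = "\<lambda>y v. hess_yy f (x, y) *v v", OF der_yy])
      (use spectral_lipschitzD[OF lip_yy, of "(x, _)" _ "(x, _)"] in \<open>simp add: norm_Pair\<close>)
  then have "norm (grad_y f x (y + t *\<^sub>R v) - grad_y f x y - t *\<^sub>R (hess_yy f z *v v)) \<le> t * (t * c)"
    using t by (simp add: z c_def matrix_vector_mult_scaleR power2_eq_square mult_ac)
  moreover have "t * (\<mu> * norm v) \<le> norm (grad_y f x (y + t *\<^sub>R v) - grad_y f x y)"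
    using grad_y_expansive[of "y + t *\<^sub>R v" y x] t by (simp add: mult_ac)
  ultimately have "t * (\<mu> * norm v) \<le> norm (t *\<^sub>R (hess_yy f z *v v)) + t * (t * c)"
    using norm_triangle_sub[of "grad_y f x (y + t *\<^sub>R v) - grad_y f x y" "t *\<^sub>R (hess_yy f z *v v)"] by linarith
  then have "t * (\<mu> * norm v) \<le> t * (norm (hess_yy f z *v v) + t * c)"
    using t by (simp add: algebra_simps)
  then have "\<mu> * norm v \<le> norm (hess_yy f z *v v) + t * c" using t by simp
  also have "t * c \<le> t * (c + 1)" using t by simp
  also have "\<dots> = e" using c by (simp add: t_def)
  finally show "\<mu> * norm v \<le> norm (hess_yy f z *v v) + e" by simp
qed

text \<open>At \<open>z = (x, ystar f x)\<close> this is the negated derivative of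
  \<open>ystar\<close> in direction \<open>v\<close>. Estimates then use the linear equation
  \<open>hess_yy f z *v corr z v = hess_yx f z *v v\<close> instead of the inverse matrix.\<close>

definition "corr z v = matrix_inv (hess_yy f z) *v (hess_yx f z *v v)"

lemma hess_yy_inv:
  shows "matrix_inv (hess_yy f z) *v (hess_yy f z *v v) = v"
    and "hess_yy f z *v (matrix_inv (hess_yy f z) *v v) = v"
proof -
  have "v = 0" if "hess_yy f z *v v = 0" for v
    using hess_yy_expansive[of v z] mu_pos that by (simp add: mult_le_0_iff)
  then show "matrix_inv (hess_yy f z) *v (hess_yy f z *v v) = v"
    and "hess_yy f z *v (matrix_inv (hess_yy f z) *v v) = v"
    by (auto intro!: matrix_inv_vector_mult)
qed

lemma hess_yy_corr: "hess_yy f z *v corr z v = hess_yx f z *v v"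
  by (simp add: corr_def hess_yy_inv)

lemma corr_bound: "norm (corr z v) \<le> \<kappa> * norm v"
  using hess_yy_expansive[of "corr z v" z] hess_yx_bound[of z v] mu_pos
  by (simp add: hess_yy_corr kappa_def field_simps)

section \<open>The Schur complement: symmetry, bound and Lipschitz constant\<close>

definition "S z = schur_hess f (fst z) (snd z)"

lemma S_apply: "S z *v v = hess_xx f z *v v - hess_xy f z *v corr z v"
  by (simp add: S_def schur_hess_def corr_def matrix_vector_mult_diff_rdistrib
      flip: matrix_vector_mul_assoc)

lemma der_grad_x: "((\<lambda>z. grad_x f (fst z) (snd z)) has_derivative
    (\<lambda>h. hess_xx f z *v fst h + hess_xy f z *v snd h)) (at z)"
  by (rule has_derivative_joint[OF _ der_xx der_xy lip_xy]) (use rho_pos in simp)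

lemma der_grad_y: "((\<lambda>z. grad_y f (fst z) (snd z)) has_derivative
    (\<lambda>h. hess_yx f z *v fst h + hess_yy f z *v snd h)) (at z)"
  by (rule has_derivative_joint[OF _ der_yx der_yy lip_yy]) (use rho_pos in simp)

text \<open>The joint derivative of \<open>grad f\<close> is symmetric; tested on pairs with one
  zero component, this makes the mixed blocks transposes of each other. The correction term then
  equals the \<open>hess_yy\<close> form of \<open>corr z v\<close> and
  \<open>corr z w\<close>.\<close>

lemma S_symmetric: "transpose (S z) = S z"
proof (rule transpose_eqI)
  fix v w
  let ?A = "\<lambda>h. (hess_xx f z *v fst h + hess_xy f z *v snd h, hess_yx f z *v fst h + hess_yy f z *v snd h)"
  have "(grad f has_derivative ?A) (at z)"
    using has_derivative_Pair[OF der_grad_x der_grad_y] by (simp flip: grad_eq)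
  with has_derivative_grad[OF f_diff] have sym: "p \<bullet> ?A q = q \<bullet> ?A p" for p q
    by (rule second_derivative_symmetric)
  have xx: "v \<bullet> (hess_xx f z *v w) = w \<bullet> (hess_xx f z *v v)"
    using sym[of "(v, 0)" "(w, 0)"] by (simp add: inner_prod_def)
  have xy: "a \<bullet> (hess_xy f z *v b) = b \<bullet> (hess_yx f z *v a)" for a b
    using sym[of "(a, 0)" "(0, b)"] by (simp add: inner_prod_def)
  have yy: "a \<bullet> (hess_yy f z *v b) = b \<bullet> (hess_yy f z *v a)" for a b
    using sym[of "(0, a)" "(0, b)"] by (simp add: inner_prod_def)
  have "v \<bullet> (hess_xy f z *v corr z w) = corr z w \<bullet> (hess_yy f z *v corr z v)"
    by (simp add: xy hess_yy_corr)
  also have "\<dots> = corr z v \<bullet> (hess_yy f z *v corr z w)" by (rule yy)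
  also have "\<dots> = w \<bullet> (hess_xy f z *v corr z v)" by (simp add: xy hess_yy_corr)
  finally show "v \<bullet> (S z *v w) = w \<bullet> (S z *v v)"
    by (simp add: S_apply inner_diff_right xx)
qed

lemma S_bound: "norm (S z *v v) \<le> L1 l \<mu> * norm v"
proof -
  have "norm (hess_xy f z *v corr z v) \<le> l * (\<kappa> * norm v)"
    using hess_xy_bound[of z "corr z v"] corr_bound[of z v] l_pos
    by (meson mult_left_mono order.trans less_imp_le)
  then show ?thesis
    using hess_xx_bound[of z v] norm_triangle_ineq4[of "hess_xx f z *v v" "hess_xy f z *v corr z v"]
    by (simp add: S_apply L1_def algebra_simps)
qed

text \<open>The difference of the two corrections solves a system with matrix
  \<open>hess_yy f z\<close> and right-hand side of size at most
  \<open>d * (1 + \<kappa>) * norm v\<close>, so expansiveness bounds it. The contributions of the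
  blocks add up to 1 + \<kappa> + \<kappa> (1 + \<kappa>) = (1 + \<kappa>)^2, the factor in
  \<open>LH\<close>.\<close>

lemma S_lipschitz: "norm (S z *v v - S z' *v v) \<le> LH l \<mu> \<rho> * norm (z - z') * norm v"
proof -
  define d where "d = \<rho> * norm (z - z')"
  have d: "0 \<le> d" using rho_pos by (simp add: d_def)
  define p p' where "p = corr z v" and "p' = corr z' v"
  have "hess_yy f z *v (p - p') = (hess_yx f z *v v - hess_yx f z' *v v) - (hess_yy f z *v p' - hess_yy f z' *v p')"
    by (simp add: matrix_vector_mult_diff_distrib p_def p'_def hess_yy_corr)
  then have "norm (hess_yy f z *v (p - p')) \<le> d * norm v + d * norm p'"
    using spectral_lipschitzD[OF lip_yx, of z v z'] spectral_lipschitzD[OF lip_yy, of z p' z']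
      norm_triangle_ineq4[of "hess_yx f z *v v - hess_yx f z' *v v" "hess_yy f z *v p' - hess_yy f z' *v p'"]
    by (simp add: d_def)
  also have "\<dots> \<le> d * norm v + d * (\<kappa> * norm v)"
    using corr_bound[of z' v] d by (simp add: p'_def mult_left_mono)
  finally have "\<mu> * norm (p - p') \<le> d * (1 + \<kappa>) * norm v"
    using hess_yy_expansive[of "p - p'" z] by (simp add: algebra_simps)
  then have pp: "norm (p - p') \<le> d * (1 + \<kappa>) / \<mu> * norm v"
    using mu_pos by (simp add: field_simps)
  have "norm (hess_xy f z' *v (p - p')) \<le> l * (d * (1 + \<kappa>) / \<mu> * norm v)"
    using hess_xy_bound[of z' "p - p'"] pp l_pos by (meson mult_left_mono order.trans less_imp_le)
  also have "\<dots> = d * \<kappa> * (1 + \<kappa>) * norm v" by (simp add: kappa_def)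
  finally have 1: "norm (hess_xy f z' *v (p - p')) \<le> d * \<kappa> * (1 + \<kappa>) * norm v" .
  have 2: "norm (hess_xy f z *v p - hess_xy f z' *v p) \<le> d * (\<kappa> * norm v)"
    using spectral_lipschitzD[OF lip_xy, of z p z'] corr_bound[of z v] d
    unfolding d_def[symmetric] p_def by (meson mult_left_mono order.trans)
  have 3: "norm (hess_xx f z *v v - hess_xx f z' *v v) \<le> d * norm v"
    using spectral_lipschitzD[OF lip_xx, of z v z'] by (simp add: d_def)
  have "S z *v v - S z' *v v = (hess_xx f z *v v - hess_xx f z' *v v)
      - ((hess_xy f z *v p - hess_xy f z' *v p) + hess_xy f z' *v (p - p'))"
    by (simp add: S_apply p_def p'_def matrix_vector_mult_diff_distrib)
  then have "norm (S z *v v - S z' *v v) = norm ((hess_xx f z *v v - hess_xx f z' *v v)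
      - ((hess_xy f z *v p - hess_xy f z' *v p) + hess_xy f z' *v (p - p')))"
    by (rule arg_cong)
  then have "norm (S z *v v - S z' *v v) \<le> d * norm v + (d * (\<kappa> * norm v) + d * \<kappa> * (1 + \<kappa>) * norm v)"
    using 1 2 3 norm_triangle_ineq4[of "hess_xx f z *v v - hess_xx f z' *v v"
        "(hess_xy f z *v p - hess_xy f z' *v p) + hess_xy f z' *v (p - p')"]
      norm_triangle_ineq[of "hess_xy f z *v p - hess_xy f z' *v p" "hess_xy f z' *v (p - p')"]
    by linarith
  also have "\<dots> = LH l \<mu> \<rho> * norm (z - z') * norm v"
    by (simp add: LH_def d_def power2_eq_square algebra_simps)
  finally show ?thesis .
qed

section \<open>The inner maximizer and the derivatives of the primal function\<close>

abbreviation "ys \<equiv> ystar f"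
abbreviation "P \<equiv> primal f"

text \<open>\<open>ystar\<close> is a choice, so a maximizer must be shown to exist. By the
  quadratic bound at 0, points outside the ball of radius \<open>R\<close> are no better than 0;
  compactness handles the ball.\<close>

lemma ystar_max: "f (x, y) \<le> f (x, ys x)"
proof -
  let ?h = "\<lambda>y. f (x, y)" and ?g = "grad_y f x 0"
  define R where "R = 2 * norm ?g / \<mu>"
  have R: "R \<ge> 0" using mu_pos by (simp add: R_def)
  have "continuous_on UNIV ?h"
    by (rule has_derivative_continuous_on) (use der_y in blast)
  then have "continuous_on (cball 0 R) ?h" by (rule continuous_on_subset) simp
  moreover have "cball (0::real^'m) R \<noteq> {}" using R by simp
  ultimately obtain y1 where y1: "\<And>y. y \<in> cball 0 R \<Longrightarrow> ?h y \<le> ?h y1"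
    using continuous_attains_sup[of "cball 0 R" ?h] compact_cball by blast
  have "?h y \<le> ?h y1" for y
  proof (cases "y \<in> cball 0 R")
    case False
    then have "norm ?g \<le> \<mu> / 2 * norm y" using mu_pos by (simp add: R_def field_simps)
    then have "y \<bullet> ?g \<le> norm y * (\<mu> / 2 * norm y)"
      by (intro order_trans[OF norm_cauchy_schwarz] mult_left_mono) auto
    then have "?h y \<le> ?h 0"
      using f_y_upper[of x y 0] by (simp add: power2_eq_square mult_ac)
    also have "?h 0 \<le> ?h y1" by (rule y1) (use R in simp)
    finally show ?thesis .
  qed (rule y1)
  then have "\<exists>y1. is_arg_max ?h (\<lambda>_. True) y1" by (auto simp: is_arg_max_linorder)
  then have "is_arg_max ?h (\<lambda>_. True) (ys x)"
    unfolding ystar_def arg_max_def by (rule someI_ex)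
  then show ?thesis by (simp add: is_arg_max_linorder)
qed

lemma grad_y_ystar: "grad_y f x (ys x) = 0"
proof -
  have "(\<lambda>h. h \<bullet> grad_y f x (ys x)) = (\<lambda>v. 0)"
    by (rule differential_zero_maxmin[OF _ _ der_y, of _ UNIV]) (auto simp: ystar_max)
  then show ?thesis by (metis inner_eq_zero_iff)
qed

lemma primal_eq: "P x = f (x, ys x)"
  unfolding primal_def by (rule cSup_eq_maximum) (auto simp: ystar_max)

text \<open>The gradient vanishes at both maximizers, so the change in \<open>y\<close> can be
  traded for a change of \<open>x\<close> alone at the fixed point \<open>ys x'\<close>.\<close>

lemma ystar_lipschitz: "norm (ys x - ys x') \<le> \<kappa> * norm (x - x')"
proof -
  have "\<mu> * norm (ys x - ys x') \<le> norm (grad_y f x (ys x) - grad_y f x (ys x'))"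
    by (rule grad_y_expansive)
  also have "\<dots> = norm (grad_y f x' (ys x') - grad_y f x (ys x'))" by (simp add: grad_y_ystar)
  also have "\<dots> \<le> l * norm (x - x')"
    using grad_y_lipschitz[of x' "ys x'" x "ys x'"] by (simp add: norm_Pair norm_minus_commute)
  finally show ?thesis using mu_pos by (simp add: kappa_def field_simps)
qed

text \<open>Implicit differentiation by hand. Since \<open>ystar\<close> is Lipschitz and
  \<open>grad_y\<close> vanishes at both points, the joint linearization of \<open>grad_y\<close> is
  small relative to \<open>norm (x' - x)\<close>; expansiveness of \<open>hess_yy\<close> carries
  this over to \<open>ystar\<close>.\<close>

lemma der_ystar: "(ys has_derivative (\<lambda>h. - corr (x, ys x) h)) (at x)"
proof -
  let ?z = "(x, ys x)"
  have bl: "bounded_linear (\<lambda>h. - corr ?z h)"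
    unfolding corr_def
    by (intro bounded_linear_minus bounded_linear_compose[OF matrix_vector_mul_bounded_linear] matrix_vector_mul_bounded_linear)
  have "\<exists>d>0. \<forall>x'. norm (x' - x) < d \<longrightarrow> norm (ys x' - ys x - - corr ?z (x' - x)) \<le> e * norm (x' - x)"
    if e: "e > 0" for e
  proof -
    \<comment> \<open>\<open>1 + \<kappa>\<close> is the Lipschitz constant of the map to pairs,
      \<open>\<mu>\<close> the expansion factor of \<open>hess_yy\<close>.\<close>
    define e' where "e' = e * \<mu> / (1 + \<kappa>)"
    have e': "e' > 0" using e mu_pos kappa_ge_1 by (simp add: e'_def)
    obtain d where d: "d > 0" and dd: "\<And>z. norm (z - ?z) < d \<Longrightarrow>
        norm (grad_y f (fst z) (snd z) - grad_y f x (ys x)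
          - (hess_yx f ?z *v fst (z - ?z) + hess_yy f ?z *v snd (z - ?z))) \<le> e' * norm (z - ?z)"
      using der_grad_y[of ?z] e' unfolding has_derivative_at_alt by force
    show ?thesis
    proof (intro exI conjI allI impI)
      show "0 < d / (1 + \<kappa>)" using d kappa_ge_1 by simp
      fix x' assume x': "norm (x' - x) < d / (1 + \<kappa>)"
      let ?w = "(x', ys x') - ?z" and ?k = "ys x' - ys x"
      have "norm ?w \<le> norm (x' - x) + norm ?k" by (simp add: norm_Pair_le)
      also have "\<dots> \<le> (1 + \<kappa>) * norm (x' - x)"
        using ystar_lipschitz[of x' x] by (simp add: algebra_simps)
      finally have w: "norm ?w \<le> (1 + \<kappa>) * norm (x' - x)" .
      also have "\<dots> < d" using x' kappa_ge_1 by (simp add: field_simps)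
      finally have "norm (hess_yx f ?z *v (x' - x) + hess_yy f ?z *v ?k) \<le> e' * norm ?w"
        using dd[of "(x', ys x')"] by (simp add: grad_y_ystar flip: norm_minus_cancel[of "_ + _"])
      also have "\<dots> \<le> e' * ((1 + \<kappa>) * norm (x' - x))" using w e' by (intro mult_left_mono) auto
      also have "\<dots> = \<mu> * (e * norm (x' - x))" using kappa_ge_1 by (simp add: e'_def)
      finally have "norm (hess_yy f ?z *v (?k + corr ?z (x' - x))) \<le> \<mu> * (e * norm (x' - x))"
        by (simp add: matrix_vector_right_distrib hess_yy_corr add.commute)
      then have "\<mu> * norm (?k + corr ?z (x' - x)) \<le> \<mu> * (e * norm (x' - x))"
        by (rule order_trans[OF hess_yy_expansive])
      then show "norm (?k - - corr ?z (x' - x)) \<le> e * norm (x' - x)"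
        using mu_pos by simp
    qed
  qed
  with bl show ?thesis unfolding has_derivative_at_alt by blast
qed

lemma der_pair: "((\<lambda>x. (x, ys x)) has_derivative (\<lambda>h. (h, - corr (x, ys x) h))) (at x)"
  by (intro has_derivative_Pair has_derivative_ident der_ystar)

text \<open>Envelope argument: in the chain rule the derivative of \<open>ystar\<close> is paired
  with \<open>grad_y\<close> at the maximizer, which is 0.\<close>

lemma der_primal: "(P has_derivative (\<lambda>h. h \<bullet> grad_x f x (ys x))) (at x)"
proof -
  have "((\<lambda>x. f (x, ys x)) has_derivative (\<lambda>h. (h, - corr (x, ys x) h) \<bullet> grad f (x, ys x))) (at x)"
    by (rule has_derivative_compose[OF der_pair]) (rule has_derivative_grad[OF f_diff])
  moreover have "P = (\<lambda>x. f (x, ys x))" by (simp add: fun_eq_iff primal_eq)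
  ultimately show ?thesis by (simp add: grad_eq grad_y_ystar inner_prod_def)
qed

lemma grad_primal: "grad P x = grad_x f x (ys x)"
  by (rule grad_unique) (rule der_primal)

lemma der_grad_primal: "(grad P has_derivative (*v) (S (x, ys x))) (at x)"
proof -
  let ?z = "(x, ys x)"
  have "((\<lambda>x. grad_x f (fst (x, ys x)) (snd (x, ys x))) has_derivative
      (\<lambda>h. hess_xx f ?z *v fst (h, - corr ?z h) + hess_xy f ?z *v snd (h, - corr ?z h))) (at x)"
    by (rule has_derivative_compose[OF der_pair]) (rule der_grad_x)
  moreover have "grad P = (\<lambda>x. grad_x f x (ys x))" by (simp add: fun_eq_iff grad_primal)
  moreover have "hess_xy f ?z *v (- w) = - (hess_xy f ?z *v w)" for w
    using matrix_vector_mult_scaleR[of "hess_xy f ?z" "-1" w] by simp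
  moreover have "(*v) (S ?z) = (\<lambda>v. hess_xx f ?z *v v - hess_xy f ?z *v corr ?z v)"
    by (simp add: fun_eq_iff S_apply)
  ultimately show ?thesis by simp
qed

lemma hess_primal: "hess P x = S (x, ys x)"
  by (simp add: hess_def jacobian_def flip: frechet_derivative_at[OF der_grad_primal])

text \<open>The map from \<open>x\<close> to \<open>(x, ys x)\<close> is Lipschitz with constant
  \<open>1 + \<kappa>\<close>, the ratio of \<open>L2\<close> to \<open>LH\<close>.\<close>

lemma hess_primal_lipschitz:
  "norm (S (x, ys x) *v v - S (x', ys x') *v v) \<le> L2 l \<mu> \<rho> * norm (x - x') * norm v"
proof -
  have "norm ((x, ys x) - (x', ys x')) \<le> norm (x - x') + norm (ys x - ys x')"
    by (simp add: norm_Pair_le)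
  also have "\<dots> \<le> (1 + \<kappa>) * norm (x - x')"
    using ystar_lipschitz[of x x'] by (simp add: algebra_simps)
  finally have "LH l \<mu> \<rho> * norm ((x, ys x) - (x', ys x')) * norm v \<le> LH l \<mu> \<rho> * ((1 + \<kappa>) * norm (x - x')) * norm v"
    using rho_pos by (intro mult_right_mono mult_left_mono) (auto simp: LH_def)
  then show ?thesis
    using S_lipschitz[of "(x, ys x)" v "(x', ys x')"]
    by (simp add: LH_def L2_def power2_eq_square power3_eq_cube mult_ac)
qed

lemma grad_primal_remainder:
  "norm (grad P (x + s) - grad P x - S (x, ys x) *v s) \<le> L2 l \<mu> \<rho> / 2 * (norm s)\<^sup>2"
  by (rule lipschitz_derivative_remainder[where G = "\<lambda>x v. S (x, ys x) *v v", OF der_grad_primal])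
    (rule hess_primal_lipschitz)

lemma primal_upper:
  "P (x + s) \<le> P x + s \<bullet> grad P x + 1 / 2 * (s \<bullet> (S (x, ys x) *v s)) + L2 l \<mu> \<rho> / 6 * norm s ^ 3"
  by (rule lipschitz_hessian_upper[where g = "grad P" and G = "\<lambda>x v. S (x, ys x) *v v"])
    (auto intro: der_primal[folded grad_primal] grad_primal_remainder simp del: le_divide_eq_numeral1 times_divide_eq_left)

lemma nag_accuracy:
  assumes A: "0 < A" and r: "norm (y0 - ys x) \<le> r"
    and k: "2 * sqrt \<kappa> * ln (sqrt (\<kappa> + 1) * r / A) \<le> real k"
  shows "norm (fst (nag (grad_y f x) (1 / l) ((sqrt \<kappa> - 1) / (sqrt \<kappa> + 1)) y0 k) - ys x) \<le> A"
proof -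
  let ?y = "fst (nag (grad_y f x) (1 / l) ((sqrt \<kappa> - 1) / (sqrt \<kappa> + 1)) y0 k)"
  have le: "norm (?y - ys x) \<le> sqrt (\<kappa> + 1) * exp (- (k / (2 * sqrt \<kappa>))) * norm (y0 - ys x)"
    unfolding kappa_def
    by (rule nag_convergence[where h = "\<lambda>y. f (x, y)", OF f_y_upper f_y_lower ystar_max grad_y_ystar mu_pos mu_le_l])
  have sk: "sqrt \<kappa> \<ge> 1" using kappa_ge_1 by simp
  show ?thesis
  proof (cases "r = 0")
    \<comment> \<open>Here the logarithm is \<open>ln 0\<close> and tells nothing about
      \<open>k\<close>, but the loop already starts at the maximizer.\<close>
    case True
    then have "norm (y0 - ys x) = 0" using r by simp
    with le A show ?thesis by simp
  next
    case False
    then have rp: "r > 0" using r norm_ge_zero[of "y0 - ys x"] by linarith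
    let ?q = "sqrt (\<kappa> + 1) * r / A"
    have qp: "?q > 0" using rp A kappa_ge_1 by simp
    have "ln ?q \<le> k / (2 * sqrt \<kappa>)" using k sk by (simp add: field_simps)
    then have "?q \<le> exp (k / (2 * sqrt \<kappa>))" using qp by (metis exp_le_cancel_iff exp_ln)
    then have "?q * exp (- (k / (2 * sqrt \<kappa>))) \<le> exp (k / (2 * sqrt \<kappa>)) * exp (- (k / (2 * sqrt \<kappa>)))"
      by (rule mult_right_mono) simp
    also have "\<dots> = 1" by (rule exp_minus_inverse)
    finally have "?q * exp (- (k / (2 * sqrt \<kappa>))) \<le> 1" .
    then have "sqrt (\<kappa> + 1) * exp (- (k / (2 * sqrt \<kappa>))) * r \<le> A"
      using A by (simp add: field_simps)
    moreover have "sqrt (\<kappa> + 1) * exp (- (k / (2 * sqrt \<kappa>))) * norm (y0 - ys x)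
        \<le> sqrt (\<kappa> + 1) * exp (- (k / (2 * sqrt \<kappa>))) * r"
      using r kappa_ge_1 by (intro mult_left_mono) auto
    ultimately show ?thesis using le by linarith
  qed
qed

end

section \<open>One iteration\<close>

context nonconvex_strongly_concave
begin

abbreviation "M \<equiv> L2 l \<mu> \<rho>"

lemma constants_pos: "0 < M" "0 < L1 l \<mu>" "0 < LH l \<mu> \<rho>"
  using rho_pos kappa_ge_1 l_pos by (auto simp: L2_def L1_def LH_def)

lemma primal_step_le:
  assumes g: "norm (g - grad P x) \<le> e1"
    and H: "\<And>v. norm (H *v v - S (x, ys x) *v v) \<le> e2 * norm v"
  shows "P (x + s) \<le> P x + s \<bullet> g + e1 * norm s + 1 / 2 * (s \<bullet> (H *v s)) + e2 / 2 * (norm s)\<^sup>2 + M / 6 * norm s ^ 3"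
proof -
  have "s \<bullet> (grad P x - g) \<le> norm s * e1"
    using norm_cauchy_schwarz[of s "grad P x - g"] mult_left_mono[OF g norm_ge_zero[of s]]
    by (simp add: norm_minus_commute)
  moreover have "s \<bullet> (S (x, ys x) *v s - H *v s) \<le> norm s * (e2 * norm s)"
    using norm_cauchy_schwarz[of s "S (x, ys x) *v s - H *v s"] mult_left_mono[OF H[of s] norm_ge_zero[of s]]
    by (simp add: norm_minus_commute)
  ultimately show ?thesis
    using primal_upper[of x s] by (simp add: inner_diff_right power2_eq_square mult_ac)
qed

text \<open>With \<open>r = norm s\<close> and \<open>M * r\<^sup>2 = G\<close>, every term of the
  cubic model is bounded by a multiple of \<open>M * r ^ 3\<close>: gradient error 1/36, curvature
  -1/4, Hessian error 1/72, cubic term 1/6. They add up to -1/24.\<close>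

lemma neg_curvature_decrease:
  assumes \<epsilon>: "0 < \<epsilon>" "\<epsilon> \<le> 1"
    and g: "norm (g - grad P x) \<le> \<epsilon> * sqrt \<epsilon> / 36"
    and H: "\<And>v. norm (H *v v - S (x, ys x) *v v) \<le> sqrt (M * \<epsilon>) / 36 * norm v"
    and G: "G = max (norm g) \<epsilon>"
    and u: "u \<bullet> (H *v u) \<le> - (1 / 2) * sqrt (M * G)" "norm u = 1" "g \<bullet> u \<le> 0"
    and s: "s = sqrt (G / M) *\<^sub>R u"
  shows "P (x + s) \<le> P x - G * sqrt G / (24 * sqrt M)"
proof -
  note M = constants_pos(1)
  have Gp: "G > 0" "\<epsilon> \<le> G" using \<epsilon> G by auto
  define r where "r = sqrt (G / M)"
  have r: "r > 0" using Gp M by (simp add: r_def)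
  have ns: "norm s = r" using r u by (simp add: s r_def)
  have Mr2: "M * r\<^sup>2 = G" using Gp M by (simp add: r_def)
  have "sqrt (M * G) = sqrt ((M * r)\<^sup>2)" by (simp add: Mr2[symmetric] power2_eq_square mult_ac)
  then have Mr: "sqrt (M * G) = M * r" using M r by simp
  have 1: "s \<bullet> g \<le> 0" using u r by (simp add: s r_def[symmetric] inner_commute mult_le_0_iff)
  have "\<epsilon> * sqrt \<epsilon> \<le> \<epsilon> * 1" using \<epsilon> by (intro mult_left_mono) auto
  then have "\<epsilon> * sqrt \<epsilon> / 36 \<le> M * r\<^sup>2 / 36" using Gp Mr2 by simp
  then have 2: "\<epsilon> * sqrt \<epsilon> / 36 * norm s \<le> M * r ^ 3 / 36"
    using r mult_right_mono[of "\<epsilon> * sqrt \<epsilon> / 36" "M * r\<^sup>2 / 36" r] by (simp add: ns power2_eq_square power3_eq_cube mult_ac)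
  have "s \<bullet> (H *v s) = r\<^sup>2 * (u \<bullet> (H *v u))"
    by (simp add: s r_def[symmetric] matrix_vector_mult_scaleR power2_eq_square)
  also have "\<dots> \<le> r\<^sup>2 * (- (1 / 2) * (M * r))" using u by (intro mult_left_mono) (auto simp: Mr)
  finally have 3: "s \<bullet> (H *v s) \<le> - (1 / 2) * (M * r ^ 3)"
    by (simp add: power2_eq_square power3_eq_cube mult_ac)
  have "sqrt (M * \<epsilon>) \<le> M * r" unfolding Mr[symmetric] using Gp M by simp
  then have "sqrt (M * \<epsilon>) * r\<^sup>2 \<le> M * r * r\<^sup>2" by (rule mult_right_mono) simp
  then have 4: "sqrt (M * \<epsilon>) / 36 / 2 * (norm s)\<^sup>2 \<le> M * r ^ 3 / 72"
    by (simp add: ns power2_eq_square power3_eq_cube mult_ac)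
  have "P (x + s) \<le> P x - M * r ^ 3 / 24"
    using primal_step_le[OF g H, of s] 1 2 3 4 unfolding ns by simp
  also have "M * r ^ 3 = G * r" by (simp add: Mr2[symmetric] power2_eq_square power3_eq_cube)
  also have "\<dots> = G * sqrt G / sqrt M" by (simp add: r_def real_sqrt_divide)
  finally show ?thesis by simp
qed

text \<open>With \<open>r = norm s\<close>, the change of \<open>P\<close> is measured in
  \<open>\<sigma> * r\<^sup>2\<close>: curvature and shift contribute at most -3/4, the gradient
  error 1/6, the Hessian error 1/72 and the cubic term 1/3, in total -17/72. The new gradient is
  measured in \<open>\<sigma> * r\<close>: Taylor remainder 1, gradient error 1/6, Hessian error
  1/36 and shift 1, in total 79/36.\<close>

lemma newton_step:
  assumes \<epsilon>: "0 < \<epsilon>" "\<epsilon> \<le> 1"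
    and g: "norm (g - grad P x) \<le> e1" "e1 \<le> \<epsilon> * sqrt \<epsilon> / 36" "e1 \<le> sqrt M / (12 * L1 l \<mu>) * (\<epsilon> * sqrt \<epsilon>)"
    and H: "\<And>v. norm (H *v v - S (x, ys x) *v v) \<le> sqrt (M * \<epsilon>) / 36 * norm v"
    and Hn: "\<And>v. norm (H *v v) \<le> L1 l \<mu> * norm v"
    and \<gamma>: "\<epsilon> \<le> norm g" and \<sigma>: "\<sigma> = sqrt (M * norm g)"
    and psd: "\<And>v. - (1 / 2) * \<sigma> * (norm v)\<^sup>2 \<le> v \<bullet> (H *v v)"
    and s: "H *v s + \<sigma> *\<^sub>R s = - g"
  shows "M * norm s \<le> 2 * \<sigma>" and "e1 \<le> \<sigma> * norm s / 6"
    and "P (x + s) \<le> P x - 17 / 72 * \<sigma> * (norm s)\<^sup>2"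
    and "norm (grad P (x + s)) \<le> 79 / 36 * (\<sigma> * norm s)"
proof -
  note M = constants_pos(1)
  define r where "r = norm s"
  have gp: "norm g > 0" using \<epsilon> \<gamma> by linarith
  have \<sigma>p: "\<sigma> > 0" using M gp by (simp add: \<sigma>)
  have \<sigma>2: "\<sigma> * \<sigma> = M * norm g" using M by (simp add: \<sigma>)
  have r0: "r \<ge> 0" by (simp add: r_def)
  have gs: "s \<bullet> g = - (s \<bullet> (H *v s)) - \<sigma> * r\<^sup>2"
  proof -
    have "s \<bullet> (H *v s + \<sigma> *\<^sub>R s) = - (s \<bullet> g)" by (simp add: s)
    then show ?thesis by (simp add: inner_add_right dot_square_norm r_def)
  qed
  have psd_s: "- (1 / 2) * \<sigma> * r\<^sup>2 \<le> s \<bullet> (H *v s)" using psd[of s] by (simp add: r_def)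
  have "\<sigma> / 2 * r\<^sup>2 \<le> - (s \<bullet> g)" using gs psd_s by simp
  also have "\<dots> \<le> r * norm g" using Cauchy_Schwarz_ineq2[of s g] by (simp add: r_def)
  finally have "r * (\<sigma> * r) \<le> r * (2 * norm g)" by (simp add: power2_eq_square mult_ac)
  then have \<sigma>r: "\<sigma> * r \<le> 2 * norm g"
    using r0 by (cases "r = 0") auto
  have "\<sigma> * (M * r) \<le> M * (2 * norm g)"
    using \<sigma>r M mult_left_mono[of "\<sigma> * r" "2 * norm g" M] by (simp add: mult_ac)
  also have "\<dots> = \<sigma> * (2 * \<sigma>)" using \<sigma>2 by simp
  finally have "\<sigma> * (M * r) \<le> \<sigma> * (2 * \<sigma>)" .
  then have Mr: "M * r \<le> 2 * \<sigma>" using \<sigma>p by simp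
  then show "M * norm s \<le> 2 * \<sigma>" by (simp add: r_def)
  have "norm g = norm (H *v s + \<sigma> *\<^sub>R s)" by (simp add: s)
  also have "\<dots> \<le> L1 l \<mu> * r + \<sigma> * r"
    using norm_triangle_ineq[of "H *v s" "\<sigma> *\<^sub>R s"] Hn[of s] \<sigma>p by (simp add: r_def)
  finally have gr: "norm g \<le> (L1 l \<mu> + \<sigma>) * r" by (simp add: algebra_simps)
  \<comment> \<open>\<open>gr\<close> bounds the step length from below. If \<open>L1\<close>
    dominates, the second bound on \<open>e1\<close> matches it; if \<open>\<sigma>\<close>
    dominates, the first one suffices.\<close>
  have e1: "e1 \<le> \<sigma> * r / 6"
  proof (cases "\<sigma> \<le> L1 l \<mu>")
    case True
    have "norm g \<le> 2 * L1 l \<mu> * r" using gr mult_right_mono[OF True r0] by (simp add: algebra_simps)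
    have "sqrt M * (\<epsilon> * sqrt \<epsilon>) = sqrt (M * \<epsilon>) * \<epsilon>" by (simp add: real_sqrt_mult)
    also have "\<dots> \<le> \<sigma> * norm g" using \<epsilon> \<gamma> M \<sigma>p by (intro mult_mono) (auto simp: \<sigma>)
    also have "\<dots> \<le> \<sigma> * (2 * L1 l \<mu> * r)" using \<open>norm g \<le> 2 * L1 l \<mu> * r\<close> \<sigma>p by simp
    finally have "sqrt M * (\<epsilon> * sqrt \<epsilon>) / (12 * L1 l \<mu>) \<le> \<sigma> * (2 * L1 l \<mu> * r) / (12 * L1 l \<mu>)"
      using constants_pos by (intro divide_right_mono) auto
    also have "\<dots> = \<sigma> * r / 6" using constants_pos(2) by (simp add: field_simps)
    finally have "sqrt M * (\<epsilon> * sqrt \<epsilon>) / (12 * L1 l \<mu>) \<le> \<sigma> * r / 6" .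
    moreover have "e1 \<le> sqrt M * (\<epsilon> * sqrt \<epsilon>) / (12 * L1 l \<mu>)" using g(3) by simp
    ultimately show ?thesis by (rule order_trans[rotated])
  next
    case False
    then have "norm g \<le> 2 * (\<sigma> * r)" using gr mult_right_mono[OF less_imp_le r0, of "L1 l \<mu>" \<sigma>] by (simp add: algebra_simps)
    moreover have "\<epsilon> * sqrt \<epsilon> \<le> \<epsilon> * 1" using \<epsilon> by (intro mult_left_mono) auto
    moreover have "0 \<le> \<sigma> * r" using \<sigma>p r0 by simp
    ultimately show ?thesis using g(2) \<gamma> by linarith
  qed
  then show "e1 \<le> \<sigma> * norm s / 6" by (simp add: r_def)
  have \<sigma>\<epsilon>: "sqrt (M * \<epsilon>) \<le> \<sigma>" using \<gamma> M by (simp add: \<sigma>)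
  have a1: "e1 * r \<le> \<sigma> * r\<^sup>2 / 6"
    using mult_right_mono[OF e1 r0] by (simp add: power2_eq_square mult_ac)
  have a2: "sqrt (M * \<epsilon>) / 36 / 2 * r\<^sup>2 \<le> \<sigma> * r\<^sup>2 / 72"
    using mult_right_mono[OF \<sigma>\<epsilon>, of "r\<^sup>2"] by simp
  have a3: "M / 6 * r ^ 3 \<le> \<sigma> * r\<^sup>2 / 3"
    using mult_right_mono[OF Mr, of "r\<^sup>2"] by (simp add: power2_eq_square power3_eq_cube mult_ac)
  show "P (x + s) \<le> P x - 17 / 72 * \<sigma> * (norm s)\<^sup>2"
    using primal_step_le[OF g(1) H, of s] gs psd_s a1 a2 a3 unfolding r_def[symmetric] by simp
  define d1 d2 d3 where "d1 = grad P (x + s) - grad P x - S (x, ys x) *v s"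
    and "d2 = g - grad P x" and "d3 = H *v s - S (x, ys x) *v s"
  have "grad P (x + s) = d1 - d2 - d3 - \<sigma> *\<^sub>R s"
  proof -
    have "g = - (H *v s + \<sigma> *\<^sub>R s)" unfolding s by simp
    then show ?thesis by (simp add: d1_def d2_def d3_def)
  qed
  then have "norm (grad P (x + s)) \<le> norm d1 + norm d2 + norm d3 + norm (\<sigma> *\<^sub>R s)"
    using norm_triangle_ineq4[of "d1 - d2 - d3" "\<sigma> *\<^sub>R s"] norm_triangle_ineq4[of "d1 - d2" d3]
      norm_triangle_ineq4[of d1 d2] by simp
  moreover have "norm d1 \<le> \<sigma> * r"
    using grad_primal_remainder[of x s] mult_right_mono[OF Mr r0]
    by (simp add: d1_def r_def power2_eq_square mult_ac)
  moreover have "norm d2 \<le> \<sigma> * r / 6" using g(1) e1 by (simp add: d2_def)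
  moreover have "norm d3 \<le> \<sigma> * r / 36"
    using H[of s] mult_right_mono[OF \<sigma>\<epsilon> r0] by (simp add: d3_def r_def)
  moreover have "norm (\<sigma> *\<^sub>R s) = \<sigma> * r" using \<sigma>p by (simp add: r_def)
  ultimately show "norm (grad P (x + s)) \<le> 79 / 36 * (\<sigma> * norm s)" unfolding r_def[symmetric] by linarith
qed

lemma grad_primal_lipschitz: "norm (grad P x - grad P x') \<le> L1 l \<mu> * norm (x - x')"
  by (rule differentiable_bound[where S = UNIV and f' = "\<lambda>x. (*v) (S (x, ys x))"])
    (auto intro: der_grad_primal S_bound onorm_le)

text \<open>A gradient descent step with step size \<open>1 / L1\<close> lowers \<open>P\<close> by
  at least \<open>(norm (grad P x))\<^sup>2 / (2 * L1)\<close>, and the value reached is still at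
  least \<open>Pstar\<close>.\<close>

lemma grad_primal_le_gap:
  assumes "\<And>x. Pstar \<le> P x"
  shows "(norm (grad P x))\<^sup>2 \<le> 2 * L1 l \<mu> * (P x - Pstar)"
proof -
  let ?g = "grad P x" and ?L = "L1 l \<mu>"
  have L: "?L > 0" by (rule constants_pos)
  have "- P (x + (- 1 / ?L) *\<^sub>R ?g) \<ge> - P x + ((- 1 / ?L) *\<^sub>R ?g) \<bullet> (- ?g) - ?L / 2 * (norm ((- 1 / ?L) *\<^sub>R ?g))\<^sup>2"
  proof (rule lipschitz_grad_lower[where h = "\<lambda>x. - P x" and g = "\<lambda>x. - grad P x"])
    show "((\<lambda>x. - P x) has_derivative (\<lambda>k. k \<bullet> - grad P z)) (at z)" for z
      using has_derivative_minus[OF der_primal[of z]] by (simp add: grad_primal)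
    show "norm (- grad P z - - grad P z') \<le> ?L * norm (z - z')" for z z'
      using grad_primal_lipschitz[of z' z] by (simp add: norm_minus_commute)
  qed
  then have "(norm ?g)\<^sup>2 / ?L - ?L / 2 * ((1 / ?L) * norm ?g)\<^sup>2 \<le> P x - P (x + (- 1 / ?L) *\<^sub>R ?g)"
    using L by (simp add: dot_square_norm power_mult_distrib)
  also have "\<dots> \<le> P x - Pstar" using assms by simp
  also have "(norm ?g)\<^sup>2 / ?L - ?L / 2 * ((1 / ?L) * norm ?g)\<^sup>2 = (norm ?g)\<^sup>2 / (2 * ?L)"
    using L by (simp add: field_simps power2_eq_square)
  finally show ?thesis using L by (simp add: field_simps)
qed

end

section \<open>Runs of the algorithm\<close>

context nonconvex_strongly_concave
begin

lemma approx_second_order_point_iff: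
  "approx_second_order_point f a b x \<longleftrightarrow>
    norm (grad P x) \<le> a \<and> (\<forall>v. - b * (norm v)\<^sup>2 \<le> v \<bullet> (S (x, ys x) *v v))"
proof -
  have "(S (x, ys x) - mat (- b)) *v v = S (x, ys x) *v v + b *\<^sub>R v" for v
    by (simp add: matrix_vector_mult_diff_rdistrib mat_vector_mult)
  moreover have "transpose (S (x, ys x) - mat (- b)) = S (x, ys x) - mat (- b)"
    by (rule transpose_eqI)
      (simp add: matrix_vector_mult_diff_rdistrib mat_vector_mult inner_add_right
        inner_matrix_symmetric[OF S_symmetric] inner_commute)
  moreover have "0 \<le> v \<bullet> (S (x, ys x) *v v + b *\<^sub>R v) \<longleftrightarrow> - b * (norm v)\<^sup>2 \<le> v \<bullet> (S (x, ys x) *v v)" for v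
    by (simp add: inner_add_right dot_square_norm) linarith
  ultimately show ?thesis
    by (simp only: approx_second_order_point_def loewner_le_def hess_primal simp_thms)
qed

end

text \<open>Restricted to \<open>\<epsilon> \<le> 1\<close>: for larger accuracies \<open>x0\<close>
  itself qualifies by the choice of \<open>\<xi>\<close> and \<open>\<theta>\<close>.\<close>

locale lmnegcur_run = nonconvex_strongly_concave f l \<mu> \<rho>
  for f :: "(real^'n) \<times> (real^'m) \<Rightarrow> real" and l \<mu> \<rho> +
  fixes Pstar \<epsilon> :: real and x0 :: "real^'n" and ym1 :: "real^'m" and N :: "nat \<Rightarrow> nat" and \<tau> :: enat
    and x :: "nat \<Rightarrow> real^'n" and y :: "nat \<Rightarrow> real^'m" and u s :: "nat \<Rightarrow> real^'n"
  assumes Pstar_le: "\<And>x. Pstar \<le> primal f x"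
    and eps_pos: "0 < \<epsilon>" and eps_le_1: "\<epsilon> \<le> 1"
    and run: "LMNegCur f (L2 l \<mu> \<rho>) (1 / l) ((sqrt (kappa l \<mu>) - 1) / (sqrt (kappa l \<mu>) + 1))
             N \<epsilon> x0 ym1 \<tau> x y u s"
    and inner_iterations: "\<And>t. enat t \<le> \<tau> \<Longrightarrow>
      inner_lower l \<mu> \<rho> \<epsilon> (norm (ym1 - ystar f x0)) s t \<le> real (N t)"
begin

abbreviation "g t \<equiv> grad_x f (x t) (y t)"
abbreviation "H t \<equiv> S (x t, y t)"
abbreviation "A \<equiv> Acc l \<mu> \<rho> \<epsilon>"

lemma run_start: "x 0 = x0"
  using run by (simp add: LMNegCur_def)

lemma run_iteration:
  assumes "enat t \<le> \<tau>"
  shows "y t = fst (nag (grad_y f (x t)) (1 / l) ((sqrt \<kappa> - 1) / (sqrt \<kappa> + 1)) (if t = 0 then ym1 else y (t - 1)) (N t))"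
    and "lambda_min (H t) = u t \<bullet> (H t *v u t)" and "norm (u t) = 1" and "g t \<bullet> u t \<le> 0"
    and "enat t = \<tau> \<longleftrightarrow> \<not> neg_curvature M \<epsilon> (g t) (H t) \<and> norm (g t) < \<epsilon>"
  using run assms unfolding LMNegCur_def Let_def S_def by auto

lemma run_step:
  assumes "enat t < \<tau>"
  shows "neg_curvature M \<epsilon> (g t) (H t) \<Longrightarrow> s t = sqrt (max (norm (g t)) \<epsilon> / M) *\<^sub>R u t"
    and "\<not> neg_curvature M \<epsilon> (g t) (H t) \<Longrightarrow> (H t + mat (sqrt (M * norm (g t)))) *v s t = - g t"
    and "x (Suc t) = x t + s t"
  using run assms less_imp_le[OF assms] unfolding LMNegCur_def Let_def S_def by auto

section \<open>Accuracy of the inner loop and of the gradient and Hessian computed from it\<close>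

lemma eps_powr: "\<epsilon> powr (3 / 2) = \<epsilon> * sqrt \<epsilon>" "\<epsilon> powr (1 / 2) = sqrt \<epsilon>"
proof -
  show "\<epsilon> powr (1 / 2) = sqrt \<epsilon>" using eps_pos by (simp add: powr_half_sqrt)
  moreover have "\<epsilon> powr (3 / 2) = \<epsilon> powr (1 + 1 / 2)" by simp
  ultimately show "\<epsilon> powr (3 / 2) = \<epsilon> * sqrt \<epsilon>" using eps_pos unfolding powr_add by simp
qed

lemma eps1_bounds:
  "eps1 l \<mu> \<rho> \<epsilon> \<le> \<epsilon> * sqrt \<epsilon> / 36"
  "eps1 l \<mu> \<rho> \<epsilon> \<le> sqrt M / (12 * L1 l \<mu>) * (\<epsilon> * sqrt \<epsilon>)"
proof -
  have "0 \<le> \<epsilon> * sqrt \<epsilon>" using eps_pos by simp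
  then have "min (1 / 36) b * (\<epsilon> * sqrt \<epsilon>) \<le> 1 / 36 * (\<epsilon> * sqrt \<epsilon>)"
    "min (1 / 36) b * (\<epsilon> * sqrt \<epsilon>) \<le> b * (\<epsilon> * sqrt \<epsilon>)" for b
    by (intro mult_right_mono; simp)+
  from this(1)[of "sqrt M / (12 * L1 l \<mu>)"] this(2)[of "sqrt M / (12 * L1 l \<mu>)"]
  show "eps1 l \<mu> \<rho> \<epsilon> \<le> \<epsilon> * sqrt \<epsilon> / 36"
    "eps1 l \<mu> \<rho> \<epsilon> \<le> sqrt M / (12 * L1 l \<mu>) * (\<epsilon> * sqrt \<epsilon>)"
    unfolding eps1_def eps_powr by simp_all
qed

lemma eps1_le: "eps1 l \<mu> \<rho> \<epsilon> \<le> \<epsilon> / 36"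
proof -
  have "\<epsilon> * sqrt \<epsilon> \<le> \<epsilon> * 1" using eps_pos eps_le_1 by (intro mult_left_mono) auto
  then show ?thesis using eps1_bounds(1) by simp
qed

lemma A_pos: "0 < A"
  using constants_pos l_pos eps_pos by (simp add: Acc_def eps1_def eps2_def)

text \<open>Warm start: \<open>y t\<close> is within \<open>A\<close> of its target, and the target
  then moves by at most \<open>\<kappa> * norm (s t)\<close>. The sum is the starting distance that
  the second case of \<open>inner_lower\<close> allows for.\<close>

lemma inner_accuracy: "enat t \<le> \<tau> \<Longrightarrow> norm (y t - ys (x t)) \<le> A"
proof (induction t)
  case 0
  then show ?case
    unfolding run_iteration(1)[OF 0]
    using inner_iterations[OF 0]
    by (intro nag_accuracy[OF A_pos, of _ _ "norm (ym1 - ys x0)"]) (auto simp: run_start inner_lower_def Let_def)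
next
  case (Suc t)
  then have t: "enat t < \<tau>" using Suc_ile_eq by blast
  then have IH: "norm (y t - ys (x t)) \<le> A" using Suc.IH by simp
  have "norm (y t - ys (x (Suc t))) \<le> norm (y t - ys (x t)) + norm (ys (x t) - ys (x (Suc t)))"
    using norm_triangle_ineq[of "y t - ys (x t)" "ys (x t) - ys (x (Suc t))"] by simp
  also have "\<dots> \<le> A + \<kappa> * norm (s t)"
    using IH ystar_lipschitz[of "x t" "x (Suc t)"] run_step(3)[OF t] by simp
  finally show ?case
    unfolding run_iteration(1)[OF Suc.prems]
    using inner_iterations[OF Suc.prems]
    by (intro nag_accuracy[OF A_pos, of _ _ "A + \<kappa> * norm (s t)"]) (auto simp: inner_lower_def Let_def)
qed

lemma gradient_accuracy:
  assumes "enat t \<le> \<tau>"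
  shows "norm (g t - grad P (x t)) \<le> eps1 l \<mu> \<rho> \<epsilon>"
proof -
  have "norm (g t - grad P (x t)) \<le> l * norm (y t - ys (x t))"
    using grad_x_lipschitz[of "x t" "y t" "x t" "ys (x t)"] by (simp add: grad_primal norm_Pair)
  also have "\<dots> \<le> l * A" using inner_accuracy[OF assms] l_pos by simp
  also have "\<dots> \<le> eps1 l \<mu> \<rho> \<epsilon>"
    using l_pos by (simp add: Acc_def min_def field_simps)
  finally show ?thesis .
qed

lemma hessian_accuracy:
  assumes "enat t \<le> \<tau>"
  shows "norm (H t *v v - S (x t, ys (x t)) *v v) \<le> sqrt (M * \<epsilon>) / 36 * norm v"
proof -
  have "norm (H t *v v - S (x t, ys (x t)) *v v) \<le> LH l \<mu> \<rho> * norm (y t - ys (x t)) * norm v"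
    using S_lipschitz[of "(x t, y t)" v "(x t, ys (x t))"] by (simp add: norm_Pair)
  also have "\<dots> \<le> LH l \<mu> \<rho> * A * norm v"
    using inner_accuracy[OF assms] constants_pos by (intro mult_right_mono mult_left_mono) auto
  also have "LH l \<mu> \<rho> * A \<le> eps2 l \<mu> \<rho> \<epsilon> / 2"
  proof -
    have "A \<le> eps2 l \<mu> \<rho> \<epsilon> / (2 * LH l \<mu> \<rho>)" by (simp add: Acc_def)
    then show ?thesis using constants_pos(3) by (simp add: field_simps)
  qed
  also have "eps2 l \<mu> \<rho> \<epsilon> / 2 = sqrt (M * \<epsilon>) / 36"
    by (simp add: eps2_def eps_powr real_sqrt_mult)
  finally show ?thesis by (simp add: mult_right_mono)
qed

text \<open>The threshold is four times the stopping tolerance, so that any iteration left over has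
  negative curvature or \<open>4 * \<epsilon> \<le> norm (g t)\<close>; the Newton estimate relies
  on this factor. Below the threshold, \<open>lambda_min (H t)\<close> is still at least
  \<open>- sqrt (M * \<epsilon>)\<close>.\<close>

lemma approx_point_if_flat:
  assumes t: "enat t \<le> \<tau>" and nc: "\<not> neg_curvature M \<epsilon> (g t) (H t)" and g: "norm (g t) < 4 * \<epsilon>"
    and \<xi>: "5 \<le> \<xi>" and \<theta>: "2 * sqrt M \<le> \<theta>"
  shows "approx_second_order_point f (\<xi> * \<epsilon>) (\<theta> * sqrt \<epsilon>) (x t)"
  unfolding approx_second_order_point_iff
proof (intro conjI allI)
  have "norm (grad P (x t)) \<le> norm (g t) + norm (g t - grad P (x t))"
    using norm_triangle_ineq4[of "g t" "g t - grad P (x t)"] by simp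
  also have "\<dots> \<le> 5 * \<epsilon>" using g gradient_accuracy[OF t] eps1_le eps_pos by simp
  also have "\<dots> \<le> \<xi> * \<epsilon>" using \<xi> eps_pos by simp
  finally show "norm (grad P (x t)) \<le> \<xi> * \<epsilon>" .
  fix v :: "real^'n"
  note M = constants_pos(1)
  have "sqrt (M * max (norm (g t)) \<epsilon>) \<le> sqrt (M * (2\<^sup>2 * \<epsilon>))"
    using g eps_pos M by (intro real_sqrt_le_mono mult_left_mono) auto
  also have "\<dots> = 2 * sqrt (M * \<epsilon>)" by (simp add: real_sqrt_mult)
  finally have "- sqrt (M * \<epsilon>) \<le> lambda_min (H t)" using nc by (simp add: neg_curvature_def)
  then have "- sqrt (M * \<epsilon>) * (norm v)\<^sup>2 \<le> lambda_min (H t) * (norm v)\<^sup>2"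
    by (rule mult_right_mono) simp
  also have "\<dots> \<le> v \<bullet> (H t *v v)" by (rule lambda_min_le_Rayleigh[OF S_symmetric])
  also have "\<dots> \<le> v \<bullet> (S (x t, ys (x t)) *v v) + sqrt (M * \<epsilon>) / 36 * (norm v)\<^sup>2"
  proof -
    have "v \<bullet> (H t *v v - S (x t, ys (x t)) *v v) \<le> norm v * (sqrt (M * \<epsilon>) / 36 * norm v)"
      using norm_cauchy_schwarz[of v "H t *v v - S (x t, ys (x t)) *v v"]
        mult_left_mono[OF hessian_accuracy[OF t, of v] norm_ge_zero[of v]] by linarith
    then show ?thesis by (simp add: inner_diff_right power2_eq_square mult_ac)
  qed
  finally have "- (37 / 36) * (sqrt (M * \<epsilon>) * (norm v)\<^sup>2) \<le> v \<bullet> (S (x t, ys (x t)) *v v)" by simp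
  moreover have "37 / 36 * (sqrt (M * \<epsilon>) * (norm v)\<^sup>2) \<le> \<theta> * sqrt \<epsilon> * (norm v)\<^sup>2"
  proof -
    have "37 / 36 * sqrt M \<le> \<theta>" using \<theta> real_sqrt_ge_zero[OF less_imp_le[OF M]] by linarith
    then have "37 / 36 * sqrt M * (sqrt \<epsilon> * (norm v)\<^sup>2) \<le> \<theta> * (sqrt \<epsilon> * (norm v)\<^sup>2)"
      using eps_pos by (intro mult_right_mono) auto
    then show ?thesis by (simp add: real_sqrt_mult mult_ac)
  qed
  ultimately show "- (\<theta> * sqrt \<epsilon>) * (norm v)\<^sup>2 \<le> v \<bullet> (S (x t, ys (x t)) *v v)" by simp
qed

lemma iteration_progress:
  assumes t: "enat t < \<tau>" and far: "neg_curvature M \<epsilon> (g t) (H t) \<or> 4 * \<epsilon> \<le> norm (g t)"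
  shows "P (x (Suc t)) < P (x t)" (is ?strict)
    and "P (x (Suc t)) \<le> P (x t) - \<epsilon> * sqrt \<epsilon> / (24 * sqrt M) \<or>
      \<epsilon> \<le> norm (g t) \<and> norm (g (Suc t)) \<le> norm (g t) / 2" (is ?progress)
    and "norm (s t) \<le> 2 * (sqrt (max (norm (g t)) \<epsilon>) / sqrt M)" (is ?short)
proof -
  note M = constants_pos(1)
  have t': "enat t \<le> \<tau>" "enat (Suc t) \<le> \<tau>" using t by (auto simp: Suc_ile_eq)
  have e: "0 < \<epsilon> * sqrt \<epsilon>" using eps_pos by simp
  have sM: "0 < sqrt M" using M by simp
  have "?strict \<and> ?progress \<and> ?short"
  proof (cases "neg_curvature M \<epsilon> (g t) (H t)")
    case True
    let ?G = "max (norm (g t)) \<epsilon>"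
    have "P (x t + s t) \<le> P (x t) - ?G * sqrt ?G / (24 * sqrt M)"
    proof (rule neg_curvature_decrease[OF eps_pos eps_le_1 _ hessian_accuracy[OF t'(1)] refl])
      show "norm (g t - grad P (x t)) \<le> \<epsilon> * sqrt \<epsilon> / 36"
        using gradient_accuracy[OF t'(1)] eps1_bounds(1) by linarith
      show "u t \<bullet> (H t *v u t) \<le> - (1 / 2) * sqrt (M * ?G)"
        using True run_iteration(2)[OF t'(1)] by (simp add: neg_curvature_def)
    qed (use run_iteration(3,4)[OF t'(1)] run_step(1)[OF t True] in auto)
    moreover have "\<epsilon> * sqrt \<epsilon> / (24 * sqrt M) \<le> ?G * sqrt ?G / (24 * sqrt M)"
      using eps_pos sM by (intro divide_right_mono mult_mono) auto
    moreover have "0 < \<epsilon> * sqrt \<epsilon> / (24 * sqrt M)" using e sM by simp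
    moreover have "norm (s t) = sqrt ?G / sqrt M"
      using run_step(1)[OF t True] run_iteration(3)[OF t'(1)] M eps_pos
      by (simp add: real_sqrt_divide)
    moreover have "0 \<le> sqrt ?G / sqrt M" using eps_pos M by simp
    ultimately show ?thesis unfolding run_step(3)[OF t] by (intro conjI disjI1; linarith)
  next
    case False
    let ?\<gamma> = "norm (g t)"
    have \<gamma>4: "4 * \<epsilon> \<le> ?\<gamma>" using far False by simp
    then have \<gamma>: "\<epsilon> \<le> ?\<gamma>" using eps_pos by linarith
    define \<sigma> where "\<sigma> = sqrt (M * ?\<gamma>)"
    have \<gamma>p: "0 < ?\<gamma>" using \<gamma> eps_pos by linarith
    have \<sigma>p: "0 < \<sigma>" using \<gamma>p M by (simp add: \<sigma>_def)
    have max: "max ?\<gamma> \<epsilon> = ?\<gamma>" using \<gamma> by simp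
    have psd: "- (1 / 2) * \<sigma> * (norm v)\<^sup>2 \<le> v \<bullet> (H t *v v)" for v
    proof -
      have "- (1 / 2) * \<sigma> \<le> lambda_min (H t)"
        using False by (simp add: neg_curvature_def max \<sigma>_def)
      then have "- (1 / 2) * \<sigma> * (norm v)\<^sup>2 \<le> lambda_min (H t) * (norm v)\<^sup>2"
        by (rule mult_right_mono) simp
      then show ?thesis using lambda_min_le_Rayleigh[OF S_symmetric, of "(x t, y t)" v] by linarith
    qed
    have eq: "H t *v s t + \<sigma> *\<^sub>R s t = - g t"
      using run_step(2)[OF t False] by (simp add: matrix_vector_mult_add_rdistrib mat_vector_mult \<sigma>_def)
    note newton = newton_step[OF eps_pos eps_le_1 gradient_accuracy[OF t'(1)] eps1_bounds
        hessian_accuracy[OF t'(1)] S_bound \<gamma> \<sigma>_def psd eq, folded run_step(3)[OF t]]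
    let ?r = "norm (s t)"
    have "s t \<noteq> 0" using eq \<gamma>p by auto
    then have r: "0 < ?r" by simp
    have short: "?r \<le> 2 * (sqrt ?\<gamma> / sqrt M)"
    proof -
      have "sqrt M * (sqrt M * ?r) \<le> sqrt M * (2 * sqrt ?\<gamma>)"
        using newton(1) M by (simp add: \<sigma>_def real_sqrt_mult flip: mult.assoc)
      then have "sqrt M * ?r \<le> 2 * sqrt ?\<gamma>" using sM by simp
      then show ?thesis using sM by (simp add: field_simps)
    qed
    have "0 < 17 / 72 * \<sigma> * ?r\<^sup>2" using \<sigma>p r by simp
    then have strict: ?strict using newton(3) by linarith
    have ?progress
    proof (cases "norm (g (Suc t)) \<le> ?\<gamma> / 2")
      case True
      then show ?thesis using \<gamma> by simp
    next
      case False
      \<comment> \<open>The new inexact gradient is at most 79/36 + 1/6 = 85/36 times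
        \<open>\<sigma> * ?r\<close>, so a failure to halve forces \<open>\<sigma> * ?r\<close>
        above 18/85 of the old norm.\<close>
      have "norm (g (Suc t)) \<le> norm (grad P (x (Suc t))) + norm (g (Suc t) - grad P (x (Suc t)))"
        using norm_triangle_ineq[of "grad P (x (Suc t))" "g (Suc t) - grad P (x (Suc t))"] by simp
      also have "\<dots> \<le> 79 / 36 * (\<sigma> * ?r) + \<sigma> * ?r / 6"
        using newton(2,4) gradient_accuracy[OF t'(2)] by linarith
      finally have "18 / 85 * ?\<gamma> \<le> \<sigma> * ?r" using False by simp
      then have "(18 / 85 * ?\<gamma>)\<^sup>2 \<le> (\<sigma> * ?r)\<^sup>2" using \<gamma>p by (intro power_mono) auto
      then have "(18 / 85)\<^sup>2 * ?\<gamma>\<^sup>2 \<le> \<sigma> * (\<sigma> * ?r\<^sup>2)" by (simp add: power2_eq_square mult_ac)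
      moreover have "?\<gamma>\<^sup>2 = \<sigma> * (?\<gamma> * sqrt ?\<gamma> / sqrt M)"
      proof -
        have "\<sigma> * (?\<gamma> * sqrt ?\<gamma> / sqrt M) = ?\<gamma> * (sqrt ?\<gamma> * sqrt ?\<gamma>) * (sqrt M / sqrt M)"
          by (simp only: \<sigma>_def real_sqrt_mult times_divide_eq_right mult_ac)
        also have "\<dots> = ?\<gamma> * ?\<gamma>" using sM by simp
        finally show ?thesis by (simp add: power2_eq_square)
      qed
      ultimately have "\<sigma> * ((18 / 85)\<^sup>2 * (?\<gamma> * sqrt ?\<gamma> / sqrt M)) \<le> \<sigma> * (\<sigma> * ?r\<^sup>2)"
        by (simp add: mult_ac)
      then have dec: "(18 / 85)\<^sup>2 * (?\<gamma> * sqrt ?\<gamma> / sqrt M) \<le> \<sigma> * ?r\<^sup>2"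
        using \<sigma>p by (simp only: mult_le_cancel_left_pos)
      \<comment> \<open>The threshold \<open>4 * \<epsilon>\<close> pays off here: its power 3/2
        yields the factor 8, which lifts 17/72 times the square of 18/85 above 1/24.\<close>
      have "8 * (\<epsilon> * sqrt \<epsilon>) = (4 * \<epsilon>) * sqrt (4 * \<epsilon>)" by (simp add: real_sqrt_mult)
      also have "\<dots> \<le> ?\<gamma> * sqrt ?\<gamma>" using \<gamma>4 eps_pos by (intro mult_mono) auto
      finally have "8 * (\<epsilon> * sqrt \<epsilon> / sqrt M) \<le> ?\<gamma> * sqrt ?\<gamma> / sqrt M"
        using sM by (simp add: divide_right_mono)
      moreover define w where "w = \<epsilon> * sqrt \<epsilon> / sqrt M"
      ultimately have "8 * w \<le> ?\<gamma> * sqrt ?\<gamma> / sqrt M" by simp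
      moreover have "0 < w" using e sM by (simp add: w_def)
      ultimately have "w / 24 \<le> 17 / 72 * (\<sigma> * ?r\<^sup>2)" using dec by (simp add: power2_eq_square)
      then show ?thesis using newton(3) by (simp add: w_def)
    qed
    with strict short show ?thesis by (simp add: max)
  qed
  then show ?strict ?progress ?short by auto
qed

text \<open>Origin of the middle entry of \<open>Gbar\<close>: since
  \<open>C powr (3/2) = 36 * sqrt M * D\<close>, the gap bound on the squared gradient reads
  \<open>a * C / 18\<close>. Hence \<open>a + C\<close> bounds the gradient, and the summand 1
  covers its error as well as \<open>\<epsilon>\<close>.\<close>

lemma gradient_le_Gbar:
  assumes t: "enat t \<le> \<tau>" and le: "P (x t) \<le> P x0"
  shows "max (norm (g t)) \<epsilon> \<le> Gbar l \<mu> \<rho> (P x0 - Pstar)"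
proof -
  note M = constants_pos(1)
  define D where "D = P x0 - Pstar"
  have D: "0 \<le> D" using Pstar_le by (simp add: D_def)
  define C where "C = Cbar l \<mu> \<rho> D"
  define a where "a = L1 l \<mu> / sqrt M * C powr (1 / 2)"
  have sM: "0 < sqrt M" using M by simp
  have C: "0 \<le> C" by (simp add: C_def Cbar_def)
  have a: "0 \<le> a" using constants_pos sM by (simp add: a_def)
  have pos: "0 \<le> 36 * sqrt M * D" using D sM by simp
  have "C * C powr (1 / 2) = 36 * sqrt M * D"
  proof (cases "D = 0")
    case False
    then have "0 < 36 * sqrt M * D" using D sM by simp
    then show ?thesis by (simp add: C_def Cbar_def powr_powr flip: powr_add)
  qed (simp add: C_def Cbar_def)
  then have "2 * L1 l \<mu> * D = a * C / 18"
    using sM by (simp add: a_def field_simps)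
  moreover have "(norm (grad P (x t)))\<^sup>2 \<le> 2 * L1 l \<mu> * D"
  proof -
    have "2 * L1 l \<mu> * (P (x t) - Pstar) \<le> 2 * L1 l \<mu> * D"
      using le constants_pos by (intro mult_left_mono) (auto simp: D_def)
    then show ?thesis using grad_primal_le_gap[OF Pstar_le, of "x t"] by linarith
  qed
  ultimately have "(norm (grad P (x t)))\<^sup>2 \<le> a * C / 18" by simp
  also have "\<dots> \<le> (a + C)\<^sup>2"
  proof -
    have "0 \<le> a * C" using a C by simp
    moreover have "(a + C)\<^sup>2 = a\<^sup>2 + 2 * (a * C) + C\<^sup>2" by (simp add: power2_sum)
    moreover have "0 \<le> a\<^sup>2" "0 \<le> C\<^sup>2" by auto
    ultimately show ?thesis by linarith
  qed
  finally have "norm (grad P (x t)) \<le> a + C" by (rule power2_le_imp_le) (use a C in simp)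
  moreover have "norm (g t) \<le> norm (grad P (x t)) + norm (g t - grad P (x t))"
    using norm_triangle_ineq[of "grad P (x t)" "g t - grad P (x t)"] by simp
  ultimately have "norm (g t) \<le> 1 + a + C"
    using gradient_accuracy[OF t] eps1_le eps_le_1 by linarith
  then have "max (norm (g t)) \<epsilon> \<le> 1 + a + C" using eps_le_1 a C by simp
  also have "\<dots> \<le> Gbar l \<mu> \<rho> D" unfolding Gbar_def a_def C_def by (intro Max_ge) auto
  finally show ?thesis by (simp add: D_def)
qed

end

section \<open>The iteration bound\<close>

lemma count_geometric_phases:
  fixes p \<gamma> :: "nat \<Rightarrow> real"
  assumes c: "0 < c" and \<epsilon>: "0 < \<epsilon>" and B: "\<epsilon> \<le> 2 * B"
    and step: "\<And>t. t < n \<Longrightarrow> p (Suc t) \<le> p t - c \<or> (\<epsilon> \<le> \<gamma> t \<and> \<gamma> (Suc t) \<le> \<gamma> t / 2 \<and> p (Suc t) \<le> p t)"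
    and \<gamma>: "\<And>t. t \<le> n \<Longrightarrow> \<gamma> t \<le> B"
    and p: "\<And>t. t \<le> n \<Longrightarrow> pmin \<le> p t"
  defines "Lg \<equiv> log 2 (2 * B / \<epsilon>)"
  shows "real n \<le> (p 0 - pmin) / c * (Lg + 1) + Lg"
proof -
  \<comment> \<open>A large decrease of \<open>p\<close> pays for resetting the halving counter \<open>\<psi>\<close> from 0 to \<open>Lg\<close>.\<close>
  define \<psi> where "\<psi> t = (if \<gamma> t \<le> \<epsilon> / 2 then 0 else log 2 (2 * \<gamma> t / \<epsilon>))" for t
  have Lg0: "0 \<le> Lg" using B \<epsilon> by (simp add: Lg_def)
  have \<psi>0: "0 \<le> \<psi> t" for t using \<epsilon> by (simp add: \<psi>_def)
  have \<psi>L: "\<psi> t \<le> Lg" if "t \<le> n" for t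
  proof (cases "\<gamma> t \<le> \<epsilon> / 2")
    case False
    have "\<gamma> t \<le> B" by (rule \<gamma>[OF that])
    with False have "2 * \<gamma> t / \<epsilon> \<le> 2 * B / \<epsilon>" "0 < 2 * \<gamma> t / \<epsilon>" using \<epsilon> by (auto simp: divide_right_mono)
    with False show ?thesis by (simp add: \<psi>_def Lg_def)
  qed (simp add: \<psi>_def Lg0)
  \<comment> \<open>This potential falls by at least 1 per step. A large decrease takes
    \<open>Lg + 1\<close> off the first summand while \<open>\<psi>\<close> gains at most
    \<open>Lg\<close>; a halving takes 1 off \<open>\<psi>\<close> and does not raise the first
    summand.\<close>
  define \<Phi> where "\<Phi> t = (p t - pmin) / c * (Lg + 1) + \<psi> t" for t
  have dec: "\<Phi> (Suc t) \<le> \<Phi> t - 1" if t: "t < n" for t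
    using step[OF t]
  proof
    assume "p (Suc t) \<le> p t - c"
    then have "(p (Suc t) - pmin) / c \<le> (p t - pmin - c) / c" using c by (intro divide_right_mono) auto
    also have "\<dots> = (p t - pmin) / c - 1" using c by (simp add: diff_divide_distrib)
    finally have "(p (Suc t) - pmin) / c * (Lg + 1) \<le> ((p t - pmin) / c - 1) * (Lg + 1)"
      using Lg0 by (intro mult_right_mono) auto
    then show ?thesis using \<psi>L[of "Suc t"] \<psi>0[of t] t by (simp add: \<Phi>_def algebra_simps)
  next
    assume a: "\<epsilon> \<le> \<gamma> t \<and> \<gamma> (Suc t) \<le> \<gamma> t / 2 \<and> p (Suc t) \<le> p t"
    then have "(p (Suc t) - pmin) / c * (Lg + 1) \<le> (p t - pmin) / c * (Lg + 1)"
      using Lg0 c by (intro mult_right_mono divide_right_mono) auto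
    moreover have "\<psi> (Suc t) \<le> \<psi> t - 1"
    proof -
      have \<psi>t: "\<psi> t = log 2 (2 * \<gamma> t / \<epsilon>)" using a \<epsilon> by (simp add: \<psi>_def)
      have "log 2 (2 * \<gamma> t / \<epsilon>) = log 2 (2 * (\<gamma> t / \<epsilon>))" by simp
      also have "\<dots> = 1 + log 2 (\<gamma> t / \<epsilon>)" using a \<epsilon> by (subst log_mult) auto
      finally have eq: "\<psi> t - 1 = log 2 (\<gamma> t / \<epsilon>)" using \<psi>t by simp
      show ?thesis
      proof (cases "\<gamma> (Suc t) \<le> \<epsilon> / 2")
        \<comment> \<open>Truncating \<open>\<psi>\<close> at 0 is harmless:
          \<open>\<epsilon> \<le> \<gamma> t\<close> makes the logarithm on the right
          nonnegative.\<close>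
        case True
        then show ?thesis unfolding eq using a \<epsilon> by (simp add: \<psi>_def)
      next
        case False
        then have "2 * \<gamma> (Suc t) / \<epsilon> \<le> \<gamma> t / \<epsilon>" "0 < 2 * \<gamma> (Suc t) / \<epsilon>"
          using a \<epsilon> by (auto simp: divide_right_mono)
        then show ?thesis unfolding eq using False by (simp add: \<psi>_def)
      qed
    qed
    ultimately show ?thesis by (simp add: \<Phi>_def)
  qed
  have "real t \<le> \<Phi> 0 - \<Phi> t" if "t \<le> n" for t
    using that
  proof (induction t)
    case (Suc t)
    then show ?case using dec[of t] by simp
  qed simp
  then have "real n \<le> \<Phi> 0 - \<Phi> n" by simp
  moreover have "0 \<le> \<Phi> n" using \<psi>0[of n] p[of n] c Lg0 by (simp add: \<Phi>_def)
  ultimately show ?thesis using \<psi>L[of 0] by (simp add: \<Phi>_def)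
qed

section \<open>Sign and growth of the explicit iteration bound\<close>

lemma powr_le_one_plus:
  fixes a x :: real
  assumes "0 \<le> x" "0 \<le> a" "a \<le> 1"
  shows "x powr a \<le> 1 + x"
proof (cases "x \<le> 1")
  case True
  then have "x powr a \<le> 1" using assms by (simp add: powr_le1)
  then show ?thesis using assms by simp
next
  case False
  then have "x powr a \<le> x powr 1" using assms by (intro powr_mono) auto
  then show ?thesis using False by simp
qed

lemma Gbar_ge:
  shows "41 / 9 * Cbar l \<mu> \<rho> D \<le> Gbar l \<mu> \<rho> D" and "2 + L1 l \<mu> / sqrt (L2 l \<mu> \<rho>) \<le> Gbar l \<mu> \<rho> D"
  unfolding Gbar_def by (intro Max_ge; simp)+

lemma L1_div_sqrt_L2_nonneg:
  assumes "0 < \<mu>" "\<mu> \<le> l" "0 < \<rho>"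
  shows "0 \<le> L1 l \<mu> / sqrt (L2 l \<mu> \<rho>)"
  using assms by (simp add: L1_def L2_def kappa_def)

lemma Gbar_ge_2:
  assumes "0 < \<mu>" "\<mu> \<le> l" "0 < \<rho>"
  shows "2 \<le> Gbar l \<mu> \<rho> D"
  using Gbar_ge(2)[of l \<mu> \<rho> D] L1_div_sqrt_L2_nonneg[OF assms] by linarith

lemma outer_bound_eq:
  assumes G: "0 < Gbar l \<mu> \<rho> D" and \<epsilon>: "0 < \<epsilon>"
  shows "outer_bound D l \<mu> \<rho> \<epsilon> = Cbar1 l \<mu> \<rho> D * \<epsilon> powr (-3/2) * ln (2 * Gbar l \<mu> \<rho> D / \<epsilon>) + 1"
proof -
  have "ln (2 * Gbar l \<mu> \<rho> D / \<epsilon>) = ln 2 + ln (Gbar l \<mu> \<rho> D) + ln (inverse \<epsilon>)"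
    using G \<epsilon> by (simp add: ln_mult ln_div ln_inverse)
  then show ?thesis by (simp add: outer_bound_def Cbar2_def algebra_simps)
qed

text \<open>Needed for \<open>T = 0\<close>, since the logarithm is negative for large
  \<open>\<epsilon>\<close>. With \<open>\<epsilon> = 2 * G * a\<close> and \<open>a > 1\<close>,
  the negative term stays above -1 because \<open>ln a \<le> a powr (3/2)\<close> and
  \<open>8 * K \<le> (2 * G) powr (3/2)\<close>; the latter comes from the first entry of
  \<open>Gbar\<close>. The summand 1 of the bound compensates.\<close>

lemma outer_bound_nonneg:
  assumes "0 < \<mu>" "\<mu> \<le> l" "0 < \<rho>" and D: "0 \<le> D" and \<epsilon>: "0 < \<epsilon>"
  shows "0 \<le> outer_bound D l \<mu> \<rho> \<epsilon>"
proof -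
  define G where "G = Gbar l \<mu> \<rho> D"
  have G2: "2 \<le> G" unfolding G_def by (rule Gbar_ge_2) fact+
  define K where "K = 36 * sqrt (L2 l \<mu> \<rho>) * D"
  have "0 \<le> L2 l \<mu> \<rho>" using assms by (simp add: L2_def kappa_def)
  then have K: "0 \<le> K" using D by (simp add: K_def)
  have C1: "Cbar1 l \<mu> \<rho> D = K / ln 2" by (simp add: Cbar1_def K_def)
  have eq: "outer_bound D l \<mu> \<rho> \<epsilon> = K / ln 2 * \<epsilon> powr (-3/2) * ln (2 * G / \<epsilon>) + 1"
    unfolding G_def C1[symmetric] by (rule outer_bound_eq) (use G2 \<epsilon> in \<open>auto simp: G_def\<close>)
  show ?thesis
  proof (cases "\<epsilon> \<le> 2 * G")
    case True
    then have "0 \<le> ln (2 * G / \<epsilon>)" using \<epsilon> by (intro ln_ge_zero) (simp add: field_simps)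
    then show ?thesis unfolding eq using K by simp
  next
    case False
    define a where "a = \<epsilon> / (2 * G)"
    have a: "1 < a" using False G2 by (simp add: a_def)
    have ea: "\<epsilon> = 2 * G * a" using G2 by (simp add: a_def)
    have "ln a \<le> a powr (3/2)"
      using ln_le_minus_one[of a] powr_mono[of 1 "3/2" a] a by simp
    have "8 * K = (4 * Cbar l \<mu> \<rho> D) powr (3/2)"
    proof -
      have "(4::real) powr (3/2) = (4 powr (1/2)) ^ 3"
        by (subst powr_realpow[symmetric]) (auto simp: powr_powr)
      then have "(4::real) powr (3/2) = 8" by (simp add: powr_half_sqrt)
      moreover have "Cbar l \<mu> \<rho> D powr (3/2) = K"
        using K by (simp add: Cbar_def K_def[symmetric] powr_powr)
      ultimately show ?thesis by (simp add: powr_mult Cbar_def)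
    qed
    also have "\<dots> \<le> (2 * G) powr (3/2)"
    proof (rule powr_mono2)
      have "0 \<le> Cbar l \<mu> \<rho> D" by (simp add: Cbar_def)
      then show "0 \<le> 4 * Cbar l \<mu> \<rho> D" "4 * Cbar l \<mu> \<rho> D \<le> 2 * G"
        using Gbar_ge(1)[of l \<mu> \<rho> D] unfolding G_def[symmetric] by linarith+
    qed simp
    finally have K8: "8 * K \<le> (2 * G) powr (3/2)" .
    have ln2: "1 / 2 \<le> ln (2::real)" using ln_le_minus_one[of "1 / 2"] by (simp add: ln_div)
    have "K * ln a \<le> ln 2 * \<epsilon> powr (3/2)"
    proof -
      have "K * ln a \<le> ((2 * G) powr (3/2) / 8) * a powr (3/2)"
        using K K8 \<open>ln a \<le> a powr (3/2)\<close> a by (intro mult_mono) auto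
      also have "\<dots> = \<epsilon> powr (3/2) / 8" using G2 a by (simp add: ea powr_mult)
      also have "\<dots> \<le> ln 2 * \<epsilon> powr (3/2)" using ln2 mult_right_mono[of "1/8" "ln 2" "\<epsilon> powr (3/2)"] by simp
      finally show ?thesis .
    qed
    then have "K * ln a / (ln 2 * \<epsilon> powr (3/2)) \<le> 1"
      using \<epsilon> by (simp add: divide_le_eq_1)
    moreover have "K / ln 2 * \<epsilon> powr (-3/2) * ln (2 * G / \<epsilon>) = - (K * ln a / (ln 2 * \<epsilon> powr (3/2)))"
    proof -
      have "ln (2 * G / \<epsilon>) = - ln a" using G2 \<epsilon> by (simp add: a_def ln_div)
      moreover have "\<epsilon> powr (-3/2) = 1 / \<epsilon> powr (3/2)" using powr_minus_divide[of \<epsilon> "3/2"] by simp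
      ultimately show ?thesis by simp
    qed
    ultimately show ?thesis unfolding eq by linarith
  qed
qed

text \<open>\<open>Gbar\<close> is at most polynomial in \<open>Q = exp \<Lambda>\<close>, which
  dominates \<open>l\<close>, \<open>1 / \<mu>\<close>, \<open>\<rho>\<close> and
  \<open>1 / \<rho>\<close>. The exponent 6 arises from
  \<open>L1 l \<mu> / R \<le> Q\<^sup>2\<close> times the \<open>Q ^ 4\<close> in the bound on
  \<open>Cbar\<close>; 12 and 1000 are generous roundings.\<close>

lemma ln_Gbar_le:
  assumes D: "0 \<le> D" and \<mu>: "0 < \<mu>" "\<mu> \<le> l" and \<rho>: "0 < \<rho>"
    and \<Lambda>: "\<bar>ln l\<bar> + \<bar>ln \<mu>\<bar> + \<bar>ln \<rho>\<bar> \<le> \<Lambda>"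
  shows "ln (Gbar l \<mu> \<rho> D) \<le> ln (12 + 1000 * D) + 6 * \<Lambda>"
proof -
  define Q where "Q = exp \<Lambda>"
  have \<Lambda>0: "0 \<le> \<Lambda>" using \<Lambda> by linarith
  have Q1: "1 \<le> Q" using \<Lambda>0 by (simp add: Q_def)
  have l: "0 < l" using \<mu> by linarith
  have up: "z \<le> Q" if "0 < z" "ln z \<le> \<Lambda>" for z
    using that by (metis Q_def exp_le_cancel_iff exp_ln)
  have lQ: "l \<le> Q" "1 / \<mu> \<le> Q" "\<rho> \<le> Q" "1 / \<rho> \<le> Q"
    using \<mu> l \<rho> \<Lambda> by (auto intro!: up simp: ln_div)
  define k where "k = 1 + kappa l \<mu>"
  have k2: "2 \<le> k" using \<mu> by (simp add: k_def kappa_def)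
  have kQ: "k \<le> 2 * Q\<^sup>2"
  proof -
    have "kappa l \<mu> = l * (1 / \<mu>)" by (simp add: kappa_def)
    also have "\<dots> \<le> Q * Q" using lQ \<mu> l Q1 by (intro mult_mono) auto
    finally have "kappa l \<mu> \<le> Q\<^sup>2" by (simp add: power2_eq_square)
    moreover have "1 \<le> Q\<^sup>2" using Q1 by simp
    ultimately show ?thesis by (simp add: k_def)
  qed
  define R where "R = sqrt (L2 l \<mu> \<rho>)"
  have L2: "L2 l \<mu> \<rho> = \<rho> * k ^ 3" by (simp add: L2_def k_def)
  have R0: "0 < R" using \<rho> k2 by (simp add: R_def L2)
  have RQ: "R \<le> 3 * Q ^ 4"
  proof -
    have "L2 l \<mu> \<rho> \<le> Q * (2 * Q\<^sup>2) ^ 3"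
      unfolding L2 using lQ kQ k2 \<rho> Q1 by (intro mult_mono power_mono) auto
    also have "\<dots> = 8 * Q ^ 7" by (simp add: power_mult_distrib flip: power_mult power_Suc)
    \<comment> \<open>Rounded up to a perfect square for the root that follows.\<close>
    also have "\<dots> \<le> 9 * Q ^ 8" using Q1 by (intro mult_mono power_increasing) auto
    also have "\<dots> = (3 * Q ^ 4)\<^sup>2" by (simp add: power_mult_distrib flip: power_mult)
    finally show ?thesis unfolding R_def using Q1 by (intro real_le_lsqrt) auto
  qed
  have LR: "L1 l \<mu> / R \<le> Q\<^sup>2"
  proof -
    have "k\<^sup>2 / Q \<le> k ^ 3 * \<rho>"
    proof -
      have "1 / Q \<le> \<rho>" using lQ(4) \<rho> Q1 by (simp add: field_simps)
      moreover have "k\<^sup>2 \<le> k ^ 3" using k2 by (intro power_increasing) auto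
      ultimately have "k\<^sup>2 * (1 / Q) \<le> k ^ 3 * \<rho>" using Q1 \<rho> k2 by (intro mult_mono) auto
      then show ?thesis by simp
    qed
    then have "(k / sqrt Q)\<^sup>2 \<le> L2 l \<mu> \<rho>" using Q1 by (simp add: L2 power_divide mult.commute)
    then have kR: "k / sqrt Q \<le> R" unfolding R_def by (rule real_le_rsqrt)
    have "k / Q \<le> k / sqrt Q"
    proof (rule divide_left_mono)
      show "sqrt Q \<le> Q" using Q1 by (simp add: real_le_lsqrt power2_eq_square)
    qed (use k2 Q1 in auto)
    with kR have "k / Q \<le> R" by linarith
    then have "k \<le> R * Q" using Q1 by (simp add: field_simps)
    then have "L1 l \<mu> \<le> (R * Q) * Q" unfolding L1_def using lQ l k2 R0 Q1 k_def by (intro mult_mono) auto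
    then show ?thesis using R0 by (simp add: field_simps power2_eq_square)
  qed
  define C where "C = Cbar l \<mu> \<rho> D"
  have C0: "0 \<le> C" by (simp add: C_def Cbar_def)
  have Cle: "C \<le> 1 + 108 * Q ^ 4 * D"
  proof -
    have "C \<le> 1 + 36 * R * D"
      unfolding C_def Cbar_def R_def using R0 D by (intro powr_le_one_plus) (auto simp: R_def)
    also have "36 * R * D \<le> 36 * (3 * Q ^ 4) * D" using RQ D by (intro mult_right_mono mult_left_mono) auto
    finally show ?thesis by simp
  qed
  have Cs: "C powr (1/2) \<le> 1 + C" using C0 by (intro powr_le_one_plus) auto
  have Qp: "1 \<le> Q ^ 6" "Q\<^sup>2 \<le> Q ^ 6" "Q ^ 4 \<le> Q ^ 6" using Q1 by (auto intro!: power_increasing)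
  have t1: "41 / 9 * C \<le> (12 + 1000 * D) * Q ^ 6"
  proof -
    have "41 / 9 * C \<le> 5 * (1 + 108 * Q ^ 4 * D)" using Cle C0 by simp
    also have "\<dots> \<le> 5 * (Q ^ 6 + 108 * Q ^ 6 * D)"
      using Qp D by (intro mult_left_mono add_mono mult_right_mono) auto
    also have "\<dots> \<le> (12 + 1000 * D) * Q ^ 6" using D Q1 by (simp add: algebra_simps)
    finally show ?thesis .
  qed
  have t3: "2 + L1 l \<mu> / R \<le> (12 + 1000 * D) * Q ^ 6"
  proof -
    have "2 + L1 l \<mu> / R \<le> 12 * Q ^ 6" using LR Qp by linarith
    also have "\<dots> \<le> (12 + 1000 * D) * Q ^ 6" using D Q1 by (intro mult_right_mono) auto
    finally show ?thesis .
  qed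
  have t2: "1 + L1 l \<mu> / R * C powr (1/2) + C \<le> (12 + 1000 * D) * Q ^ 6"
  proof -
    have "L1 l \<mu> / R * C powr (1/2) \<le> Q\<^sup>2 * (2 + 108 * Q ^ 4 * D)"
      using LR Cs Cle by (intro mult_mono) auto
    also have "\<dots> = 2 * Q\<^sup>2 + 108 * Q ^ 6 * D" by (simp add: algebra_simps flip: power_add)
    finally have "1 + L1 l \<mu> / R * C powr (1/2) + C \<le> 1 + (2 * Q\<^sup>2 + 108 * Q ^ 6 * D) + (1 + 108 * Q ^ 4 * D)"
      using Cle by linarith
    also have "\<dots> \<le> Q ^ 6 + (2 * Q ^ 6 + 108 * Q ^ 6 * D) + (Q ^ 6 + 108 * Q ^ 6 * D)"
      using Qp D by (intro add_mono mult_left_mono mult_right_mono) auto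
    also have "\<dots> \<le> (12 + 1000 * D) * Q ^ 6" using D Q1 by (simp add: algebra_simps)
    finally show ?thesis .
  qed
  have "Gbar l \<mu> \<rho> D \<le> (12 + 1000 * D) * Q ^ 6"
    unfolding Gbar_def R_def[symmetric] C_def[symmetric] using t1 t2 t3 by simp
  moreover have "2 \<le> Gbar l \<mu> \<rho> D" by (rule Gbar_ge_2) fact+
  ultimately have "ln (Gbar l \<mu> \<rho> D) \<le> ln ((12 + 1000 * D) * Q ^ 6)" by simp
  also have "\<dots> = ln (12 + 1000 * D) + 6 * \<Lambda>" using D Q1 by (simp add: ln_mult ln_realpow Q_def)
  finally show ?thesis .
qed

text \<open>\<open>D\<close> is fixed and may enter the constants. As
  \<open>1 + kappa l \<mu> \<le> 2 * (l / \<mu>)\<close>, the root of \<open>L2\<close> is at most 8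
  times the part of \<open>X\<close> without \<open>\<epsilon>\<close>; the single logarithm in the
  bound needs only the exponent \<open>k = 1\<close>.\<close>

lemma outer_bound_soft_O:
  assumes D: "0 \<le> D"
  shows "soft_O (outer_bound D) (\<lambda>l \<mu> \<rho> \<epsilon>. l powr (3/2) * \<rho> powr (1/2) * \<mu> powr (-3/2) * \<epsilon> powr (-3/2))"
proof -
  define c where "c = 36 * 8 * D / ln 2"
  have c: "0 \<le> c" using D by (simp add: c_def)
  \<comment> \<open>The 8 collects 6 from \<open>ln_Gbar_le\<close> and 1 each for
    \<open>ln 2\<close> and \<open>\<bar>ln \<epsilon>\<bar>\<close>.\<close>
  define b where "b = ln (12 + 1000 * D) + 8"
  show ?thesis unfolding soft_O_def
  proof (intro exI allI impI)
    fix l \<mu> \<rho> \<epsilon> :: real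
    assume as: "0 < \<mu> \<and> \<mu> \<le> l \<and> 0 < \<rho> \<and> 0 < \<epsilon>"
    define X where "X = l powr (3/2) * \<rho> powr (1/2) * \<mu> powr (-3/2) * \<epsilon> powr (-3/2)"
    define \<Lambda> where "\<Lambda> = 1 + \<bar>ln l\<bar> + \<bar>ln \<mu>\<bar> + \<bar>ln \<rho>\<bar> + \<bar>ln \<epsilon>\<bar>"
    have \<Lambda>: "1 \<le> \<Lambda>" by (simp add: \<Lambda>_def)
    have l: "0 < l" using as by linarith
    have G2: "2 \<le> Gbar l \<mu> \<rho> D" using as by (intro Gbar_ge_2) auto
    have lnG: "ln (Gbar l \<mu> \<rho> D) \<le> ln (12 + 1000 * D) + 6 * \<Lambda>"
      using as D by (intro ln_Gbar_le) (auto simp: \<Lambda>_def)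
    define Lg where "Lg = ln (2 * Gbar l \<mu> \<rho> D / \<epsilon>)"
    have "Lg = ln 2 + ln (Gbar l \<mu> \<rho> D) - ln \<epsilon>"
      using G2 as by (simp add: Lg_def ln_mult ln_div)
    moreover have "0 \<le> ln (Gbar l \<mu> \<rho> D)" using G2 by simp
    moreover have "\<bar>ln \<epsilon>\<bar> \<le> \<Lambda>" "0 \<le> ln (12 + 1000 * D)" using D by (auto simp: \<Lambda>_def)
    moreover have "ln 2 \<le> (1::real)" using ln_le_minus_one[of 2] by simp
    moreover have "0 \<le> ln (2::real)" by simp
    ultimately have "\<bar>Lg\<bar> \<le> ln (12 + 1000 * D) + 8 * \<Lambda>" using lnG \<Lambda> by linarith
    also have "\<dots> \<le> b * \<Lambda>"
      using mult_left_mono[OF \<Lambda>, of "ln (12 + 1000 * D)"] D by (simp add: b_def algebra_simps)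
    finally have Lg: "\<bar>Lg\<bar> \<le> b * \<Lambda>" .
    have C1: "Cbar1 l \<mu> \<rho> D * \<epsilon> powr (-3/2) \<le> c * X"
    proof -
      have "1 + kappa l \<mu> \<le> 2 * (l / \<mu>)" using as by (simp add: kappa_def field_simps)
      moreover have "0 \<le> 1 + kappa l \<mu>" using as l by (simp add: kappa_def)
      ultimately have "L2 l \<mu> \<rho> \<le> \<rho> * (2 * (l / \<mu>)) ^ 3"
        unfolding L2_def using as by (intro mult_left_mono power_mono) auto
      also have "\<dots> \<le> \<rho> * (64 * (l / \<mu>) ^ 3)"
        unfolding power_mult_distrib using as l by (intro mult_left_mono mult_right_mono) auto
      also have "\<dots> = (8 * (l powr (3/2) * \<rho> powr (1/2) * \<mu> powr (-3/2)))\<^sup>2"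
      proof -
        have sq: "(z powr (3/2))\<^sup>2 = z ^ 3" if "0 < z" for z :: real
          using that powr_add[of z "3/2" "3/2"] by (simp add: power2_eq_square)
        have "(\<mu> powr (-3/2))\<^sup>2 = 1 / \<mu> ^ 3"
          using as sq[of \<mu>] by (simp add: powr_minus_divide power_divide)
        moreover have "(\<rho> powr (1/2))\<^sup>2 = \<rho>" using as by (simp add: powr_half_sqrt)
        ultimately show ?thesis using sq[OF l] by (simp add: power_mult_distrib power_divide)
      qed
      finally have "sqrt (L2 l \<mu> \<rho>) \<le> 8 * (l powr (3/2) * \<rho> powr (1/2) * \<mu> powr (-3/2))"
        by (rule real_le_lsqrt[rotated]) simp
      then have "36 * D / ln 2 * \<epsilon> powr (-3/2) * sqrt (L2 l \<mu> \<rho>)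
          \<le> 36 * D / ln 2 * \<epsilon> powr (-3/2) * (8 * (l powr (3/2) * \<rho> powr (1/2) * \<mu> powr (-3/2)))"
        using D by (intro mult_left_mono) auto
      then show ?thesis by (simp add: Cbar1_def c_def X_def mult_ac)
    qed
    have C10: "0 \<le> Cbar1 l \<mu> \<rho> D * \<epsilon> powr (-3/2)"
      using as D l by (simp add: Cbar1_def L2_def kappa_def)
    have "\<bar>outer_bound D l \<mu> \<rho> \<epsilon>\<bar> \<le> \<bar>Cbar1 l \<mu> \<rho> D * \<epsilon> powr (-3/2) * Lg\<bar> + 1"
      using outer_bound_eq[of l \<mu> \<rho> D \<epsilon>] G2 as unfolding Lg_def[symmetric] by simp
    also have "\<bar>Cbar1 l \<mu> \<rho> D * \<epsilon> powr (-3/2) * Lg\<bar> = Cbar1 l \<mu> \<rho> D * \<epsilon> powr (-3/2) * \<bar>Lg\<bar>"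
      by (simp only: abs_mult[of _ Lg] abs_of_nonneg[OF C10])
    also have "\<dots> \<le> (c * max 1 X) * (b * \<Lambda>)"
    proof (rule mult_mono[OF _ Lg])
      have "c * X \<le> c * max 1 X" using c by (intro mult_left_mono) auto
      then show "Cbar1 l \<mu> \<rho> D * \<epsilon> powr (-3/2) \<le> c * max 1 X" using C1 by linarith
    qed (use c in auto)
    finally have "\<bar>outer_bound D l \<mu> \<rho> \<epsilon>\<bar> \<le> (c * max 1 X) * (b * \<Lambda>) + 1" by simp
    moreover have "1 \<le> max 1 X * \<Lambda>" using mult_mono[of 1 "max 1 X" 1 \<Lambda>] \<Lambda> by simp
    ultimately have "\<bar>outer_bound D l \<mu> \<rho> \<epsilon>\<bar> \<le> (c * b + 1) * max 1 X * \<Lambda> ^ 1"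
      by (simp add: algebra_simps)
    then show "\<bar>outer_bound D l \<mu> \<rho> \<epsilon>\<bar> \<le> (c * b + 1) * max 1 (l powr (3/2) * \<rho> powr (1/2) * \<mu> powr (-3/2) * \<epsilon> powr (-3/2))
        * (1 + \<bar>ln l\<bar> + \<bar>ln \<mu>\<bar> + \<bar>ln \<rho>\<bar> + \<bar>ln \<epsilon>\<bar>) ^ 1"
      unfolding X_def \<Lambda>_def .
  qed
qed

section \<open>Outer and inner iteration counts of a run\<close>

context lmnegcur_run
begin

text \<open>Stated for any \<open>n\<close> with no qualifying point before it rather than for the
  first such point, so that it also refutes infinite runs that never reach one. The two bounds on
  \<open>\<epsilon>\<close> provide \<open>3 \<le> Lg\<close> and \<open>12 \<le> K\<close> in the
  final comparison.\<close>

lemma iterations_before_approx_point: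
  assumes n: "enat n \<le> \<tau>"
    and bad: "\<And>t. t < n \<Longrightarrow> \<not> approx_second_order_point f (\<xi> * \<epsilon>) (\<theta> * sqrt \<epsilon>) (x t)"
    and \<xi>: "5 \<le> \<xi>" and \<theta>: "2 * sqrt M \<le> \<theta>"
    and \<epsilon>: "\<epsilon> \<le> 1 / 2" "P x0 \<noteq> Pstar \<Longrightarrow> \<epsilon> * sqrt \<epsilon> \<le> 3 * sqrt M * (P x0 - Pstar)"
  shows "real n \<le> outer_bound (P x0 - Pstar) l \<mu> \<rho> \<epsilon>"
    and "t < n \<Longrightarrow> norm (s t) \<le> 2 * sqrt (Gbar l \<mu> \<rho> (P x0 - Pstar)) / sqrt M"
proof -
  define D where "D = P x0 - Pstar"
  define G where "G = Gbar l \<mu> \<rho> D"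
  have D0: "0 \<le> D" using Pstar_le by (simp add: D_def)
  have sM: "0 < sqrt M" using constants_pos by simp
  have e: "0 < \<epsilon> * sqrt \<epsilon>" using eps_pos by simp
  have G2: "2 \<le> G" unfolding G_def using mu_pos mu_le_l rho_pos by (rule Gbar_ge_2)
  have active: "enat t < \<tau>" if "t < n" for t
    using that n by (metis enat_ord_simps(2) order_less_le_trans)
  have far: "neg_curvature M \<epsilon> (g t) (H t) \<or> 4 * \<epsilon> \<le> norm (g t)" if "t < n" for t
    using approx_point_if_flat[OF less_imp_le[OF active[OF that]] _ _ \<xi> \<theta>] bad[OF that] by fastforce
  have mono: "P (x t) \<le> P x0" if "t \<le> n" for t
    using that
  proof (induction t)
    case (Suc t)
    then show ?case using iteration_progress(1)[OF active far, of t] by simp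
  qed (simp add: run_start)
  have gG: "max (norm (g t)) \<epsilon> \<le> G" if "t \<le> n" for t
    unfolding G_def D_def
  proof (rule gradient_le_Gbar)
    show "enat t \<le> \<tau>" using that n by (meson enat_ord_simps(1) order_trans)
  qed (rule mono[OF that])
  show "norm (s t) \<le> 2 * sqrt (Gbar l \<mu> \<rho> (P x0 - Pstar)) / sqrt M" if "t < n"
  proof -
    have "norm (s t) \<le> 2 * (sqrt (max (norm (g t)) \<epsilon>) / sqrt M)"
      using iteration_progress(3)[OF active far] that by simp
    also have "\<dots> \<le> 2 * (sqrt G / sqrt M)"
      using gG[of t] that sM by (intro mult_left_mono divide_right_mono) auto
    finally show ?thesis by (simp add: G_def D_def)
  qed
  show "real n \<le> outer_bound (P x0 - Pstar) l \<mu> \<rho> \<epsilon>"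
  proof (cases "n = 0")
    case True
    then show ?thesis
      using outer_bound_nonneg[OF mu_pos mu_le_l rho_pos D0 eps_pos] by (simp add: D_def)
  next
    case False
    \<comment> \<open>One completed step strictly lowers \<open>P\<close>, so the gap is positive
      and the conditional bound on \<open>\<epsilon>\<close> becomes available.\<close>
    then have "P (x (Suc 0)) < P x0"
      using iteration_progress(1)[OF active far, of 0] run_start by simp
    then have D: "0 < D" using Pstar_le[of "x (Suc 0)"] by (simp add: D_def)
    define c where "c = \<epsilon> * sqrt \<epsilon> / (24 * sqrt M)"
    define Lg where "Lg = log 2 (2 * G / \<epsilon>)"
    have "real n \<le> (P (x 0) - Pstar) / c * (Lg + 1) + Lg"
      unfolding Lg_def
    proof (rule count_geometric_phases[where p = "\<lambda>t. P (x t)" and \<gamma> = "\<lambda>t. norm (g t)"])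
      show "0 < c" using e sM by (simp add: c_def)
      show "\<epsilon> \<le> 2 * G" using G2 eps_le_1 by linarith
      show "P (x (Suc t)) \<le> P (x t) - c \<or>
          \<epsilon> \<le> norm (g t) \<and> norm (g (Suc t)) \<le> norm (g t) / 2 \<and> P (x (Suc t)) \<le> P (x t)" if "t < n" for t
        using iteration_progress(1,2)[OF active[OF that] far[OF that]] by (auto simp: c_def)
      show "norm (g t) \<le> G" if "t \<le> n" for t using gG[OF that] by simp
    qed (rule eps_pos Pstar_le)+
    moreover define K where "K = 36 * sqrt M * D / (\<epsilon> * sqrt \<epsilon>)"
    moreover have "(P (x 0) - Pstar) / c = 2 / 3 * K"
      using sM e by (simp add: run_start D_def[symmetric] c_def K_def)
    ultimately have n_le: "real n \<le> 2 / 3 * K * (Lg + 1) + Lg" by simp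
    have K12: "12 \<le> K"
      using \<epsilon>(2) D e by (simp add: K_def D_def le_divide_eq mult_ac)
    have "2 powr 3 \<le> 2 * G / \<epsilon>"
    proof -
      have "8 * \<epsilon> \<le> 2 * G" using \<epsilon>(1) G2 by linarith
      then show ?thesis using eps_pos by (simp add: le_divide_eq)
    qed
    then have Lg3: "3 \<le> Lg" unfolding Lg_def using G2 eps_pos by (subst le_log_iff) auto
    \<comment> \<open>2/3 is 24/36. The remaining third of \<open>K * Lg\<close> covers
      \<open>2 / 3 * K \<le> 2 / 9 * (K * Lg)\<close> and
      \<open>Lg \<le> K * Lg / 12\<close>.\<close>
    have "2 / 3 * K * (Lg + 1) + Lg \<le> K * Lg"
    proof -
      have "K * 3 \<le> K * Lg" "12 * Lg \<le> K * Lg" using K12 Lg3 by (intro mult_left_mono mult_right_mono; simp)+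
      moreover have "2 / 3 * K * (Lg + 1) = 2 / 3 * (K * Lg) + 2 / 3 * K" by (simp only: distrib_left mult.assoc mult_1_right)
      ultimately show ?thesis using Lg3 by linarith
    qed
    with n_le have "real n \<le> K * Lg" by linarith
    also have "K * Lg = Cbar1 l \<mu> \<rho> D * \<epsilon> powr (-3/2) * ln (2 * G / \<epsilon>)"
      using powr_minus_divide[of \<epsilon> "3/2"]
      by (simp add: K_def Lg_def Cbar1_def log_def eps_powr)
    also have "\<dots> \<le> outer_bound D l \<mu> \<rho> \<epsilon>"
      using outer_bound_eq[of l \<mu> \<rho> D \<epsilon>] G2 eps_pos by (simp add: G_def)
    finally show ?thesis by (simp add: D_def)
  qed
qed

lemma inner_lower_le:
  assumes "1 \<le> t" and s: "norm (s (t - 1)) \<le> 2 * sqrt G / sqrt M"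
  shows "inner_lower l \<mu> \<rho> \<epsilon> d s t \<le> 2 * sqrt \<kappa> * ln (sqrt (\<kappa> + 1) * (A + 2 * \<kappa> * sqrt G / sqrt M) / A)"
proof -
  have \<kappa>: "0 < \<kappa>" using kappa_ge_1 by simp
  have "\<kappa> * norm (s (t - 1)) \<le> 2 * \<kappa> * sqrt G / sqrt M"
    using mult_left_mono[OF s less_imp_le[OF \<kappa>]] by (simp add: mult_ac)
  then have le: "sqrt (\<kappa> + 1) * (A + \<kappa> * norm (s (t - 1))) / A \<le> sqrt (\<kappa> + 1) * (A + 2 * \<kappa> * sqrt G / sqrt M) / A"
    using A_pos \<kappa> by (intro divide_right_mono mult_left_mono) auto
  have pos: "0 < sqrt (\<kappa> + 1) * (A + \<kappa> * norm (s (t - 1))) / A"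
    using A_pos \<kappa> by (intro divide_pos_pos mult_pos_pos add_pos_nonneg) auto
  from ln_mono[OF le pos] show ?thesis
    using assms \<kappa> by (simp add: inner_lower_def Let_def)
qed

lemma sum_inner_lower_le:
  assumes "\<And>t. t < T \<Longrightarrow> norm (s t) \<le> 2 * sqrt G / sqrt M"
  shows "(\<Sum>t=0..T. inner_lower l \<mu> \<rho> \<epsilon> d s t)
    \<le> 2 * sqrt \<kappa> * ln (sqrt (\<kappa> + 1) * d / A)
      + 2 * sqrt \<kappa> * real T * ln (sqrt (\<kappa> + 1) * (A + 2 * \<kappa> * sqrt G / sqrt M) / A)"
proof -
  have "(\<Sum>t=0..T. inner_lower l \<mu> \<rho> \<epsilon> d s t)
      = inner_lower l \<mu> \<rho> \<epsilon> d s 0 + (\<Sum>t=1..T. inner_lower l \<mu> \<rho> \<epsilon> d s t)"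
    by (simp add: sum.atLeast_Suc_atMost)
  moreover have "(\<Sum>t=1..T. inner_lower l \<mu> \<rho> \<epsilon> d s t)
      \<le> real (card {1..T}) * (2 * sqrt \<kappa> * ln (sqrt (\<kappa> + 1) * (A + 2 * \<kappa> * sqrt G / sqrt M) / A))"
    by (intro sum_bounded_above inner_lower_le assms) auto
  ultimately show ?thesis by (simp add: inner_lower_def Let_def mult_ac)
qed

end

theorem theorem3p1:
  fixes f :: "(real^'n) \<times> (real^'m) \<Rightarrow> real"
    and l \<mu> \<rho> Pstar :: real
    and x0 :: "real^'n" and ym1 :: "real^'m"
  assumes "\<mu> > 0" and "\<rho> > 0"
    and "\<And>z. f differentiable (at z)" and "continuous_on UNIV (grad f)"
    and "\<And>x. strongly_concave \<mu> (\<lambda>y. f (x, y))"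
    and "l-lipschitz_on UNIV (grad f)"
    and "second_partials_exist f"
    and "spectral_lipschitz \<rho> (hess_xx f)" and "spectral_lipschitz \<rho> (hess_xy f)"
    and "spectral_lipschitz \<rho> (hess_yx f)" and "spectral_lipschitz \<rho> (hess_yy f)"
    and "\<And>x. Pstar \<le> primal f x"
  shows "(\<exists>\<xi>>0. \<exists>\<theta>>0. \<forall>\<epsilon>>0. \<forall>N \<tau> x y u s.
           LMNegCur f (L2 l \<mu> \<rho>) (1 / l) ((sqrt (kappa l \<mu>) - 1) / (sqrt (kappa l \<mu>) + 1))
             N \<epsilon> x0 ym1 \<tau> x y u s \<and>
           (\<forall>t. enat t \<le> \<tau> \<longrightarrow>
              real (N t) \<ge> inner_lower l \<mu> \<rho> \<epsilon> (norm (ym1 - ystar f x0)) s t)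
           \<longrightarrow>
           (\<exists>T. enat T \<le> \<tau> \<and>
              approx_second_order_point f (\<xi> * \<epsilon>) (\<theta> * sqrt \<epsilon>) (x T) \<and>
              (\<forall>t<T. \<not> approx_second_order_point f (\<xi> * \<epsilon>) (\<theta> * sqrt \<epsilon>) (x t)) \<and>
              real T \<le> outer_bound (primal f x0 - Pstar) l \<mu> \<rho> \<epsilon> \<and>
              (\<Sum>t=0..T. inner_lower l \<mu> \<rho> \<epsilon> (norm (ym1 - ystar f x0)) s t)
                \<le> 2 * sqrt (kappa l \<mu>)
                     * ln (sqrt (kappa l \<mu> + 1) * norm (ym1 - ystar f x0) / Acc l \<mu> \<rho> \<epsilon>)
                   + 2 * sqrt (kappa l \<mu>) * real T
                     * ln (sqrt (kappa l \<mu> + 1)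
                         * (Acc l \<mu> \<rho> \<epsilon> + 2 * kappa l \<mu> * sqrt (Gbar l \<mu> \<rho> (primal f x0 - Pstar))
                              / sqrt (L2 l \<mu> \<rho>)) / Acc l \<mu> \<rho> \<epsilon>)))
         \<and> soft_O (outer_bound (primal f x0 - Pstar))
             (\<lambda>l \<mu> \<rho> \<epsilon>. l powr (3/2) * \<rho> powr (1/2) * \<mu> powr (-3/2) * \<epsilon> powr (-3/2))"
proof
  interpret nonconvex_strongly_concave f l \<mu> \<rho>
    using assms by unfold_locales
  note Pstar = assms(12)
  define D where "D = P x0 - Pstar"
  have D0: "0 \<le> D" using Pstar by (simp add: D_def)
  show "soft_O (outer_bound (P x0 - Pstar))
      (\<lambda>l \<mu> \<rho> \<epsilon>. l powr (3/2) * \<rho> powr (1/2) * \<mu> powr (-3/2) * \<epsilon> powr (-3/2))"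
    using outer_bound_soft_O[OF D0] by (simp add: D_def)
  have sM: "0 < sqrt M" using constants_pos by simp
  \<comment> \<open>Below this threshold both bounds on \<open>\<epsilon>\<close> required by
    \<open>iterations_before_approx_point\<close> hold; the power 2/3 inverts
    \<open>\<epsilon> powr (3/2)\<close>.\<close>
  define \<epsilon>0 where "\<epsilon>0 = (if D = 0 then 1 / 2 else min (1 / 2) ((3 * sqrt M * D) powr (2/3)))"
  have \<epsilon>0: "0 < \<epsilon>0" "\<epsilon>0 \<le> 1 / 2" using sM D0 by (auto simp: \<epsilon>0_def)
  have \<epsilon>0_gap: "\<epsilon> * sqrt \<epsilon> \<le> 3 * sqrt M * D" if "0 < \<epsilon>" "\<epsilon> < \<epsilon>0" "D \<noteq> 0" for \<epsilon>
  proof -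
    have pos: "0 < 3 * sqrt M * D" using sM D0 that by simp
    have "\<epsilon> * sqrt \<epsilon> = \<epsilon> powr (3/2)"
      using that powr_add[of \<epsilon> 1 "1/2"] by (simp add: powr_half_sqrt)
    also have "\<dots> \<le> ((3 * sqrt M * D) powr (2/3)) powr (3/2)"
      using that by (intro powr_mono2) (auto simp: \<epsilon>0_def)
    also have "\<dots> = 3 * sqrt M * D" using pos by (simp add: powr_powr)
    finally show ?thesis .
  qed
  \<comment> \<open>In \<open>\<xi>\<close> and \<open>\<theta>\<close>, the first entry is what
    \<open>approx_point_if_flat\<close> asks for, and the second makes \<open>x0\<close> qualify
    whenever \<open>\<epsilon> \<ge> \<epsilon>0\<close>, with \<open>L1\<close> bounding the
    Hessian of \<open>P\<close>.\<close>
  define \<xi> where "\<xi> = max 5 (norm (grad P x0) / \<epsilon>0)"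
  define \<theta> where "\<theta> = max (2 * sqrt M) (L1 l \<mu> / sqrt \<epsilon>0)"
  show "\<exists>\<xi>>0. \<exists>\<theta>>0. \<forall>\<epsilon>>0. \<forall>N \<tau> x y u s.
           LMNegCur f (L2 l \<mu> \<rho>) (1 / l) ((sqrt (kappa l \<mu>) - 1) / (sqrt (kappa l \<mu>) + 1))
             N \<epsilon> x0 ym1 \<tau> x y u s \<and>
           (\<forall>t. enat t \<le> \<tau> \<longrightarrow>
              real (N t) \<ge> inner_lower l \<mu> \<rho> \<epsilon> (norm (ym1 - ystar f x0)) s t)
           \<longrightarrow>
           (\<exists>T. enat T \<le> \<tau> \<and>
              approx_second_order_point f (\<xi> * \<epsilon>) (\<theta> * sqrt \<epsilon>) (x T) \<and>
              (\<forall>t<T. \<not> approx_second_order_point f (\<xi> * \<epsilon>) (\<theta> * sqrt \<epsilon>) (x t)) \<and>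
              real T \<le> outer_bound (primal f x0 - Pstar) l \<mu> \<rho> \<epsilon> \<and>
              (\<Sum>t=0..T. inner_lower l \<mu> \<rho> \<epsilon> (norm (ym1 - ystar f x0)) s t)
                \<le> 2 * sqrt (kappa l \<mu>)
                     * ln (sqrt (kappa l \<mu> + 1) * norm (ym1 - ystar f x0) / Acc l \<mu> \<rho> \<epsilon>)
                   + 2 * sqrt (kappa l \<mu>) * real T
                     * ln (sqrt (kappa l \<mu> + 1)
                         * (Acc l \<mu> \<rho> \<epsilon> + 2 * kappa l \<mu> * sqrt (Gbar l \<mu> \<rho> (primal f x0 - Pstar))
                              / sqrt (L2 l \<mu> \<rho>)) / Acc l \<mu> \<rho> \<epsilon>))"
  proof ((rule exI[of _ \<xi>], rule conjI[OF _ exI[of _ \<theta>]]); (intro conjI allI impI)?)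
    show "0 < \<xi>" by (simp add: \<xi>_def)
    show "0 < \<theta>" using sM by (simp add: \<theta>_def less_max_iff_disj)
    fix \<epsilon> N \<tau> x y u s
    assume \<epsilon>: "0 < (\<epsilon>::real)" and "LMNegCur f M (1 / l) ((sqrt \<kappa> - 1) / (sqrt \<kappa> + 1)) N \<epsilon> x0 ym1 \<tau> x y u s \<and>
      (\<forall>t. enat t \<le> \<tau> \<longrightarrow> inner_lower l \<mu> \<rho> \<epsilon> (norm (ym1 - ys x0)) s t \<le> real (N t))"
    then have run: "LMNegCur f M (1 / l) ((sqrt \<kappa> - 1) / (sqrt \<kappa> + 1)) N \<epsilon> x0 ym1 \<tau> x y u s"
      and inner: "\<And>t. enat t \<le> \<tau> \<Longrightarrow> inner_lower l \<mu> \<rho> \<epsilon> (norm (ym1 - ys x0)) s t \<le> real (N t)"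
      by auto
    let ?Q = "\<lambda>t. approx_second_order_point f (\<xi> * \<epsilon>) (\<theta> * sqrt \<epsilon>) (x t)"
    show "\<exists>T. enat T \<le> \<tau> \<and> ?Q T \<and> (\<forall>t<T. \<not> ?Q t) \<and>
              real T \<le> outer_bound (P x0 - Pstar) l \<mu> \<rho> \<epsilon> \<and>
              (\<Sum>t=0..T. inner_lower l \<mu> \<rho> \<epsilon> (norm (ym1 - ys x0)) s t)
                \<le> 2 * sqrt \<kappa> * ln (sqrt (\<kappa> + 1) * norm (ym1 - ys x0) / Acc l \<mu> \<rho> \<epsilon>)
                   + 2 * sqrt \<kappa> * real T
                     * ln (sqrt (\<kappa> + 1) * (Acc l \<mu> \<rho> \<epsilon> + 2 * \<kappa> * sqrt (Gbar l \<mu> \<rho> (P x0 - Pstar)) / sqrt M) / Acc l \<mu> \<rho> \<epsilon>)"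
    proof (cases "\<epsilon> < \<epsilon>0")
      case False
      have "?Q 0" unfolding approx_second_order_point_iff
      proof (intro conjI allI)
        have x0: "x 0 = x0" using run by (simp add: LMNegCur_def)
        have "norm (grad P x0) / \<epsilon>0 * \<epsilon>0 \<le> \<xi> * \<epsilon>"
          using False \<epsilon>0 \<epsilon> by (intro mult_mono) (auto simp: \<xi>_def)
        then show "norm (grad P (x 0)) \<le> \<xi> * \<epsilon>" using \<epsilon>0 by (simp add: x0)
        fix v :: "real^'n"
        have "L1 l \<mu> / sqrt \<epsilon>0 * sqrt \<epsilon>0 \<le> \<theta> * sqrt \<epsilon>"
          using False \<epsilon>0 \<epsilon> sM by (intro mult_mono) (auto simp: \<theta>_def le_max_iff_disj)
        then have "L1 l \<mu> * (norm v)\<^sup>2 \<le> \<theta> * sqrt \<epsilon> * (norm v)\<^sup>2"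
          using \<epsilon>0 by (intro mult_right_mono) auto
        moreover have "- (v \<bullet> (S (x 0, ys (x 0)) *v v)) \<le> norm v * (L1 l \<mu> * norm v)"
          using Cauchy_Schwarz_ineq2[of v "S (x 0, ys (x 0)) *v v"]
            mult_left_mono[OF S_bound[of "(x 0, ys (x 0))" v] norm_ge_zero[of v]] by linarith
        ultimately show "- (\<theta> * sqrt \<epsilon>) * (norm v)\<^sup>2 \<le> v \<bullet> (S (x 0, ys (x 0)) *v v)"
          by (simp add: power2_eq_square mult_ac)
      qed
      \<comment> \<open>With \<open>T = 0\<close> the sum consists of its first term, which is the
        first summand of the bound.\<close>
      then show ?thesis
        using outer_bound_nonneg[OF mu_pos mu_le_l rho_pos D0 \<epsilon>]
        by (intro exI[of _ 0]) (simp add: D_def inner_lower_def Let_def zero_enat_def[symmetric])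
    next
      case True
      interpret lmnegcur_run f l \<mu> \<rho> Pstar \<epsilon> x0 ym1 N \<tau> x y u s
        by unfold_locales (use True \<epsilon>0 \<epsilon> run inner Pstar in auto)
      have \<xi>5: "5 \<le> \<xi>" and \<theta>2: "2 * sqrt M \<le> \<theta>" by (simp_all add: \<xi>_def \<theta>_def)
      have half: "\<epsilon> \<le> 1 / 2" using True \<epsilon>0 by linarith
      have gap: "P x0 \<noteq> Pstar \<Longrightarrow> \<epsilon> * sqrt \<epsilon> \<le> 3 * sqrt M * (P x0 - Pstar)"
        using \<epsilon>0_gap[OF \<epsilon> True] by (simp add: D_def)
      note bounds = iterations_before_approx_point[OF _ _ \<xi>5 \<theta>2 half gap]
      have "\<exists>t. enat t \<le> \<tau> \<and> ?Q t"
      proof (cases \<tau>)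
        \<comment> \<open>A finite run ends where the stopping test succeeds, which is stronger than
          the flatness required here.\<close>
        case (enat k)
        then have k: "enat k \<le> \<tau>" "enat k = \<tau>" by simp_all
        with run_iteration(5)[OF k(1)] eps_pos
        have "\<not> neg_curvature M \<epsilon> (g k) (H k)" "norm (g k) < 4 * \<epsilon>" by auto
        with k show ?thesis using approx_point_if_flat[OF k(1) _ _ \<xi>5 \<theta>2] by blast
      next
        case infinity
        show ?thesis
        proof (rule ccontr)
          assume no: "\<not> ?thesis"
          obtain n :: nat where "outer_bound (P x0 - Pstar) l \<mu> \<rho> \<epsilon> < real n"
            using reals_Archimedean2 by blast
          moreover have "real n \<le> outer_bound (P x0 - Pstar) l \<mu> \<rho> \<epsilon>"
            by (rule bounds(1)) (use no infinity in auto)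
          ultimately show False by simp
        qed
      qed
      then obtain T where T: "enat T \<le> \<tau> \<and> ?Q T" and first: "\<And>t. t < T \<Longrightarrow> \<not> (enat t \<le> \<tau> \<and> ?Q t)"
        using exists_least_iff[of "\<lambda>t. enat t \<le> \<tau> \<and> ?Q t"] by blast
      have bad: "\<not> ?Q t" if "t < T" for t
        using first[OF that] T that by (meson enat_ord_simps(1) less_imp_le order_trans)
      show ?thesis
      proof (intro exI[of _ T] conjI allI impI)
        show "real T \<le> outer_bound (P x0 - Pstar) l \<mu> \<rho> \<epsilon>"
          by (rule bounds(1)) (use T bad in auto)
      qed (use T bad in \<open>auto intro!: sum_inner_lower_le bounds(2)[of T]\<close>)
    qed
  qed
qed

end
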